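(* Let $T,x_0,A^\star,B^\star,\bar\sigma,Q,S,R,p,q,M,\bar m$ satisfy the standing assumptions in the context. Then for all $k,K\in L^\infty([0,T];\mathbb R)$, $\lambda\in L^\infty([0,T];\mathbb R_{\ge0})$ and noise processes $\xi$ as in the context, with $\nu\sim\mathcal G(k,K,\lambda)$ and $\varphi\sim\mathcal R(k,K,\lambda,\xi)$, it holds almost surely that $$J^{\theta^\star}(\varphi)-\widetilde J^{\theta^\star}_0(\nu)=\int_0^Th_{1,t}\lambda_t\xi_t\,dt+\int_0^Th_{2,t}\lambda_t^2(\xi_t^2-1)\,dt+\int_0^T\!\!\int_0^Th_{3,t,r}\lambda_r\lambda_t\xi_r\xi_t\,dr\,dt,$$ where $h_1,h_2:[0,T]\to\mathbb R$ and $h_3:[0,T]^2\to\mathbb R$ are some bounded (deterministic, measurable) functions whose sup-norms depend only on the sup-norms of $k,K$ and on the model coefficients listed above.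
   Context: Standing assumptions: $T>0$, $x_0,A^\star,B^\star\in\mathbb R$, $\theta^\star=(A^\star,B^\star)$; $\bar\sigma,Q,S,R,p,q\in C([0,T];\mathbb R)$, $M\ge0$, $\bar m\in\mathbb R$, and for all $t\in[0,T]$: $\bar\sigma_t>0$, $R_t>0$, $Q_t-S_t^2R_t^{-1}\ge0$. Cost functions: $f(t,x,a)=Q_tx^2+2S_txa+R_ta^2+2p_tx+2q_ta$ and $g(x)=Mx^2+2\bar mx$. $(\Omega,\mathcal F,\mathbb P)$ is a complete probability space carrying a one-dimensional Brownian motion $W=(W_t)_{t\in[0,T]}$, and $\mathcal F_0\subset\mathcal F$ is a $\sigma$-algebra independent of $W$. Gaussian relaxed policy: $\nu\sim\mathcal G(k,K,\lambda)$ means $\nu:[0,T]\times\mathbb R\to\mathcal P(\mathbb R)$, $\nu(t,x)=\mathcal N(k_t+K_tx,\lambda_t^2)$. Its relaxed cost is $$\widetilde J^{\theta^\star}_0(\nu)=\mathbb E\Big[\int_0^T\!\!\int_{\mathbb R}f(t,X^\nu_t,a)\,\nu(t,X^\nu_t;da)\,dt+g(X^\nu_T)\Big],$$ where $dX^\nu_t=\int_{\mathbb R}(A^\star X^\nu_t+B^\star a)\,\nu(t,X^\nu_t;da)\,dt+\bar\sigma_t\,dW_t$, $X^\nu_0=x_0$. Randomised policy: the noise $\xi:\Omega\times[0,T]\to\mathbb R$ is a measurable process such that for each $t\in[0,T]$, $\xi_t$ is an $\mathcal F_0$-measurable standard normal random variable (no independence across time is required). $\varphi\sim\mathcal R(k,K,\lambda,\xi)$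 means $\varphi(\omega,t,x)=k_t+K_tx+\lambda_t\xi_t(\omega)$. Its cost is the random variable $$J^{\theta^\star}(\varphi)=\mathbb E\Big[\int_0^Tf\big(t,X^\varphi_t,\varphi(\cdot,t,X^\varphi_t)\big)dt+g(X^\varphi_T)\,\Big|\,\mathcal F_0\Big],$$ where $dX^\varphi_t=(A^\star X^\varphi_t+B^\star\varphi(\cdot,t,X^\varphi_t))dt+\bar\sigma_t\,dW_t$, $X^\varphi_0=x_0$. *)

theory Defs
  imports "HOL-Probability.Probability"
begin

definition brownian_motion :: "'w measure \<Rightarrow> real \<Rightarrow> (real \<Rightarrow> 'w \<Rightarrow> real) \<Rightarrow> bool" where
  "brownian_motion P T W \<longleftrightarrow>
     (\<forall>t\<in>{0..T}. W t \<in> borel_measurable P) \<and>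
     (AE \<omega> in P. W 0 \<omega> = 0) \<and>
     (AE \<omega> in P. continuous_on {0..T} (\<lambda>t. W t \<omega>)) \<and>
     (\<forall>s t. 0 \<le> s \<and> s < t \<and> t \<le> T \<longrightarrow>
        distributed P lborel (\<lambda>\<omega>. W t \<omega> - W s \<omega>) (normal_density 0 (sqrt (t - s)))) \<and>
     (\<forall>n (\<tau> :: nat \<Rightarrow> real).
        0 \<le> \<tau> 0 \<and> (\<forall>i<n. \<tau> i \<le> \<tau> (Suc i)) \<and> \<tau> n \<le> T \<longrightarrow>
        prob_space.indep_vars P (\<lambda>_. borel) (\<lambda>i \<omega>. W (\<tau> (Suc i)) \<omega> - W (\<tau> i) \<omega>) {..<n})"

definition path_events :: "'w measure \<Rightarrow> real \<Rightarrow> (real \<Rightarrow> 'w \<Rightarrow> real) \<Rightarrow> 'w set set" where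
  "path_events P t W = {W s -` B \<inter> space P | s B. s \<in> {0..t} \<and> B \<in> sets borel}"

definition indep_of_process ::
    "'w measure \<Rightarrow> real \<Rightarrow> (real \<Rightarrow> 'w \<Rightarrow> real) \<Rightarrow> 'w measure \<Rightarrow> bool" where
  "indep_of_process P T W F0 \<longleftrightarrow>
     prob_space.indep_set P (sets F0) (sigma_sets (space P) (path_events P T W))"

definition step_fun :: "nat \<Rightarrow> (nat \<Rightarrow> real) \<Rightarrow> (nat \<Rightarrow> real) \<Rightarrow> real \<Rightarrow> real" where
  "step_fun n \<tau> c s = (\<Sum>i<n. c i * indicator {\<tau> i<..\<tau> (Suc i)} s)"

definition step_integral ::
    "(real \<Rightarrow> 'w \<Rightarrow> real) \<Rightarrow> nat \<Rightarrow> (nat \<Rightarrow> real) \<Rightarrow> (nat \<Rightarrow> real) \<Rightarrow> 'w \<Rightarrow> real" where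
  "step_integral W n \<tau> c \<omega> = (\<Sum>i<n. c i * (W (\<tau> (Suc i)) \<omega> - W (\<tau> i) \<omega>))"

text \<open>The random variable \<open>I\<close> is (a version of) the stochastic integral over \<open>[0, t]\<close> of the
  deterministic integrand \<open>f\<close> against \<open>W\<close>: the \<open>L\<^sup>2(P)\<close>-limit of the integrals of step functions
  that converge to \<open>f\<close> in \<open>L\<^sup>2([0, t])\<close>. By the isometry the choice of the
  approximating sequence is immaterial and \<open>I\<close> is unique up to null sets. The nonnegative
  integrals rule out spurious convergence through the convention that the Bochner integral of a
  non-integrable function is zero.\<close>

definition is_wiener_integral ::
    "'w measure \<Rightarrow> (real \<Rightarrow> 'w \<Rightarrow> real) \<Rightarrow> real \<Rightarrow> (real \<Rightarrow> real) \<Rightarrow> ('w \<Rightarrow> real) \<Rightarrow> bool" where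
  "is_wiener_integral P W t f I \<longleftrightarrow>
     I \<in> borel_measurable P \<and>
     (\<exists>(n :: nat \<Rightarrow> nat) (\<tau> :: nat \<Rightarrow> nat \<Rightarrow> real) (c :: nat \<Rightarrow> nat \<Rightarrow> real).
        (\<forall>j. 0 \<le> \<tau> j 0 \<and> (\<forall>i<n j. \<tau> j i \<le> \<tau> j (Suc i)) \<and> \<tau> j (n j) \<le> t) \<and>
        (\<lambda>j. \<integral>\<^sup>+s\<in>{0..t}. ennreal ((f s - step_fun (n j) (\<tau> j) (c j) s)\<^sup>2) \<partial>lborel) \<longlonglongrightarrow> 0 \<and>
        (\<lambda>j. \<integral>\<^sup>+\<omega>. ennreal ((I \<omega> - step_integral W (n j) (\<tau> j) (c j) \<omega>)\<^sup>2) \<partial>P) \<longlonglongrightarrow> 0)"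

definition noise_filtration ::
    "'w measure \<Rightarrow> 'w measure \<Rightarrow> (real \<Rightarrow> 'w \<Rightarrow> real) \<Rightarrow> real \<Rightarrow> 'w measure" where
  "noise_filtration P F0 W t = sigma (space P) (sets F0 \<union> path_events P t W \<union> null_sets P)"

text \<open>Integral form of \<open>dX t = b \<omega> t (X t) dt + \<sigma> t dW t\<close> with \<open>X 0 = x0\<close>. The drift may depend on
  \<open>\<omega>\<close>, the diffusion coefficient is deterministic, so its stochastic integral is a Wiener integral.\<close>

definition sde_solution ::
    "'w measure \<Rightarrow> real \<Rightarrow> 'w measure \<Rightarrow> (real \<Rightarrow> 'w \<Rightarrow> real) \<Rightarrow> real
     \<Rightarrow> ('w \<Rightarrow> real \<Rightarrow> real \<Rightarrow> real) \<Rightarrow> (real \<Rightarrow> real) \<Rightarrow> (real \<Rightarrow> 'w \<Rightarrow> real) \<Rightarrow> bool" where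
  "sde_solution P T F0 W x0 b \<sigma> X \<longleftrightarrow>
     (\<forall>t\<in>{0..T}. X t \<in> borel_measurable (noise_filtration P F0 W t)) \<and>
     (AE \<omega> in P. continuous_on {0..T} (\<lambda>t. X t \<omega>)) \<and>
     (AE \<omega> in P. set_integrable lborel {0..T} (\<lambda>s. b \<omega> s (X s \<omega>))) \<and>
     (\<forall>t\<in>{0..T}. \<exists>I. is_wiener_integral P W t \<sigma> I \<and>
        (AE \<omega> in P. X t \<omega> = x0 + (LBINT s:{0..t}. b \<omega> s (X s \<omega>)) + I \<omega>))"

definition Linf_norm :: "real \<Rightarrow> (real \<Rightarrow> real) \<Rightarrow> ereal" where
  "Linf_norm T k = esssup (restrict_space lborel {0..T}) (\<lambda>t. ereal \<bar>k t\<bar>)"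

text \<open>Elements of \<open>L\<^sup>\<infinity>([0, T])\<close> are given by Borel representatives.\<close>

definition Linf :: "real \<Rightarrow> (real \<Rightarrow> real) set" where
  "Linf T = {k. k \<in> borel_measurable (restrict_space lborel {0..T}) \<and> Linf_norm T k < \<infinity>}"

definition running_cost ::
    "(real \<Rightarrow> real) \<Rightarrow> (real \<Rightarrow> real) \<Rightarrow> (real \<Rightarrow> real) \<Rightarrow> (real \<Rightarrow> real) \<Rightarrow> (real \<Rightarrow> real)
     \<Rightarrow> real \<Rightarrow> real \<Rightarrow> real \<Rightarrow> real" where
  "running_cost Q S R p q t x a =
     Q t * x\<^sup>2 + 2 * S t * x * a + R t * a\<^sup>2 + 2 * p t * x + 2 * q t * a"

definition terminal_cost :: "real \<Rightarrow> real \<Rightarrow> real \<Rightarrow> real" where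
  "terminal_cost M m x = M * x\<^sup>2 + 2 * m * x"

text \<open>The second argument is the variance, not the standard deviation; a zero variance gives a point
  mass, where \<open>normal_density\<close> would degenerate.\<close>

definition normal_law :: "real \<Rightarrow> real \<Rightarrow> real measure" where
  "normal_law \<mu> v =
     (if v = 0 then return borel \<mu> else density lborel (normal_density \<mu> (sqrt v)))"

definition gaussian_policy ::
    "(real \<Rightarrow> real) \<Rightarrow> (real \<Rightarrow> real) \<Rightarrow> (real \<Rightarrow> real) \<Rightarrow> real \<Rightarrow> real \<Rightarrow> real measure" where
  "gaussian_policy k K lam t x = normal_law (k t + K t * x) ((lam t)\<^sup>2)"

definition relaxed_drift ::
    "real \<Rightarrow> real \<Rightarrow> (real \<Rightarrow> real \<Rightarrow> real measure) \<Rightarrow> 'w \<Rightarrow> real \<Rightarrow> real \<Rightarrow> real" where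
  "relaxed_drift A B \<nu> \<omega> t x = (\<integral>a. A * x + B * a \<partial>\<nu> t x)"

definition relaxed_cost ::
    "'w measure \<Rightarrow> real \<Rightarrow> (real \<Rightarrow> real \<Rightarrow> real \<Rightarrow> real) \<Rightarrow> (real \<Rightarrow> real)
     \<Rightarrow> (real \<Rightarrow> real \<Rightarrow> real measure) \<Rightarrow> (real \<Rightarrow> 'w \<Rightarrow> real) \<Rightarrow> real" where
  "relaxed_cost P T f g \<nu> X =
     prob_space.expectation P
       (\<lambda>\<omega>. (LBINT t:{0..T}. (\<integral>a. f t (X t \<omega>) a \<partial>\<nu> t (X t \<omega>))) + g (X T \<omega>))"

definition policy_noise ::
    "'w measure \<Rightarrow> real \<Rightarrow> 'w measure \<Rightarrow> ('w \<Rightarrow> real \<Rightarrow> real) \<Rightarrow> bool" where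
  "policy_noise P T F0 \<xi> \<longleftrightarrow>
     (\<lambda>(\<omega>, t). \<xi> \<omega> t) \<in> borel_measurable (P \<Otimes>\<^sub>M restrict_space borel {0..T}) \<and>
     (\<forall>t\<in>{0..T}. (\<lambda>\<omega>. \<xi> \<omega> t) \<in> borel_measurable F0 \<and>
        distributed P lborel (\<lambda>\<omega>. \<xi> \<omega> t) std_normal_density)"

definition randomised_policy ::
    "(real \<Rightarrow> real) \<Rightarrow> (real \<Rightarrow> real) \<Rightarrow> (real \<Rightarrow> real) \<Rightarrow> ('w \<Rightarrow> real \<Rightarrow> real)
     \<Rightarrow> 'w \<Rightarrow> real \<Rightarrow> real \<Rightarrow> real" where
  "randomised_policy k K lam \<xi> \<omega> t x = k t + K t * x + lam t * \<xi> \<omega> t"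

definition randomised_drift ::
    "real \<Rightarrow> real \<Rightarrow> ('w \<Rightarrow> real \<Rightarrow> real \<Rightarrow> real) \<Rightarrow> 'w \<Rightarrow> real \<Rightarrow> real \<Rightarrow> real" where
  "randomised_drift A B \<phi> \<omega> t x = A * x + B * \<phi> \<omega> t x"

definition randomised_cost ::
    "'w measure \<Rightarrow> real \<Rightarrow> 'w measure \<Rightarrow> (real \<Rightarrow> real \<Rightarrow> real \<Rightarrow> real) \<Rightarrow> (real \<Rightarrow> real)
     \<Rightarrow> ('w \<Rightarrow> real \<Rightarrow> real \<Rightarrow> real) \<Rightarrow> (real \<Rightarrow> 'w \<Rightarrow> real) \<Rightarrow> 'w \<Rightarrow> real" where
  "randomised_cost P T F0 f g \<phi> X =
     real_cond_exp P F0
       (\<lambda>\<omega>. (LBINT t:{0..T}. f t (X t \<omega>) (\<phi> \<omega> t (X t \<omega>))) + g (X T \<omega>))"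

end

theory Submission
  imports Defs
begin

text \<open>
  Both states solve linear equations driven by the same Wiener integral, so their difference \<open>D\<close>
  solves a linear integral equation with source \<open>B \<lambda> \<xi>\<close>, and variation of constants gives
  \<open>D t = \<integral> \<kappa> t s \<lambda> s \<xi> s ds\<close> with a bounded deterministic kernel. Hence \<open>D\<close> is measurable with
  respect to the noise, while the relaxed state \<open>X\<close> is a functional of \<open>W\<close> and therefore independent
  of it. Expanding the quadratic cost around \<open>X\<close>, conditioning replaces \<open>X\<close> by its mean wherever it
  multiplies \<open>D\<close> or \<open>\<xi>\<close>, the pure \<open>X\<close> terms cancel against the relaxed cost up to the variance
  \<open>R \<lambda>\<^sup>2\<close>, and what remains is linear and quadratic in \<open>\<lambda> \<xi>\<close>; Fubini collects the kernels.
\<close>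

section \<open>Integrals over a time interval\<close>

text \<open>Three obstacles shape the proof. The policy coefficients are merely bounded and
  measurable, so nothing is differentiated: products and powers of indefinite integrals are computed
  by Fubini. A solution is only known to be adapted to a filtration that contains \<open>F0\<close>,
  and no moments of it are assumed; removing initial value and drift leaves a Wiener integral
  \<open>J\<close>, and solving the pathwise equation for \<open>X - J\<close> writes
  \<open>X\<close> as a deterministic function plus \<open>J\<close> plus a bounded linear transform
  of \<open>J\<close>. This yields its second moments, its measurability in the paths of
  \<open>W\<close> and an explicit bound on its mean. Finally, \<xi> is jointly measurable for
  \<open>P\<close>, but measurable for \<open>F0\<close> only at fixed times, so its time integrals
  are \<open>F0\<close>-measurable only up to null sets; hence \<open>ae_measurable\<close> and a
  Fubini theorem for conditional expectations proved by duality. The law of \<open>X\<close> enters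
  the kernels through its mean alone, which is why their bounds do not involve \<lambda>.\<close>

lemmas bochner_integral_cong = Bochner_Integration.integral_cong
  and bochner_integrable_add = Bochner_Integration.integrable_add

text \<open>One fixed finite measure for time turns the set integrals of the statement into plain
  integrals, so that product measures, Fubini and \<open>AE\<close> treat time and probability
  alike.\<close>

definition leb :: "real \<Rightarrow> real measure" where
  "leb T = restrict_space lborel {0..T}"

text \<open>The integrand is cut off instead of the domain. The upper limit becomes an ordinary
  parameter, which makes joint measurability and Fubini immediate and frees identities in
  \<open>t\<close> from side conditions on \<open>t\<close>.\<close>

definition cumint :: "real \<Rightarrow> (real \<Rightarrow> real) \<Rightarrow> real \<Rightarrow> real" where
  "cumint T f t = (\<integral>s. (if s \<le> t then f s else 0) \<partial>leb T)"

abbreviation process_measurable :: "real \<Rightarrow> 'a measure \<Rightarrow> (real \<Rightarrow> 'a \<Rightarrow> real) \<Rightarrow> bool" where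
  "process_measurable T M z \<equiv> (\<lambda>(t, w). z t w) \<in> borel_measurable (leb T \<Otimes>\<^sub>M M)"

abbreviation process_integrable :: "real \<Rightarrow> 'a measure \<Rightarrow> (real \<Rightarrow> 'a \<Rightarrow> real) \<Rightarrow> bool" where
  "process_integrable T M z \<equiv> integrable (leb T \<Otimes>\<^sub>M M) (\<lambda>(t, w). z t w)"

lemma space_leb [simp]: "space (leb T) = {0..T}"
  by (simp add: leb_def space_restrict_space)

lemma sets_leb: "sets (leb T) = sets (restrict_space borel {0..T})"
  unfolding leb_def by (rule sets_restrict_space_cong) simp

lemma measurable_leb:
  "borel_measurable (leb T) = borel_measurable (restrict_space borel {0..T})"
  by (rule measurable_cong_sets[OF sets_leb refl])

lemma leb_borelI:
  "f \<in> borel_measurable borel \<Longrightarrow> f \<in> borel_measurable (leb T)"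
  unfolding measurable_leb by (rule measurable_restrict_space1)

lemma measurable_time_ident [measurable]: "(\<lambda>t. t) \<in> borel_measurable (leb T)"
  by (rule leb_borelI) simp

lemma finite_leb: "finite_measure (leb T)"
proof
  have "emeasure (leb T) {0..T} = emeasure lborel {0..T}"
    by (simp add: leb_def emeasure_restrict_space)
  also have "\<dots> < \<infinity>" by (cases "0 \<le> T") auto
  finally show "emeasure (leb T) (space (leb T)) \<noteq> \<infinity>" by simp
qed

lemma measure_leb:
  assumes "T \<ge> 0" shows "measure (leb T) {0..T} = T"
  using assms by (simp add: leb_def measure_restrict_space)

lemma time_le_measurable [measurable]:
  "Measurable.pred (leb T \<Otimes>\<^sub>M leb T) (\<lambda>x. fst x \<le> snd x)"
proof -
  have [measurable]: "(\<lambda>x. fst x) \<in> borel_measurable (leb T \<Otimes>\<^sub>M leb T)"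
    "(\<lambda>x. snd x) \<in> borel_measurable (leb T \<Otimes>\<^sub>M leb T)"
    using measurable_compose[OF measurable_fst measurable_time_ident]
      measurable_compose[OF measurable_snd measurable_time_ident] by auto
  show ?thesis by measurable
qed

lemma AE_time_neq: "AE s in leb T. s \<noteq> t"
  unfolding leb_def by (subst AE_restrict_space_iff) (auto intro: AE_mp[OF AE_lborel_singleton])

lemma LBINT_time: "(LBINT t:{0..T}. f t) = (\<integral>t. f t \<partial>leb T)" for f :: "real \<Rightarrow> real"
  unfolding leb_def set_lebesgue_integral_def by (subst integral_restrict_space) auto

lemma set_integrable_time: "set_integrable lborel {0..T} f \<longleftrightarrow> integrable (leb T) f"
  for f :: "real \<Rightarrow> real"
  unfolding leb_def set_integrable_def by (subst integrable_restrict_space) auto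

lemma LBINT_time_upto:
  assumes "t \<in> {0..T}"
  shows "(LBINT s:{0..t}. f s) = cumint T f t"
proof -
  have "(LBINT s:{0..t}. f s) = (LBINT s:{0..T}. (if s \<le> t then f s else 0))"
    unfolding set_lebesgue_integral_def using assms
    by (intro bochner_integral_cong) (auto simp: indicator_def)
  then show ?thesis by (simp add: LBINT_time cumint_def)
qed

interpretation time: finite_measure "leb T" for T
  by (rule finite_leb)

interpretation time2: pair_sigma_finite "leb T" "leb T" for T ..

lemma integrable_cut:
  fixes f :: "real \<Rightarrow> real"
  assumes "integrable (leb T) f"
  shows "integrable (leb T) (\<lambda>s. if s \<le> t then f s else 0)"
    and "integrable (leb T) (\<lambda>s. if t < s then f s else 0)"
proof -
  have [measurable]: "f \<in> borel_measurable (leb T)" using assms by auto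
  have [measurable]: "(\<lambda>s. s) \<in> borel_measurable (leb T)" by (rule measurable_time_ident)
  have "{s \<in> space (leb T). s \<le> t} \<in> sets (leb T)"
    "{s \<in> space (leb T). t < s} \<in> sets (leb T)" by measurable
  then show "integrable (leb T) (\<lambda>s. if s \<le> t then f s else 0)"
    "integrable (leb T) (\<lambda>s. if t < s then f s else 0)"
    by (auto intro!: Bochner_Integration.integrable_bound[OF assms] measurable_If)
qed

section \<open>Indefinite integrals: product rule, exponential, variation of constants\<close>

lemma cumint_measurable [measurable]:
  assumes [measurable]: "f \<in> borel_measurable (leb T)"
  shows "cumint T f \<in> borel_measurable (leb T)"
  unfolding cumint_def[abs_def]
proof (rule time.borel_measurable_lebesgue_integral)
  have "(\<lambda>x. if snd x \<le> fst x then f (snd x) else 0) \<in> borel_measurable (leb T \<Otimes>\<^sub>M leb T)"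
    using measurable_compose[OF measurable_pair_swap' time_le_measurable[of T]]
    by (auto intro!: measurable_If)
  then show "(\<lambda>(t, s). if s \<le> t then f s else 0) \<in> borel_measurable (leb T \<Otimes>\<^sub>M leb T)"
    by (simp add: case_prod_beta')
qed

lemma cumint_bound:
  assumes "integrable (leb T) f"
  shows "\<bar>cumint T f t\<bar> \<le> (\<integral>s. \<bar>f s\<bar> \<partial>leb T)"
proof -
  have "\<bar>cumint T f t\<bar> \<le> (\<integral>s. \<bar>if s \<le> t then f s else 0\<bar> \<partial>leb T)"
    unfolding cumint_def by (rule integral_abs_bound)
  also have "\<dots> \<le> (\<integral>s. \<bar>f s\<bar> \<partial>leb T)"
    using integrable_cut(1)[OF assms, of t] assms by (intro integral_mono) auto
  finally show ?thesis .
qed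

lemma integrable_bounded_mult:
  fixes f g :: "'a \<Rightarrow> real"
  assumes "integrable M f" "g \<in> borel_measurable M" "\<And>x. x \<in> space M \<Longrightarrow> \<bar>g x\<bar> \<le> c"
  shows "integrable M (\<lambda>x. g x * f x)"
proof (rule Bochner_Integration.integrable_bound)
  show "integrable M (\<lambda>x. c * f x)" using assms(1) by simp
  show "(\<lambda>x. g x * f x) \<in> borel_measurable M" using assms by auto
  show "AE x in M. norm (g x * f x) \<le> norm (c * f x)"
    using assms(3) by (intro AE_I2) (force simp: abs_mult intro!: mult_right_mono)
qed

lemma cumint_add:
  assumes "integrable (leb T) u" "integrable (leb T) v"
  shows "cumint T (\<lambda>s. u s + v s) t = cumint T u t + cumint T v t"
proof -
  have "cumint T (\<lambda>s. u s + v s) t =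
      (\<integral>s. (if s \<le> t then u s else 0) + (if s \<le> t then v s else 0) \<partial>leb T)"
    unfolding cumint_def by (auto intro!: bochner_integral_cong)
  also have "\<dots> = cumint T u t + cumint T v t"
    unfolding cumint_def by (intro Bochner_Integration.integral_add integrable_cut assms)
  finally show ?thesis .
qed

lemma cumint_scale: "cumint T (\<lambda>s. c * u s) t = c * cumint T u t"
proof -
  have "cumint T (\<lambda>s. c * u s) t = (\<integral>s. c * (if s \<le> t then u s else 0) \<partial>leb T)"
    unfolding cumint_def by (intro bochner_integral_cong) auto
  then show ?thesis by (simp add: cumint_def)
qed

lemma (in pair_sigma_finite) integrable_mult_fst_snd:
  fixes f :: "'a \<Rightarrow> real" and g :: "'b \<Rightarrow> real"
  assumes "integrable M1 f" "integrable M2 g"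
  shows "integrable (M1 \<Otimes>\<^sub>M M2) (\<lambda>x. f (fst x) * g (snd x))"
proof (rule Fubini_integrable)
  have [measurable]: "f \<in> borel_measurable M1" "g \<in> borel_measurable M2" using assms by auto
  show "(\<lambda>x. f (fst x) * g (snd x)) \<in> borel_measurable (M1 \<Otimes>\<^sub>M M2)" by measurable
  show "integrable M1 (\<lambda>x. \<integral>y. norm (f (fst (x, y)) * g (snd (x, y))) \<partial>M2)"
    using assms by (simp add: abs_mult)
  show "AE x in M1. integrable M2 (\<lambda>y. f (fst (x, y)) * g (snd (x, y)))"
    using assms by simp
qed

text \<open>Integration by parts without derivatives. The product is a double integral over a
  square, which the diagonal splits into two triangles; Fubini exchanges the order on one of them,
  and then each triangle integrates one factor against the indefinite integral of the other.\<close>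

lemma cumint_mult:
  assumes f: "integrable (leb T) f" and g: "integrable (leb T) g"
  shows "cumint T f t * cumint T g t = cumint T (\<lambda>s. f s * cumint T g s + g s * cumint T f s) t"
proof -
  let ?L = "leb T"
  let ?F = "\<lambda>s. if s \<le> t then f s else 0" and ?G = "\<lambda>s. if s \<le> t then g s else 0"
  have iF: "integrable ?L ?F" and iG: "integrable ?L ?G" using integrable_cut f g by blast+
  have [measurable]: "f \<in> borel_measurable ?L" "g \<in> borel_measurable ?L"
    "?F \<in> borel_measurable ?L" "?G \<in> borel_measurable ?L" using f g iF iG by auto
  have m1[measurable]: "{x \<in> space (?L \<Otimes>\<^sub>M ?L). fst x < snd x} \<in> sets (?L \<Otimes>\<^sub>M ?L)"
  proof -
    have "{x \<in> space (?L \<Otimes>\<^sub>M ?L). fst x < snd x} =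
      {x \<in> space (?L \<Otimes>\<^sub>M ?L). \<not> (snd x \<le> fst x)}" by auto
    then show ?thesis
      using measurable_compose[OF measurable_pair_swap' time_le_measurable[of T]]
      by (simp add: case_prod_beta')
  qed
  have prod: "integrable (?L \<Otimes>\<^sub>M ?L) (\<lambda>x. ?F (fst x) * ?G (snd x))"
    by (rule time2.integrable_mult_fst_snd[OF iF iG])
  have int: "integrable (?L \<Otimes>\<^sub>M ?L) (\<lambda>(s, r). if s < r then ?F s * ?G r else 0)"
    unfolding case_prod_beta'
    by (rule Bochner_Integration.integrable_bound[OF prod]) (auto intro!: measurable_If m1)
  have bm: "integrable ?L (\<lambda>s. cumint T g s * ?F s)" "integrable ?L (\<lambda>s. cumint T f s * ?G s)"
    using cumint_bound[OF f] cumint_bound[OF g]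
    by (auto intro!: integrable_bounded_mult iF iG simp del: mult_if_delta)
  have "cumint T f t * cumint T g t = (\<integral>s. ?F s * cumint T g t \<partial>?L)"
    unfolding cumint_def[of T f t] by (rule integral_mult_left_zero[symmetric])
  also have "\<dots> = (\<integral>s. cumint T g s * ?F s + (\<integral>r. (if s < r then ?F s * ?G r else 0) \<partial>?L) \<partial>?L)"
  proof (rule bochner_integral_cong[OF refl])
    fix s
    show "?F s * cumint T g t = cumint T g s * ?F s + (\<integral>r. (if s < r then ?F s * ?G r else 0) \<partial>?L)"
    proof (cases "s \<le> t")
      case True
      \<comment> \<open>For fixed \<open>s\<close> the inner integral is split at
        \<open>r = s\<close>; the part with \<open>r \<le> s\<close> is
        \<open>cumint T g s\<close>.\<close>
      have "cumint T g t = (\<integral>r. (if r \<le> s then g r else 0) + (if s < r then ?G r else 0) \<partial>?L)"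
        unfolding cumint_def using True by (intro bochner_integral_cong) auto
      also have "\<dots> = cumint T g s + (\<integral>r. (if s < r then ?G r else 0) \<partial>?L)"
        unfolding cumint_def by (intro Bochner_Integration.integral_add integrable_cut g iG)
      finally have "f s * cumint T g t = cumint T g s * f s + (\<integral>r. f s * (if s < r then ?G r else 0) \<partial>?L)"
        by (simp add: algebra_simps)
      also have "(\<integral>r. f s * (if s < r then ?G r else 0) \<partial>?L) = (\<integral>r. (if s < r then ?F s * ?G r else 0) \<partial>?L)"
        using True by (intro bochner_integral_cong) auto
      finally show ?thesis using True by simp
    qed (simp cong: if_cong)
  qed
  also have "\<dots> = (\<integral>s. cumint T g s * ?F s \<partial>?L) + (\<integral>s. \<integral>r. (if s < r then ?F s * ?G r else 0) \<partial>?L \<partial>?L)"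
    by (rule Bochner_Integration.integral_add[OF bm(1) time2.integrable_fst[OF int]])
  also have "(\<integral>s. \<integral>r. (if s < r then ?F s * ?G r else 0) \<partial>?L \<partial>?L) =
      (\<integral>r. \<integral>s. (if s < r then ?F s * ?G r else 0) \<partial>?L \<partial>?L)"
    using time2.Fubini_integral[OF int] by simp
  also have "\<dots> = (\<integral>r. cumint T f r * ?G r \<partial>?L)"
  proof (rule bochner_integral_cong[OF refl])
    fix r
    have "(\<integral>s. (if s < r then ?F s * ?G r else 0) \<partial>?L) = (\<integral>s. (if s \<le> r then f s else 0) * ?G r \<partial>?L)"
    proof (rule integral_cong_AE)
      have "integrable ?L (\<lambda>s. if s \<le> r then f s else 0)" by (rule integrable_cut[OF f])
      then show "(\<lambda>s. (if s \<le> r then f s else 0) * ?G r) \<in> borel_measurable ?L" by auto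
      have "{s \<in> space ?L. s < r} \<in> sets ?L" by measurable
      then show "(\<lambda>s. if s < r then ?F s * ?G r else 0) \<in> borel_measurable ?L"
        by (auto intro!: measurable_If)
      \<comment> \<open>The conditions \<open>s < r\<close> and \<open>s \<le> r\<close> differ only
        at the single point \<open>s = r\<close>.\<close>
      show "AE s in ?L. (if s < r then ?F s * ?G r else 0) = (if s \<le> r then f s else 0) * ?G r"
        using AE_time_neq[where T=T and t=r] by eventually_elim auto
    qed
    then show "(\<integral>s. (if s < r then ?F s * ?G r else 0) \<partial>?L) = cumint T f r * ?G r"
      by (simp add: cumint_def)
  qed
  also have "(\<integral>s. cumint T g s * ?F s \<partial>?L) + (\<integral>r. cumint T f r * ?G r \<partial>?L) =
      (\<integral>s. cumint T g s * ?F s + cumint T f s * ?G s \<partial>?L)"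
    by (rule Bochner_Integration.integral_add[symmetric, OF bm])
  also have "\<dots> = cumint T (\<lambda>s. f s * cumint T g s + g s * cumint T f s) t"
    unfolding cumint_def[of T _ t] by (rule bochner_integral_cong) auto
  finally show ?thesis .
qed

text \<open>The power rule, by induction from the product rule \<open>cumint_mult\<close>; it
  supplies the terms of the exponential series.\<close>

lemma cumint_power:
  assumes a: "integrable (leb T) a"
  shows "cumint T a t ^ Suc n = cumint T (\<lambda>s. real (Suc n) * (a s * cumint T a s ^ n)) t"
    and "integrable (leb T) (\<lambda>s. a s * cumint T a s ^ n)"
proof -
  let ?c = "\<integral>s. \<bar>a s\<bar> \<partial>leb T"
  have [measurable]: "a \<in> borel_measurable (leb T)" using a by auto
  have int: "integrable (leb T) (\<lambda>s. a s * cumint T a s ^ n)" for n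
    using integrable_bounded_mult[OF a, of "\<lambda>s. cumint T a s ^ n" "?c ^ n"]
      power_mono[OF cumint_bound[OF a] abs_ge_zero, of _ n]
    by (simp add: power_abs mult.commute)
  then show "integrable (leb T) (\<lambda>s. a s * cumint T a s ^ n)" .
  show "cumint T a t ^ Suc n = cumint T (\<lambda>s. real (Suc n) * (a s * cumint T a s ^ n)) t"
  proof (induction n arbitrary: t)
    case 0
    then show ?case by simp
  next
    case (Suc n)
    have "cumint T a t ^ Suc (Suc n) =
        cumint T a t * cumint T (\<lambda>s. real (Suc n) * (a s * cumint T a s ^ n)) t"
      using Suc.IH[of t] by simp
    also have "\<dots> = cumint T (\<lambda>s. a s * cumint T (\<lambda>s. real (Suc n) * (a s * cumint T a s ^ n)) s +
        real (Suc n) * (a s * cumint T a s ^ n) * cumint T a s) t"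
      using a int by (intro cumint_mult) auto
    also have "\<dots> = cumint T (\<lambda>s. real (Suc (Suc n)) * (a s * cumint T a s ^ Suc n)) t"
      unfolding Suc.IH[symmetric] by (intro arg_cong[where f="\<lambda>f. cumint T f t"] ext) (simp add: algebra_simps)
    finally show ?case .
  qed
qed

text \<open>The coefficient is merely integrable, so instead of differentiating we sum the exponential series
  of powers of the indefinite integral, each of which is again an indefinite integral by Fubini.\<close>

lemma exp_cumint:
  assumes a: "integrable (leb T) a"
  shows "exp (cumint T a t) = 1 + cumint T (\<lambda>s. a s * exp (cumint T a s)) t"
proof -
  let ?L = "leb T"
  let ?c = "\<integral>s. \<bar>a s\<bar> \<partial>?L"
  let ?f = "\<lambda>n s. if s \<le> t then a s * cumint T a s ^ n / fact n else 0"
  have [measurable]: "a \<in> borel_measurable ?L" using a by auto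
  have int: "integrable ?L (?f n)" for n
    using integrable_cut(1)[OF cumint_power(2)[OF a, of n], of t]
    by (auto intro!: integrable_cut(1) cumint_power(2) a)
  have bnd: "norm (?f n s) \<le> \<bar>a s\<bar> * (?c ^ n / fact n)" for n s
    using cumint_bound[OF a, of s]
    by (auto simp: abs_mult power_abs field_simps intro!: mult_left_mono power_mono)
  have sm: "summable (\<lambda>n. ?c ^ n / fact n)" using summable_exp[of ?c] by (simp add: field_simps)
  have sums: "(\<lambda>n. integral\<^sup>L ?L (?f n)) sums (\<integral>s. (\<Sum>n. ?f n s) \<partial>?L)"
  proof (rule sums_integral[OF int])
    show "AE s in ?L. summable (\<lambda>n. norm (?f n s))"
    proof (rule AE_I2)
      fix s
      show "summable (\<lambda>n. norm (?f n s))"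
        by (rule summable_comparison_test'[OF summable_mult[OF sm, of "\<bar>a s\<bar>"], of 0]) (use bnd in simp)
    qed
    have "(\<integral>s. norm (?f n s) \<partial>?L) \<le> ?c * (?c ^ n / fact n)" for n
      using integral_mono[of ?L "\<lambda>s. norm (?f n s)" "\<lambda>s. \<bar>a s\<bar> * (?c ^ n / fact n)"] int[of n] a bnd
      by (auto simp del: real_norm_def)
    then show "summable (\<lambda>n. \<integral>s. norm (?f n s) \<partial>?L)"
      using Bochner_Integration.integral_nonneg[of ?L "\<lambda>s. norm (?f n s)" for n]
      by (intro summable_comparison_test'[OF summable_mult[OF sm, of ?c], of 0])
        (simp only: real_norm_def[of "integral\<^sup>L _ _"] abs_of_nonneg norm_ge_zero)
  qed
  have e: "(\<lambda>n. cumint T a s ^ n / fact n) sums exp (cumint T a s)" for s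
    using exp_converges[of "cumint T a s"] by (simp add: field_simps)
  have "integral\<^sup>L ?L (?f n) = cumint T a t ^ Suc n / fact (Suc n)" for n
  proof -
    have "x / fact n = real (Suc n) * x / fact (Suc n)" for x :: real
      unfolding fact_Suc by (rule nonzero_mult_divide_mult_cancel_left[symmetric]) simp
    then have "integral\<^sup>L ?L (?f n) =
        (\<integral>s. (if s \<le> t then real (Suc n) * (a s * cumint T a s ^ n) else 0) / fact (Suc n) \<partial>?L)"
      by (intro bochner_integral_cong) auto
    then show ?thesis unfolding cumint_power(1)[OF a] unfolding cumint_def[of T _ t] by simp
  qed
  moreover have "(\<integral>s. (\<Sum>n. ?f n s) \<partial>?L) = cumint T (\<lambda>s. a s * exp (cumint T a s)) t"
    unfolding cumint_def[of T _ t]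
  proof (intro bochner_integral_cong refl)
    fix s
    have "(\<lambda>n. a s * (cumint T a s ^ n / fact n)) sums (a s * exp (cumint T a s))"
      by (rule sums_mult[OF e])
    then show "(\<Sum>n. ?f n s) = (if s \<le> t then a s * exp (cumint T a s) else 0)"
      by (auto simp: sums_iff)
  qed
  ultimately have "(\<lambda>n. cumint T a t ^ Suc n / fact (Suc n)) sums cumint T (\<lambda>s. a s * exp (cumint T a s)) t"
    using sums by simp
  \<comment> \<open>Integrating the term of index \<open>n\<close> gives the term of index
    \<open>Suc n\<close>, so the summed integrals miss exactly the constant term 1 of the
    exponential series.\<close>
  then have "(\<lambda>n. cumint T a t ^ n / fact n) sums (cumint T (\<lambda>s. a s * exp (cumint T a s)) t + 1)"
    by (subst (asm) sums_Suc_iff) simp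
  with e[of t] show ?thesis by (simp add: sums_iff)
qed

lemma cumint_cong_AE:
  assumes "AE s in leb T. f s = g s"
    "f \<in> borel_measurable (leb T)" "g \<in> borel_measurable (leb T)"
  shows "cumint T f t = cumint T g t"
proof -
  have "{s \<in> space (leb T). s \<le> t} \<in> sets (leb T)" by measurable
  then show ?thesis
    unfolding cumint_def using assms by (intro integral_cong_AE) (auto intro!: measurable_If)
qed

text \<open>The integrating factor \<open>exp (- cumint T a s)\<close> is, up to the constant 1,
  itself an indefinite integral by \<open>exp_cumint\<close>, so the product rule applies to its
  product with \<open>y\<close>. The equation is required only for almost every \<open>s\<close> and
  at the chosen \<open>t\<close>, because for the difference of two states it is available almost
  surely at each single time, not at all times simultaneously.\<close>

lemma linear_ode_representation:
  assumes a: "integrable (leb T) a" and b: "integrable (leb T) b"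
    and f: "integrable (leb T) f"
    and y[measurable]: "y \<in> borel_measurable (leb T)"
    and yf: "AE s in leb T. f s = a s * y s + b s"
    and eq: "AE s in leb T. y s = y0 + cumint T f s"
    and t: "y t = y0 + cumint T f t"
  shows "y t = exp (cumint T a t) * (y0 + cumint T (\<lambda>s. exp (- cumint T a s) * b s) t)"
proof -
  let ?L = "leb T" and ?E = "\<lambda>s. exp (- cumint T a s)"
  define g where "g = (\<lambda>s. - a s * ?E s)"
  have [measurable]: "a \<in> borel_measurable ?L" "b \<in> borel_measurable ?L" "f \<in> borel_measurable ?L"
    using a b f by auto
  have E: "?E s = 1 + cumint T g s" for s
  proof -
    have "cumint T (\<lambda>s. - a s) s = - cumint T a s" for s
      unfolding cumint_def
      by (subst Bochner_Integration.integral_minus[symmetric]) (intro bochner_integral_cong, auto)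
    then show ?thesis using exp_cumint[of T "\<lambda>s. - a s" s] a by (simp add: g_def)
  qed
  have g: "integrable ?L g"
  proof -
    have "integrable ?L (\<lambda>s. ?E s * - a s)"
    proof (rule integrable_bounded_mult)
      show "\<bar>?E s\<bar> \<le> exp (\<integral>s. \<bar>a s\<bar> \<partial>?L)" for s
        using cumint_bound[OF a, of s] by auto
    qed (use a in auto)
    then show ?thesis by (simp add: mult.commute g_def)
  qed
  then have [measurable]: "g \<in> borel_measurable ?L" by auto
  have fE: "integrable ?L (\<lambda>s. f s * cumint T g s)"
  proof -
    have "integrable ?L (\<lambda>s. cumint T g s * f s)"
      using cumint_bound[OF g] g by (intro integrable_bounded_mult f) auto
    then show ?thesis by (simp add: mult.commute)
  qed
  have gf: "integrable ?L (\<lambda>s. g s * cumint T f s)"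
  proof -
    have "integrable ?L (\<lambda>s. cumint T f s * g s)"
      using cumint_bound[OF f] f by (intro integrable_bounded_mult g) auto
    then show ?thesis by (simp add: mult.commute)
  qed
  \<comment> \<open>With \<open>F = cumint T f t\<close> and \<open>G = cumint T g t\<close> the
    left side is \<open>(y0 + F) * (1 + G)\<close>; only \<open>F * G\<close> calls for the product
    rule.\<close>
  have "y t * ?E t = cumint T f t * cumint T g t + (cumint T f t + (y0 * cumint T g t + y0))"
    unfolding t E[of t] by (simp add: algebra_simps)
  also have "\<dots> = y0 + cumint T (\<lambda>s. (f s * cumint T g s + g s * cumint T f s) + (f s + y0 * g s)) t"
    using f g fE gf by (simp add: cumint_mult[OF f g] cumint_add cumint_scale)
  also have "cumint T (\<lambda>s. (f s * cumint T g s + g s * cumint T f s) + (f s + y0 * g s)) t =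
     cumint T (\<lambda>s. ?E s * b s) t"
  proof (rule cumint_cong_AE)
    \<comment> \<open>The integrand is \<open>f E + g y\<close>; inserting
      \<open>f = a y + b\<close> and \<open>g = - a E\<close> cancels \<open>a y E\<close>.\<close>
    show "AE s in ?L. (f s * cumint T g s + g s * cumint T f s) + (f s + y0 * g s) = ?E s * b s"
      using yf eq
    proof eventually_elim
      case (elim s)
      have "(f s * cumint T g s + g s * cumint T f s) + (f s + y0 * g s) =
        f s * (1 + cumint T g s) + g s * (y0 + cumint T f s)" by (simp add: algebra_simps)
      also have "\<dots> = (a s * y s + b s) * ?E s + g s * y s"
        using elim E[of s] by (simp only: )
      also have "\<dots> = ?E s * b s" by (simp add: algebra_simps g_def)
      finally show ?case .
    qed
  qed auto
  finally have *: "y t * ?E t = y0 + cumint T (\<lambda>s. ?E s * b s) t" .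
  have "y t = exp (cumint T a t) * (y t * ?E t)" by (simp add: exp_minus)
  then show ?thesis unfolding * .
qed

section \<open>Conditional expectations and square-integrable processes\<close>

locale prob_space_subalgebra = prob_space M + finite_measure_subalgebra M F
  for M F :: "'a measure"

lemma process_compose:
  assumes "process_measurable T P g"
    and "f1 \<in> measurable N (leb T)" "f2 \<in> measurable N P"
  shows "(\<lambda>x. g (f1 x) (f2 x)) \<in> borel_measurable N"
  using measurable_compose[OF measurable_Pair[OF assms(2,3)] assms(1)] by simp

lemma process_section:
  assumes "process_measurable T P g" and "w \<in> space P"
  shows "(\<lambda>t. g t w) \<in> borel_measurable (leb T)"
proof -
  have "(\<lambda>t. (t, w)) \<in> measurable (leb T) (leb T \<Otimes>\<^sub>M P)"
    using assms(2) by (rule measurable_Pair2')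
  from measurable_compose[OF this assms(1)] show ?thesis by simp
qed

text \<open>Neither \<open>F0\<close> nor the sigma-algebra of the paths is assumed to contain the
  null sets of \<open>P\<close>, while limits of step integrals and time integrals of the noise are
  determined only up to them. Conditioning and independence just use that some version is
  measurable.\<close>

definition ae_measurable :: "'a measure \<Rightarrow> 'a measure \<Rightarrow> ('a \<Rightarrow> real) \<Rightarrow> bool" where
  "ae_measurable M F Z \<longleftrightarrow> (\<exists>Z'\<in>borel_measurable F. AE w in M. Z w = Z' w)"

lemma ae_measurableI: "Z \<in> borel_measurable F \<Longrightarrow> ae_measurable M F Z"
  unfolding ae_measurable_def by (rule bexI[of _ Z]) auto

lemma ae_measurable_cong_AE:
  assumes "AE w in M. Z w = Y w" "ae_measurable M F Y"
  shows "ae_measurable M F Z"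
proof -
  obtain Y' where "Y' \<in> borel_measurable F" "AE w in M. Y w = Y' w"
    using assms(2) by (auto simp: ae_measurable_def)
  then show ?thesis using assms(1) unfolding ae_measurable_def by (auto intro!: bexI[of _ Y'])
qed

lemma ae_measurable_add:
  assumes "ae_measurable M F Y" "ae_measurable M F Z"
  shows "ae_measurable M F (\<lambda>w. Y w + Z w)"
proof -
  obtain Y' Z' where "Y' \<in> borel_measurable F" "AE w in M. Y w = Y' w"
    "Z' \<in> borel_measurable F" "AE w in M. Z w = Z' w"
    using assms by (auto simp: ae_measurable_def)
  then show ?thesis unfolding ae_measurable_def by (intro bexI[of _ "\<lambda>w. Y' w + Z' w"]) auto
qed

lemma ae_measurable_mult:
  assumes "ae_measurable M F Y" "ae_measurable M F Z"
  shows "ae_measurable M F (\<lambda>w. Y w * Z w)"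
proof -
  obtain Y' Z' where "Y' \<in> borel_measurable F" "AE w in M. Y w = Y' w"
    "Z' \<in> borel_measurable F" "AE w in M. Z w = Z' w"
    using assms by (auto simp: ae_measurable_def)
  then show ?thesis unfolding ae_measurable_def by (intro bexI[of _ "\<lambda>w. Y' w * Z' w"]) auto
qed

lemma ae_measurable_const: "ae_measurable M F (\<lambda>_. c)"
  by (rule ae_measurableI) simp

section \<open>Conditional expectation: independence and exchange with time integrals\<close>

context prob_space_subalgebra
begin

lemma real_cond_exp_ae_measurable_mult:
  assumes f: "ae_measurable M F f" and g: "g \<in> borel_measurable M" "f \<in> borel_measurable M"
    and int: "integrable M (\<lambda>x. f x * g x)"
  shows "AE x in M. real_cond_exp M F (\<lambda>x. f x * g x) x = f x * real_cond_exp M F g x"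
proof -
  obtain f' where f'[measurable]: "f' \<in> borel_measurable F" and ae: "AE x in M. f x = f' x"
    using f by (auto simp: ae_measurable_def)
  note [measurable] = g measurable_from_subalg[OF subalg f']
  have int': "integrable M (\<lambda>x. f' x * g x)"
    by (rule integrable_cong_AE_imp[OF int]) (use ae in auto)
  have "AE x in M. real_cond_exp M F (\<lambda>x. f x * g x) x = real_cond_exp M F (\<lambda>x. f' x * g x) x"
    by (rule real_cond_exp_cong) (use ae in auto)
  moreover have "AE x in M. real_cond_exp M F (\<lambda>x. f' x * g x) x = f' x * real_cond_exp M F g x"
    by (rule real_cond_exp_mult[OF f' g(1) int'])
  ultimately show ?thesis using ae by eventually_elim simp
qed

lemma real_cond_exp_ae_measurable:
  assumes f: "ae_measurable M F f" and int: "integrable M f"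
  shows "AE x in M. real_cond_exp M F f x = f x"
proof -
  have "AE x in M. real_cond_exp M F (\<lambda>x. f x * 1) x = f x * real_cond_exp M F (\<lambda>x. 1) x"
    using int by (intro real_cond_exp_ae_measurable_mult f) auto
  moreover have "AE x in M. real_cond_exp M F (\<lambda>x. 1) x = 1"
    by (rule real_cond_exp_F_meas) auto
  ultimately show ?thesis by eventually_elim simp
qed

text \<open>The conditional expectation itself is the \<open>F\<close>-measurable version.\<close>

lemma ae_measurable_real_cond_exp:
  assumes "AE x in M. real_cond_exp M F f x = f x"
  shows "ae_measurable M F f"
  unfolding ae_measurable_def
  by (rule bexI[of _ "real_cond_exp M F f"]) (use assms in auto)

text \<open>For \<open>A\<close> in \<open>F\<close>, the events generated by the indicator of
  \<open>A\<close> lie in \<open>F\<close> and those generated by a version of \<open>Z\<close> lie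
  in \<open>G\<close>. Hence the expectation of the product factorises, which is the defining
  property of the conditional expectation for the constant.\<close>

lemma real_cond_exp_indep:
  assumes indep: "indep_set (sets F) (sets G)" and G: "subalgebra M G"
    and Z: "ae_measurable M G Z" "integrable M Z"
  shows "AE x in M. real_cond_exp M F Z x = expectation Z"
proof (rule real_cond_exp_charact)
  obtain Z' where Z'[measurable]: "Z' \<in> borel_measurable G" and ae: "AE x in M. Z x = Z' x"
    using Z(1) by (auto simp: ae_measurable_def)
  have [measurable]: "Z' \<in> borel_measurable M" by (rule measurable_from_subalg[OF G Z'])
  have Z'_int: "integrable M Z'" by (rule integrable_cong_AE_imp[OF Z(2)]) (use ae in auto)
  fix A assume A: "A \<in> sets F"
  then have AM[measurable]: "A \<in> sets M" using subalg by (auto simp: subalgebra_def)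
  have "indep_var borel (indicator A :: 'a \<Rightarrow> real) borel Z'"
    unfolding indep_var_eq
  proof (intro conjI)
    have 1: "sigma_sets (space M) {indicator A -` B \<inter> space M |B. B \<in> sets (borel :: real measure)} \<subseteq> sets F"
    proof -
      have sp: "space M = space F" using subalg by (simp add: subalgebra_def)
      have "(indicator A :: 'a \<Rightarrow> real) \<in> borel_measurable F" using A by simp
      then have "{indicator A -` B \<inter> space M |B. B \<in> sets (borel :: real measure)} \<subseteq> sets F"
        unfolding sp by (auto dest: measurable_sets)
      then show ?thesis unfolding sp by (rule sets.sigma_sets_subset)
    qed
    have 2: "sigma_sets (space M) {Z' -` B \<inter> space M |B. B \<in> sets borel} \<subseteq> sets G"
    proof -
      have sp: "space M = space G" using G by (simp add: subalgebra_def)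
      have "{Z' -` B \<inter> space M |B. B \<in> sets borel} \<subseteq> sets G"
        unfolding sp using Z' by (auto dest: measurable_sets)
      then show ?thesis unfolding sp by (rule sets.sigma_sets_subset)
    qed
    show "indep_set (sigma_sets (space M) {indicator A -` B \<inter> space M |B. B \<in> sets (borel :: real measure)})
      (sigma_sets (space M) {Z' -` B \<inter> space M |B. B \<in> sets borel})"
      using indep 1 2 unfolding indep_sets2_eq by blast
  qed auto
  then have "expectation (\<lambda>x. indicator A x * Z' x) = expectation (indicator A) * expectation Z'"
    by (rule indep_var_lebesgue_integral)
      (use Z'_int in \<open>auto intro!: integrable_real_indicator simp: less_top[symmetric]\<close>)
  moreover have "expectation (\<lambda>x. indicator A x * Z x) = expectation (\<lambda>x. indicator A x * Z' x)"
    by (rule integral_cong_AE) (use ae Z in auto)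
  moreover have "expectation Z = expectation Z'"
    by (rule integral_cong_AE) (use ae Z in auto)
  ultimately show "(LINT x:A|M. Z x) = (LINT x:A|M. expectation Z)"
    by (simp add: set_lebesgue_integral_def mult.commute)
qed (use Z in auto)

text \<open>Testing against bounded \<open>z\<close>: \<open>E[z E[v|F]] = E[E[z|F] v]\<close>, so Fubini moves the conditional
  expectation through the outer integral without any joint measurability with respect to \<open>F\<close>.\<close>

lemma real_cond_exp_Fubini:
  assumes "sigma_finite_measure L"
    and v: "integrable (L \<Otimes>\<^sub>M M) (\<lambda>(t, w). v t w)"
    and h: "integrable (L \<Otimes>\<^sub>M M) (\<lambda>(t, w). h t w)"
    and vh: "AE t in L. AE w in M. real_cond_exp M F (v t) w = h t w"
  shows "AE w in M. real_cond_exp M F (\<lambda>w. \<integral>t. v t w \<partial>L) w = (\<integral>t. h t w \<partial>L)"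
proof (rule density_unique_real)
  interpret L: sigma_finite_measure L by fact
  interpret LM: pair_sigma_finite L M ..
  let ?V = "\<lambda>w. \<integral>t. v t w \<partial>L" and ?H = "\<lambda>w. \<integral>t. h t w \<partial>L"
  have V: "integrable M ?V" and H: "integrable M ?H"
    using LM.integrable_snd[OF v] LM.integrable_snd[OF h] .
  show "integrable M (real_cond_exp M F ?V)" "integrable M ?H" using V H by auto
  \<comment> \<open>The two sides are compared on every \<open>A\<close> in \<open>sets M\<close>
    rather than in \<open>sets F\<close>: the defining property of the conditional expectation could
    be used only if the right side were already known to be \<open>F\<close>-measurable.\<close>
  fix A assume A[measurable]: "A \<in> sets M"
  let ?Z = "indicator A :: 'a \<Rightarrow> real"
  \<comment> \<open>A version of \<open>E[1_A | F]\<close>, clipped to the unit interval everywhere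
    so that its products with integrable functions are integrable.\<close>
  define z where "z = (\<lambda>w. max 0 (min 1 (real_cond_exp M F ?Z w)))"
  have z[measurable]: "z \<in> borel_measurable F" unfolding z_def by measurable
  have [measurable]: "z \<in> borel_measurable M" by (rule measurable_from_subalg[OF subalg z])
  have z01: "\<bar>z w\<bar> \<le> 1" for w by (auto simp: z_def)
  have Zint: "integrable M ?Z" by (rule integrable_real_indicator) (auto simp: less_top[symmetric])
  have zZ: "AE w in M. z w = real_cond_exp M F ?Z w"
    using real_cond_exp_ge_c[OF Zint, of 0] real_cond_exp_le_c[OF Zint, of 1]
    by (auto simp: z_def indicator_def)
  have key: "expectation (\<lambda>w. ?Z w * real_cond_exp M F u w) = expectation (\<lambda>w. z w * u w)"
    if u: "integrable M u" for u
  proof -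
    have [measurable]: "u \<in> borel_measurable M" using u by auto
    have zu: "integrable M (\<lambda>w. z w * u w)"
      by (rule integrable_bounded_mult[OF u]) (use z01 in auto)
    have "integrable M (\<lambda>w. ?Z w * real_cond_exp M F u w)"
      by (rule integrable_bounded_mult[where c=1]) (use u in \<open>auto simp: indicator_def\<close>)
    then have i: "integrable M (\<lambda>w. real_cond_exp M F u w * ?Z w)" by (simp add: mult.commute)
    have "expectation (\<lambda>w. ?Z w * real_cond_exp M F u w) =
        expectation (\<lambda>w. real_cond_exp M F u w * ?Z w)" by (simp add: mult.commute)
    also have "\<dots> = expectation (\<lambda>w. real_cond_exp M F u w * real_cond_exp M F ?Z w)"
      using real_cond_exp_intg(2)[OF i] by simp
    also have "\<dots> = expectation (\<lambda>w. z w * real_cond_exp M F u w)"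
      by (rule integral_cong_AE) (use zZ in auto)
    also have "\<dots> = expectation (\<lambda>w. z w * u w)"
      using real_cond_exp_intg(2)[OF zu] by simp
    finally show ?thesis .
  qed
  have pint: "integrable (L \<Otimes>\<^sub>M M) (\<lambda>(t, w). g w * u t w)"
    if u: "integrable (L \<Otimes>\<^sub>M M) (\<lambda>(t, w). u t w)" and [measurable]: "g \<in> borel_measurable M"
      and "\<And>w. \<bar>g w\<bar> \<le> 1" for u :: "_ \<Rightarrow> 'a \<Rightarrow> real" and g
  proof -
    have "integrable (L \<Otimes>\<^sub>M M) (\<lambda>x. g (snd x) * (case x of (t, w) \<Rightarrow> u t w))"
      by (rule integrable_bounded_mult[OF u, where c=1]) (use that in auto)
    then show ?thesis by (simp add: case_prod_beta')
  qed
  have swap: "expectation (\<lambda>w. g w * (\<integral>t. u t w \<partial>L)) = (\<integral>t. expectation (\<lambda>w. g w * u t w) \<partial>L)"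
    if u: "integrable (L \<Otimes>\<^sub>M M) (\<lambda>(t, w). u t w)" and "g \<in> borel_measurable M"
      "\<And>w. \<bar>g w\<bar> \<le> 1" for u :: "_ \<Rightarrow> 'a \<Rightarrow> real" and g
    using LM.Fubini_integral[OF pint[OF that]] by simp
  have Z1: "\<bar>?Z w\<bar> \<le> 1" for w by (simp add: indicator_def)
  have "expectation (\<lambda>w. ?Z w * ?H w) = (\<integral>t. expectation (\<lambda>w. ?Z w * h t w) \<partial>L)"
    by (rule swap[OF h]) (use Z1 in auto)
  also have "\<dots> = (\<integral>t. expectation (\<lambda>w. z w * v t w) \<partial>L)"
  proof (rule integral_cong_AE)
    have "(\<lambda>(t, w). ?Z w * h t w) \<in> borel_measurable (L \<Otimes>\<^sub>M M)"
      "(\<lambda>(t, w). z w * v t w) \<in> borel_measurable (L \<Otimes>\<^sub>M M)"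
      using pint[OF h, of ?Z] pint[OF v, of z] Z1 z01 by auto
    then show "(\<lambda>t. expectation (\<lambda>w. ?Z w * h t w)) \<in> borel_measurable L"
      "(\<lambda>t. expectation (\<lambda>w. z w * v t w)) \<in> borel_measurable L"
      by (auto intro!: borel_measurable_lebesgue_integral)
    show "AE t in L. expectation (\<lambda>w. ?Z w * h t w) = expectation (\<lambda>w. z w * v t w)"
      using vh LM.AE_integrable_fst[OF v] LM.AE_integrable_fst[OF h]
    proof eventually_elim
      case (elim t)
      have "expectation (\<lambda>w. ?Z w * h t w) = expectation (\<lambda>w. ?Z w * real_cond_exp M F (v t) w)"
        by (rule integral_cong_AE) (use elim in auto)
      then show ?case using key[OF elim(2)] by simp
    qed
  qed
  also have "\<dots> = expectation (\<lambda>w. z w * ?V w)"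
    by (rule swap[OF v, symmetric]) (use z01 in auto)
  also have "\<dots> = expectation (\<lambda>w. ?Z w * real_cond_exp M F ?V w)"
    by (rule key[OF V, symmetric])
  finally show "(LINT x:A|M. real_cond_exp M F ?V x) = (LINT x:A|M. ?H x)"
    by (simp add: set_lebesgue_integral_def)
qed

text \<open>By \<open>real_cond_exp_Fubini\<close> with \<open>v = h\<close>, the time integral is
  its own conditional expectation. Measurability in \<open>F\<close> is available for the time
  sections of \<open>h\<close> only, so the usual argument by joint measurability does not
  apply.\<close>

lemma ae_measurable_integral:
  assumes "sigma_finite_measure L"
    and h: "integrable (L \<Otimes>\<^sub>M M) (\<lambda>(t, w). h t w)"
    and ae: "AE t in L. ae_measurable M F (h t)"
  shows "ae_measurable M F (\<lambda>w. \<integral>t. h t w \<partial>L)"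
proof (rule ae_measurable_real_cond_exp, rule real_cond_exp_Fubini[OF assms(1) h h])
  interpret L: sigma_finite_measure L by fact
  interpret LM: pair_sigma_finite L M ..
  show "AE t in L. AE w in M. real_cond_exp M F (h t) w = h t w"
    using ae LM.AE_integrable_fst[OF h]
    by eventually_elim (rule real_cond_exp_ae_measurable)
qed

end

section \<open>Square-integrable processes\<close>

lemma (in finite_measure) nn_cauchy_schwarz:
  fixes f :: "'a \<Rightarrow> real"
  assumes [measurable]: "f \<in> borel_measurable M" and pos: "measure M (space M) > 0"
  shows "ennreal ((\<integral>x. f x \<partial>M)\<^sup>2) \<le> ennreal (measure M (space M)) * (\<integral>\<^sup>+x. ennreal ((f x)\<^sup>2) \<partial>M)"
proof (cases "integrable M f \<and> (\<integral>\<^sup>+x. ennreal ((f x)\<^sup>2) \<partial>M) < \<infinity>")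
  case True
  let ?c = "measure M (space M)" and ?I = "\<integral>x. f x \<partial>M"
  have f: "integrable M f" and f2: "integrable M (\<lambda>x. (f x)\<^sup>2)"
    using True by (auto intro!: integrableI_bounded)
  \<comment> \<open>Cauchy-Schwarz against the constant function, by expanding the square of
    \<open>f\<close> minus its mean \<open>?I / ?c\<close>.\<close>
  have "0 \<le> (\<integral>x. (f x - ?I / ?c)\<^sup>2 \<partial>M)" by simp
  also have "\<dots> = (\<integral>x. (f x)\<^sup>2 - (2 * (?I / ?c)) * f x + (?I / ?c)\<^sup>2 \<partial>M)"
    by (intro bochner_integral_cong) (auto simp: power2_eq_square algebra_simps)
  also have "\<dots> = (\<integral>x. (f x)\<^sup>2 \<partial>M) - (2 * (?I / ?c)) * ?I + (?I / ?c)\<^sup>2 * ?c"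
    using f f2 by simp
  also have "\<dots> = (\<integral>x. (f x)\<^sup>2 \<partial>M) - ?I\<^sup>2 / ?c"
    using pos by (simp add: power2_eq_square field_simps)
  finally have "?I\<^sup>2 \<le> ?c * (\<integral>x. (f x)\<^sup>2 \<partial>M)" using pos by (simp add: field_simps)
  moreover have "(\<integral>\<^sup>+x. ennreal ((f x)\<^sup>2) \<partial>M) = ennreal (\<integral>x. (f x)\<^sup>2 \<partial>M)"
    by (rule nn_integral_eq_integral[OF f2]) simp
  ultimately show ?thesis by (simp add: ennreal_mult[symmetric])
next
  case False
  \<comment> \<open>Without integrability the left side is zero by convention; with infinite second
    moment the right side is infinite, the total mass being positive.\<close>
  then consider "\<not> integrable M f" | "(\<integral>\<^sup>+x. ennreal ((f x)\<^sup>2) \<partial>M) = \<infinity>"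
    using less_top by fastforce
  then show ?thesis
    by cases (use pos in \<open>auto simp: not_integrable_integral_eq ennreal_mult_top\<close>)
qed

lemma nn_integral_square_add:
  fixes u v :: "'b \<Rightarrow> real"
  assumes [measurable]: "u \<in> borel_measurable N" "v \<in> borel_measurable N"
  shows "(\<integral>\<^sup>+x. ennreal ((u x + v x)\<^sup>2) \<partial>N) \<le>
    2 * ((\<integral>\<^sup>+x. ennreal ((u x)\<^sup>2) \<partial>N) + (\<integral>\<^sup>+x. ennreal ((v x)\<^sup>2) \<partial>N))"
proof -
  have "(\<integral>\<^sup>+x. ennreal ((u x + v x)\<^sup>2) \<partial>N) \<le> (\<integral>\<^sup>+x. 2 * (ennreal ((u x)\<^sup>2) + ennreal ((v x)\<^sup>2)) \<partial>N)"
  proof (rule nn_integral_mono)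
    fix x
    have "(u x + v x)\<^sup>2 \<le> 2 * ((u x)\<^sup>2 + (v x)\<^sup>2)"
      using sum_squares_bound[of "u x" "v x"] by (simp add: power2_sum)
    from ennreal_leI[OF this]
    show "ennreal ((u x + v x)\<^sup>2) \<le> 2 * (ennreal ((u x)\<^sup>2) + ennreal ((v x)\<^sup>2))"
      by (simp add: ennreal_mult)
  qed
  also have "\<dots> = 2 * ((\<integral>\<^sup>+x. ennreal ((u x)\<^sup>2) \<partial>N) + (\<integral>\<^sup>+x. ennreal ((v x)\<^sup>2) \<partial>N))"
    by (simp add: nn_integral_cmult nn_integral_add)
  finally show ?thesis .
qed

lemma nn_integral_square_scale:
  fixes u :: "'b \<Rightarrow> real"
  assumes [measurable]: "u \<in> borel_measurable N" and a: "\<bar>a\<bar> \<le> b"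
    and c: "(\<integral>\<^sup>+x. ennreal ((u x)\<^sup>2) \<partial>N) \<le> ennreal c" "c \<ge> 0"
  shows "(\<integral>\<^sup>+x. ennreal ((a * u x)\<^sup>2) \<partial>N) \<le> ennreal (b\<^sup>2 * c)"
proof -
  have "a\<^sup>2 \<le> b\<^sup>2" using a by (rule abs_le_square_iff[THEN iffD1, OF order_trans]) simp
  then have "ennreal (a\<^sup>2) * (\<integral>\<^sup>+x. ennreal ((u x)\<^sup>2) \<partial>N) \<le> ennreal (b\<^sup>2) * ennreal c"
    by (intro mult_mono ennreal_leI c) auto
  then show ?thesis using c(2) by (simp add: power_mult_distrib ennreal_mult nn_integral_cmult)
qed

text \<open>Joint measurability refers to the whole of \<open>M\<close>, measurability in
  \<open>F\<close> to single times and up to null sets, matching what is known of the noise. The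
  moment bound stays existential because it serves integrability only and never enters the bounds on
  the kernels.\<close>

definition L2_process :: "'a measure \<Rightarrow> real \<Rightarrow> 'a measure \<Rightarrow> (real \<Rightarrow> 'a \<Rightarrow> real) \<Rightarrow> bool" where
  "L2_process M T F z \<longleftrightarrow>
     process_measurable T M z \<and>
     (\<exists>c::real. \<forall>t\<in>{0..T}. (\<integral>\<^sup>+w. ennreal ((z t w)\<^sup>2) \<partial>M) \<le> ennreal c) \<and>
     (\<forall>t\<in>{0..T}. ae_measurable M F (z t))"

lemma L2_bound:
  assumes "L2_process M T F z"
  obtains c :: real where "c \<ge> 0" "\<And>t. t \<in> {0..T} \<Longrightarrow> (\<integral>\<^sup>+w. ennreal ((z t w)\<^sup>2) \<partial>M) \<le> ennreal c"
proof -
  obtain c where "\<forall>t\<in>{0..T}. (\<integral>\<^sup>+w. ennreal ((z t w)\<^sup>2) \<partial>M) \<le> ennreal c"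
    using assms unfolding L2_process_def by metis
  then show thesis
    using that[of "\<bar>c\<bar>"] by (meson abs_ge_self abs_ge_zero ennreal_leI order_trans)
qed

lemma abs_mult_le_sum_squares: "\<bar>a * b\<bar> \<le> a\<^sup>2 + b\<^sup>2" for a b :: real
proof -
  have "2 * \<bar>a * b\<bar> \<le> a\<^sup>2 + b\<^sup>2"
    using sum_squares_bound[of "\<bar>a\<bar>" "\<bar>b\<bar>"] by (simp add: abs_mult)
  then show ?thesis using abs_ge_zero[of "a * b"] by linarith
qed

lemma L2_D:
  assumes "L2_process M T F z"
  shows "process_measurable T M z"
    "t \<in> {0..T} \<Longrightarrow> z t \<in> borel_measurable M"
    "t \<in> {0..T} \<Longrightarrow> ae_measurable M F (z t)"
    "t \<in> {0..T} \<Longrightarrow> integrable M (\<lambda>w. (z t w)\<^sup>2)"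
proof -
  show m: "process_measurable T M z"
    and "t \<in> {0..T} \<Longrightarrow> ae_measurable M F (z t)"
    using assms by (auto simp: L2_process_def)
  show z: "z t \<in> borel_measurable M" if "t \<in> {0..T}" for t
    using measurable_compose[OF measurable_Pair1' m, of t] that by simp
  show "integrable M (\<lambda>w. (z t w)\<^sup>2)" if t: "t \<in> {0..T}" for t
  proof (rule integrableI_bounded)
    show "(\<lambda>w. (z t w)\<^sup>2) \<in> borel_measurable M" using z[OF t] by simp
    obtain c :: real where "(\<integral>\<^sup>+w. ennreal ((z t w)\<^sup>2) \<partial>M) \<le> ennreal c"
      using L2_bound[OF assms] t by metis
    then show "(\<integral>\<^sup>+w. ennreal (norm ((z t w)\<^sup>2)) \<partial>M) < \<infinity>"
      using le_less_trans[OF _ ennreal_less_top] by auto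
  qed
qed

context prob_space
begin

lemma L2_deterministic:
  assumes f[measurable]: "f \<in> borel_measurable (leb T)"
    and c: "\<And>t. t \<in> {0..T} \<Longrightarrow> \<bar>f t\<bar> \<le> c"
  shows "L2_process M T F (\<lambda>t _. f t)"
  unfolding L2_process_def
proof (intro conjI ballI exI)
  show "process_measurable T M (\<lambda>t w. f t)" by measurable
  fix t assume t: "t \<in> {0..T}"
  have "(f t)\<^sup>2 \<le> c\<^sup>2" using c[OF t] by (rule abs_le_square_iff[THEN iffD1, OF order_trans]) simp
  then show "(\<integral>\<^sup>+w. ennreal ((f t)\<^sup>2) \<partial>M) \<le> ennreal (c\<^sup>2)"
    by (simp add: emeasure_space_1 ennreal_leI)
  show "ae_measurable M F (\<lambda>_. f t)" by (rule ae_measurable_const)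
qed

lemma L2_add:
  assumes y: "L2_process M T F y" and z: "L2_process M T F z"
  shows "L2_process M T F (\<lambda>t w. y t w + z t w)"
proof -
  obtain c :: real where c0: "c \<ge> 0" and c: "\<And>t. t \<in> {0..T} \<Longrightarrow> (\<integral>\<^sup>+w. ennreal ((y t w)\<^sup>2) \<partial>M) \<le> ennreal c"
    using L2_bound[OF y] by metis
  obtain d :: real where d0: "d \<ge> 0" and d: "\<And>t. t \<in> {0..T} \<Longrightarrow> (\<integral>\<^sup>+w. ennreal ((z t w)\<^sup>2) \<partial>M) \<le> ennreal d"
    using L2_bound[OF z] by metis
  show ?thesis unfolding L2_process_def
  proof (intro conjI ballI exI)
    show "process_measurable T M (\<lambda>t w. y t w + z t w)"
      using L2_D(1)[OF y] L2_D(1)[OF z] by (auto simp: case_prod_beta')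
    fix t assume t: "t \<in> {0..T}"
    note [measurable] = L2_D(2)[OF y t] L2_D(2)[OF z t]
    have "(\<integral>\<^sup>+w. ennreal ((y t w + z t w)\<^sup>2) \<partial>M) \<le>
        2 * ((\<integral>\<^sup>+w. ennreal ((y t w)\<^sup>2) \<partial>M) + (\<integral>\<^sup>+w. ennreal ((z t w)\<^sup>2) \<partial>M))"
      by (rule nn_integral_square_add) auto
    also have "\<dots> \<le> 2 * (ennreal c + ennreal d)"
      by (intro mult_left_mono add_mono c[OF t] d[OF t]) simp
    also have "\<dots> = ennreal (2 * (c + d))" using c0 d0 by (simp add: ennreal_mult)
    finally show "(\<integral>\<^sup>+w. ennreal ((y t w + z t w)\<^sup>2) \<partial>M) \<le> ennreal (2 * (c + d))" .
    show "ae_measurable M F (\<lambda>w. y t w + z t w)"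
      by (intro ae_measurable_add L2_D(3)[OF y t] L2_D(3)[OF z t])
  qed
qed

lemma L2_scale:
  assumes f[measurable]: "f \<in> borel_measurable (leb T)"
    and b: "\<And>t. t \<in> {0..T} \<Longrightarrow> \<bar>f t\<bar> \<le> b" and z: "L2_process M T F z"
  shows "L2_process M T F (\<lambda>t w. f t * z t w)"
proof -
  obtain c :: real where c0: "c \<ge> 0" and c: "\<And>t. t \<in> {0..T} \<Longrightarrow> (\<integral>\<^sup>+w. ennreal ((z t w)\<^sup>2) \<partial>M) \<le> ennreal c"
    using L2_bound[OF z] by metis
  show ?thesis unfolding L2_process_def
  proof (intro conjI ballI exI)
    show "process_measurable T M (\<lambda>t w. f t * z t w)"
      using L2_D(1)[OF z] by (auto simp: case_prod_beta')
    fix t assume t: "t \<in> {0..T}"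
    show "(\<integral>\<^sup>+w. ennreal ((f t * z t w)\<^sup>2) \<partial>M) \<le> ennreal (b\<^sup>2 * c)"
      by (rule nn_integral_square_scale[OF L2_D(2)[OF z t] b[OF t] c[OF t] c0])
    show "ae_measurable M F (\<lambda>w. f t * z t w)"
      by (intro ae_measurable_mult ae_measurable_const L2_D(3)[OF z t])
  qed
qed

lemma L2_nn_integral:
  assumes z: "L2_process M T F z" and "T > 0"
  obtains c :: real where "c \<ge> 0"
    "(\<integral>\<^sup>+t. (\<integral>\<^sup>+w. ennreal ((z t w)\<^sup>2) \<partial>M) \<partial>leb T) \<le> ennreal c"
proof -
  obtain c :: real where c0: "c \<ge> 0" and c: "\<And>t. t \<in> {0..T} \<Longrightarrow> (\<integral>\<^sup>+w. ennreal ((z t w)\<^sup>2) \<partial>M) \<le> ennreal c"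
    using L2_bound[OF z] by metis
  have "(\<integral>\<^sup>+t. (\<integral>\<^sup>+w. ennreal ((z t w)\<^sup>2) \<partial>M) \<partial>leb T) \<le> (\<integral>\<^sup>+t. ennreal c \<partial>leb T)"
    using c by (intro nn_integral_mono) auto
  also have "\<dots> = ennreal (c * T)"
    using \<open>T > 0\<close> time.emeasure_eq_measure[of T "{0..T}"] measure_leb[of T] c0
    by (simp add: ennreal_mult)
  finally show thesis using that[of "c * T"] \<open>T > 0\<close> c0 by auto
qed

text \<open>The factors may belong to different sigma-algebras, since the cross terms multiply a
  functional of the paths by the noise. Domination by the sum of squares works without
  independence.\<close>

lemma L2_mult_integrable:
  assumes y: "L2_process M T F y" and z: "L2_process M T G z" and "T > 0"
  shows "process_integrable T M (\<lambda>t w. y t w * z t w)"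
proof -
  interpret LM: pair_sigma_finite "leb T" M ..
  have sq: "process_integrable T M (\<lambda>t w. (z t w)\<^sup>2)" if z: "L2_process M T F z" for F z
  proof (rule integrableI_bounded)
    have [measurable]: "(\<lambda>x. z (fst x) (snd x)) \<in> borel_measurable (leb T \<Otimes>\<^sub>M M)"
      using L2_D(1)[OF z] by (simp add: case_prod_beta')
    show "process_measurable T M (\<lambda>t w. (z t w)\<^sup>2)"
      unfolding case_prod_beta' by measurable
    obtain c where c: "(\<integral>\<^sup>+t. (\<integral>\<^sup>+w. ennreal ((z t w)\<^sup>2) \<partial>M) \<partial>leb T) \<le> ennreal c"
      using L2_nn_integral[OF z \<open>T > 0\<close>] by blast
    have "(\<integral>\<^sup>+x. ennreal (norm (case x of (t, w) \<Rightarrow> (z t w)\<^sup>2)) \<partial>(leb T \<Otimes>\<^sub>M M)) =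
      (\<integral>\<^sup>+t. (\<integral>\<^sup>+w. ennreal ((z t w)\<^sup>2) \<partial>M) \<partial>leb T)"
      by (subst nn_integral_fst[symmetric]) (auto simp: case_prod_beta')
    also have "\<dots> < \<infinity>" using le_less_trans[OF c ennreal_less_top] by simp
    finally show "(\<integral>\<^sup>+x. ennreal (norm (case x of (t, w) \<Rightarrow> (z t w)\<^sup>2)) \<partial>(leb T \<Otimes>\<^sub>M M)) < \<infinity>" .
  qed
  have "integrable (leb T \<Otimes>\<^sub>M M) (\<lambda>x. (y (fst x) (snd x))\<^sup>2 + (z (fst x) (snd x))\<^sup>2)"
    using sq[OF y] sq[OF z] by (auto simp: case_prod_beta')
  then show ?thesis
  proof (rule Bochner_Integration.integrable_bound)
    show "process_measurable T M (\<lambda>t w. y t w * z t w)"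
      using L2_D(1)[OF y] L2_D(1)[OF z] by (auto simp: case_prod_beta')
    show "AE x in leb T \<Otimes>\<^sub>M M. norm (case x of (t, w) \<Rightarrow> y t w * z t w) \<le>
        norm ((y (fst x) (snd x))\<^sup>2 + (z (fst x) (snd x))\<^sup>2)"
      using abs_mult_le_sum_squares by (auto simp: case_prod_beta')
  qed
qed

lemma L2_integrable:
  assumes z: "L2_process M T F z" and "T > 0"
  shows "process_integrable T M z"
  using L2_mult_integrable[OF L2_deterministic[of "\<lambda>_. 1" T 1 F] z \<open>T > 0\<close>] by simp

lemma L2_mult_integrable_at:
  assumes y: "L2_process M T F y" and z: "L2_process M T G z" and t: "t \<in> {0..T}"
  shows "integrable M (\<lambda>w. y t w * z t w)"
proof (rule Bochner_Integration.integrable_bound)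
  show "integrable M (\<lambda>w. (y t w)\<^sup>2 + (z t w)\<^sup>2)"
    using L2_D(4)[OF y t] L2_D(4)[OF z t] by simp
  show "(\<lambda>w. y t w * z t w) \<in> borel_measurable M"
    using L2_D(2)[OF y t] L2_D(2)[OF z t] by simp
  show "AE w in M. norm (y t w * z t w) \<le> norm ((y t w)\<^sup>2 + (z t w)\<^sup>2)"
    using abs_mult_le_sum_squares by auto
qed

lemma L2_integrable_at:
  assumes z: "L2_process M T F z" and t: "t \<in> {0..T}"
  shows "integrable M (z t)"
  using L2_mult_integrable_at[OF L2_deterministic[of "\<lambda>_. 1" T 1 F] z t] by simp

text \<open>Cauchy-Schwarz in \<open>s\<close> followed by Fubini bounds the second moments
  uniformly in \<open>t\<close>. Since \<open>F\<close> is a single sigma-algebra and not a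
  filtration, integrating over the whole time interval preserves measurability in it.\<close>

lemma L2_kernel:
  assumes F: "subalgebra M F" and "T > 0"
    and \<kappa>: "process_measurable T (leb T) \<kappa>"
    and b: "\<And>t s. t \<in> {0..T} \<Longrightarrow> s \<in> {0..T} \<Longrightarrow> \<bar>\<kappa> t s\<bar> \<le> b"
    and z: "L2_process M T F z"
  shows "L2_process M T F (\<lambda>t w. \<integral>s. \<kappa> t s * z s w \<partial>leb T)"
proof -
  let ?L = "leb T"
  interpret LM: pair_sigma_finite ?L M ..
  interpret prob_space_subalgebra M F by unfold_locales (rule F)
  note zm = L2_D(1)[OF z]
  obtain c :: real where c0: "c \<ge> 0" and c: "\<And>t. t \<in> {0..T} \<Longrightarrow> (\<integral>\<^sup>+w. ennreal ((z t w)\<^sup>2) \<partial>M) \<le> ennreal c"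
    using L2_bound[OF z] by metis
  show ?thesis unfolding L2_process_def
  proof (intro conjI ballI exI)
    have "(\<lambda>x. \<integral>s. \<kappa> (fst x) s * z s (snd x) \<partial>?L) \<in> borel_measurable (?L \<Otimes>\<^sub>M M)"
    proof (rule time.borel_measurable_lebesgue_integral)
      show "(\<lambda>(x, s). \<kappa> (fst x) s * z s (snd x)) \<in> borel_measurable ((?L \<Otimes>\<^sub>M M) \<Otimes>\<^sub>M ?L)"
        unfolding case_prod_beta'
        by (intro borel_measurable_times process_compose[OF zm] process_compose[OF \<kappa>] measurable_snd
            measurable_compose[OF measurable_fst measurable_fst] measurable_compose[OF measurable_fst measurable_snd])
    qed
    then show "process_measurable T M (\<lambda>t w. \<integral>s. \<kappa> t s * z s w \<partial>?L)"
      by (simp add: case_prod_beta')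
    fix t assume t: "t \<in> {0..T}"
    have "Pair t \<in> measurable ?L (?L \<Otimes>\<^sub>M ?L)" using t by (intro measurable_Pair1') simp
    from measurable_compose[OF this \<kappa>] have \<kappa>t: "\<kappa> t \<in> borel_measurable ?L" by simp
    have sc: "L2_process M T F (\<lambda>s w. \<kappa> t s * z s w)"
      by (rule L2_scale[OF \<kappa>t _ z]) (use b t in auto)
    have m: "(\<lambda>(s, w). ennreal ((\<kappa> t s * z s w)\<^sup>2)) \<in> borel_measurable (?L \<Otimes>\<^sub>M M)"
      using L2_D(1)[OF sc] by (auto simp: case_prod_beta')
    have "(\<integral>\<^sup>+w. ennreal ((\<integral>s. \<kappa> t s * z s w \<partial>?L)\<^sup>2) \<partial>M) \<le>
        (\<integral>\<^sup>+w. ennreal T * (\<integral>\<^sup>+s. ennreal ((\<kappa> t s * z s w)\<^sup>2) \<partial>?L) \<partial>M)"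
    proof (rule nn_integral_mono)
      fix w assume "w \<in> space M"
      then show "ennreal ((\<integral>s. \<kappa> t s * z s w \<partial>?L)\<^sup>2) \<le> ennreal T * (\<integral>\<^sup>+s. ennreal ((\<kappa> t s * z s w)\<^sup>2) \<partial>?L)"
        using time.nn_cauchy_schwarz[OF process_section[OF L2_D(1)[OF sc]]]
          measure_leb[of T] \<open>T > 0\<close> by simp
    qed
    also have "\<dots> = ennreal T * (\<integral>\<^sup>+w. (\<integral>\<^sup>+s. ennreal ((\<kappa> t s * z s w)\<^sup>2) \<partial>?L) \<partial>M)"
    proof (rule nn_integral_cmult, rule time.borel_measurable_nn_integral)
      show "(\<lambda>(w, s). ennreal ((\<kappa> t s * z s w)\<^sup>2)) \<in> borel_measurable (M \<Otimes>\<^sub>M ?L)"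
        using measurable_compose[OF measurable_pair_swap' m] by (simp add: case_prod_beta')
    qed
    also have "(\<integral>\<^sup>+w. (\<integral>\<^sup>+s. ennreal ((\<kappa> t s * z s w)\<^sup>2) \<partial>?L) \<partial>M) =
        (\<integral>\<^sup>+s. (\<integral>\<^sup>+w. ennreal ((\<kappa> t s * z s w)\<^sup>2) \<partial>M) \<partial>?L)"
      by (rule LM.Fubini'[OF m])
    also have "\<dots> \<le> (\<integral>\<^sup>+s. ennreal (b\<^sup>2 * c) \<partial>?L)"
    proof (rule nn_integral_mono)
      fix s assume "s \<in> space ?L"
      then show "(\<integral>\<^sup>+w. ennreal ((\<kappa> t s * z s w)\<^sup>2) \<partial>M) \<le> ennreal (b\<^sup>2 * c)"
        using b[OF t] by (intro nn_integral_square_scale c0 c L2_D(2)[OF z]) auto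
    qed
    also have "\<dots> = ennreal (b\<^sup>2 * c * T)"
      using \<open>T > 0\<close> time.emeasure_eq_measure[of T "{0..T}"] measure_leb[of T] c0
      by (simp add: ennreal_mult)
    finally show "(\<integral>\<^sup>+w. ennreal ((\<integral>s. \<kappa> t s * z s w \<partial>?L)\<^sup>2) \<partial>M) \<le> ennreal (T * (b\<^sup>2 * c * T))"
      using \<open>T > 0\<close> c0 by (simp add: ennreal_mult mult_left_mono)
    show "ae_measurable M F (\<lambda>w. \<integral>s. \<kappa> t s * z s w \<partial>?L)"
    proof (rule ae_measurable_integral[OF time.sigma_finite_measure_axioms L2_integrable[OF sc \<open>T > 0\<close>]], rule AE_I2)
      fix s assume "s \<in> space ?L"
      then show "ae_measurable M F (\<lambda>w. \<kappa> t s * z s w)" using L2_D(3)[OF sc, of s] by simp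
    qed
  qed
qed

end

section \<open>Wiener integrals\<close>

text \<open>Its sets are literally those in \<open>indep_of_process\<close>, so the independence
  hypothesis carries over by unfolding.\<close>

definition path_algebra :: "'a measure \<Rightarrow> real \<Rightarrow> (real \<Rightarrow> 'a \<Rightarrow> real) \<Rightarrow> 'a measure" where
  "path_algebra M T W = sigma (space M) (path_events M T W)"

lemma sets_path_algebra: "sets (path_algebra M T W) = sigma_sets (space M) (path_events M T W)"
  unfolding path_algebra_def by (rule sets_measure_of) (auto simp: path_events_def)

lemma space_path_algebra [simp]: "space (path_algebra M T W) = space M"
  unfolding path_algebra_def by (rule space_measure_of) (auto simp: path_events_def)

lemma path_algebra_measurable:
  assumes "t \<in> {0..T}"
  shows "W t \<in> borel_measurable (path_algebra M T W)"
proof (rule measurableI)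
  fix B :: "real set" assume "B \<in> sets borel"
  then have "W t -` B \<inter> space M \<in> path_events M T W"
    using assms by (auto simp: path_events_def)
  then show "W t -` B \<inter> space (path_algebra M T W) \<in> sets (path_algebra M T W)"
    unfolding sets_path_algebra by auto
qed simp

lemma subalgebra_path_algebra:
  assumes "\<And>t. t \<in> {0..T} \<Longrightarrow> W t \<in> borel_measurable M"
  shows "subalgebra M (path_algebra M T W)"
  unfolding subalgebra_def sets_path_algebra
proof (intro conjI sets.sigma_sets_subset)
  show "path_events M T W \<subseteq> sets M"
    unfolding path_events_def using measurable_sets[OF assms] by auto
qed simp

definition time_partition :: "nat \<Rightarrow> (nat \<Rightarrow> real) \<Rightarrow> real \<Rightarrow> bool" where
  "time_partition n \<tau> t \<longleftrightarrow> 0 \<le> \<tau> 0 \<and> (\<forall>i<n. \<tau> i \<le> \<tau> (Suc i)) \<and> \<tau> n \<le> t"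

lemma time_partition_bounds:
  assumes "time_partition n \<tau> t" "i < n"
  shows "0 \<le> \<tau> i" "\<tau> i \<le> \<tau> (Suc i)" "\<tau> (Suc i) \<le> t"
proof -
  have p: "0 \<le> \<tau> 0" "\<And>i. i < n \<Longrightarrow> \<tau> i \<le> \<tau> (Suc i)" "\<tau> n \<le> t"
    using assms(1) by (auto simp: time_partition_def)
  show "\<tau> i \<le> \<tau> (Suc i)" using assms(2) by (rule p)
  have "0 \<le> \<tau> i" if "i \<le> n" for i using that
  proof (induction i)
    case (Suc i)
    then show ?case using p(2)[of i] by simp
  qed (use p in simp)
  then show "0 \<le> \<tau> i" using assms(2) by simp
  have "Suc i \<le> n" using assms(2) by simp
  then have "\<tau> (Suc i) \<le> \<tau> n"
  proof (induction rule: inc_induct)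
    case (step k)
    then show ?case using p(2)[of k] by simp
  qed simp
  then show "\<tau> (Suc i) \<le> t" using p(3) by simp
qed

lemma step_fun_measurable [measurable]: "step_fun n \<tau> c \<in> borel_measurable borel"
  unfolding step_fun_def[abs_def] by measurable

lemma step_fun_outside:
  assumes "time_partition n \<tau> t" "s \<notin> {0..t}"
  shows "step_fun n \<tau> c s = 0"
  unfolding step_fun_def
proof (intro sum.neutral ballI)
  fix i assume "i \<in> {..<n}"
  then show "c i * indicator {\<tau> i<..\<tau> (Suc i)} s = 0"
    using time_partition_bounds[OF assms(1), of i] assms(2) by (auto simp: indicator_def)
qed

text \<open>The four-term expression is the increment of \<open>min\<close> over a rectangle, which
  is what bilinearity makes of the Brownian covariance \<open>min u v\<close>. In this form the
  length of the overlap and the covariance of two increments are the same formula.\<close>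

lemma integral_interval_overlap:
  fixes a b c d :: real
  assumes "a \<le> b" "c \<le> d"
  shows "integrable lborel (\<lambda>s. indicator {a<..b} s * indicator {c<..d} s :: real)"
    and "(\<integral>s. indicator {a<..b} s * indicator {c<..d} s \<partial>lborel) = min b d - min b c - min a d + min a c"
proof -
  have eq: "(\<lambda>s. indicator {a<..b} s * indicator {c<..d} s) = (indicator {max a c<..min b d} :: real \<Rightarrow> real)"
    by (auto simp: indicator_def)
  have enn: "enn2real (ennreal x) = max 0 x" for x
    by (cases "x \<ge> 0") (auto simp: ennreal_neg)
  have em: "emeasure lborel {max a c<..min b d} = ennreal (max 0 (min b d - max a c))"
  proof (cases "max a c \<le> min b d")
    case True
    then show ?thesis by (simp add: max_def)
  next
    case False
    then have "{max a c<..min b d} = {}" by auto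
    then show ?thesis using False by (auto simp: max_def)
  qed
  show "integrable lborel (\<lambda>s. indicator {a<..b} s * indicator {c<..d} s :: real)"
    unfolding eq by (rule integrable_real_indicator) (simp_all add: em)
  have "(\<integral>s. indicator {max a c<..min b d} s \<partial>lborel) = measure lborel {max a c<..min b d}" by simp
  also have "\<dots> = max 0 (min b d - max a c)" unfolding measure_def em enn by simp
  also have "\<dots> = min b d - min b c - min a d + min a c" using assms by (auto simp: min_def max_def)
  finally show "(\<integral>s. indicator {a<..b} s * indicator {c<..d} s \<partial>lborel) = min b d - min b c - min a d + min a c"
    unfolding eq .
qed

section \<open>Brownian motion: covariances, isometry for step functions, Wiener integrals\<close>

context prob_space
begin

lemma normal_second_moment:
  assumes D: "distributed M lborel X (normal_density 0 \<sigma>)" and "\<sigma> > 0"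
  shows "integrable M X" "expectation X = 0" "integrable M (\<lambda>w. (X w)\<^sup>2)" "expectation (\<lambda>w. (X w)\<^sup>2) = \<sigma>\<^sup>2"
proof -
  show "integrable M X"
    using distributed_integrable[OF D, of "\<lambda>x. x"] integrable_normal_moment[OF \<open>\<sigma> > 0\<close>, of 0 1] by simp
  show E: "expectation X = 0" by (rule normal_distributed_expectation[OF \<open>\<sigma> > 0\<close> D])
  show "integrable M (\<lambda>w. (X w)\<^sup>2)"
    using distributed_integrable[OF D, of "\<lambda>x. x\<^sup>2"] integrable_normal_moment[OF \<open>\<sigma> > 0\<close>, of 0 2] by simp
  show "expectation (\<lambda>w. (X w)\<^sup>2) = \<sigma>\<^sup>2"
    using normal_distributed_variance[OF \<open>\<sigma> > 0\<close> D] unfolding E by simp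
qed

context
  fixes T :: real and W :: "real \<Rightarrow> 'a \<Rightarrow> real"
  assumes bm: "brownian_motion M T W"
begin

lemma brownian_measurable: "t \<in> {0..T} \<Longrightarrow> W t \<in> borel_measurable M"
  using bm by (simp add: brownian_motion_def)

lemma brownian_increment:
  assumes "0 \<le> a" "a \<le> b" "b \<le> T"
  shows "integrable M (\<lambda>w. W b w - W a w)" "expectation (\<lambda>w. W b w - W a w) = 0"
    "integrable M (\<lambda>w. (W b w - W a w)\<^sup>2)" "expectation (\<lambda>w. (W b w - W a w)\<^sup>2) = b - a"
proof -
  have "integrable M (\<lambda>w. W b w - W a w) \<and> expectation (\<lambda>w. W b w - W a w) = 0 \<and>
    integrable M (\<lambda>w. (W b w - W a w)\<^sup>2) \<and> expectation (\<lambda>w. (W b w - W a w)\<^sup>2) = b - a"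
  proof (cases "a = b")
    \<comment> \<open>Equal times are split off: the law of an increment is prescribed for distinct
      times only, the density with zero deviation being degenerate.\<close>
    case False
    then have "distributed M lborel (\<lambda>w. W b w - W a w) (normal_density 0 (sqrt (b - a)))"
      using bm assms by (simp add: brownian_motion_def)
    from normal_second_moment[OF this] False assms show ?thesis by simp
  qed simp
  then show "integrable M (\<lambda>w. W b w - W a w)" "expectation (\<lambda>w. W b w - W a w) = 0"
    "integrable M (\<lambda>w. (W b w - W a w)\<^sup>2)" "expectation (\<lambda>w. (W b w - W a w)\<^sup>2) = b - a"
    by auto
qed

lemma brownian_increments_orthogonal:
  assumes "0 \<le> a" "a \<le> b" "b \<le> c" "c \<le> T"
  shows "integrable M (\<lambda>w. (W b w - W a w) * (W c w - W b w))"
    and "expectation (\<lambda>w. (W b w - W a w) * (W c w - W b w)) = 0"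
proof -
  define \<tau> :: "nat \<Rightarrow> real" where "\<tau> = (\<lambda>i. if i = 0 then a else if i = 1 then b else c)"
  have "indep_vars (\<lambda>_. borel) (\<lambda>i w. W (\<tau> (Suc i)) w - W (\<tau> i) w) {..<2}"
  proof -
    have "0 \<le> \<tau> 0 \<and> (\<forall>i<2. \<tau> i \<le> \<tau> (Suc i)) \<and> \<tau> 2 \<le> T"
      using assms by (auto simp: \<tau>_def)
    then show ?thesis using bm unfolding brownian_motion_def by blast
  qed
  note indep = this
  have int: "integrable M (\<lambda>w. W (\<tau> (Suc i)) w - W (\<tau> i) w)"
    and E: "expectation (\<lambda>w. W (\<tau> (Suc i)) w - W (\<tau> i) w) = 0" if "i < 2" for i
    using assms that brownian_increment(1,2)[of a b] brownian_increment(1,2)[of b c]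
    by (cases "i = 0"; simp add: \<tau>_def)+
  have p: "(\<Prod>i<2::nat. f i) = f 0 * f 1" for f :: "nat \<Rightarrow> real"
    by (simp add: numeral_2_eq_2)
  show "integrable M (\<lambda>w. (W b w - W a w) * (W c w - W b w))"
    using indep_vars_integrable[OF _ indep int] unfolding p by (simp add: \<tau>_def)
  show "expectation (\<lambda>w. (W b w - W a w) * (W c w - W b w)) = 0"
    using indep_vars_lebesgue_integral[OF _ indep int] E[of 0] unfolding p by (simp add: \<tau>_def)
qed

text \<open>Values are taken relative to \<open>W 0\<close>, which vanishes only almost surely.
  Writing the later value as the earlier one plus an increment leaves a square and an orthogonal
  product.\<close>

lemma brownian_covariance:
  assumes "u \<in> {0..T}" "v \<in> {0..T}"
  shows "integrable M (\<lambda>w. (W u w - W 0 w) * (W v w - W 0 w))"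
    and "expectation (\<lambda>w. (W u w - W 0 w) * (W v w - W 0 w)) = min u v"
proof -
  have *: "integrable M (\<lambda>w. (W u w - W 0 w) * (W v w - W 0 w)) \<and>
    expectation (\<lambda>w. (W u w - W 0 w) * (W v w - W 0 w)) = u"
    if "0 \<le> u" "u \<le> v" "v \<le> T" for u v
  proof -
    have eq: "(W u w - W 0 w) * (W v w - W 0 w) =
        (W u w - W 0 w)\<^sup>2 + (W u w - W 0 w) * (W v w - W u w)" for w
      by (simp add: power2_eq_square algebra_simps)
    have "0 \<le> T" "u \<le> T" using that by auto
    with brownian_increments_orthogonal[of 0 u v] brownian_increment[of 0 u] that
    show ?thesis unfolding eq by simp
  qed
  show "integrable M (\<lambda>w. (W u w - W 0 w) * (W v w - W 0 w))"
    "expectation (\<lambda>w. (W u w - W 0 w) * (W v w - W 0 w)) = min u v"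
    using *[of u v] *[of v u] assms by (cases "u \<le> v", auto simp: mult.commute min_def)+
qed

text \<open>Bilinearity reduces intervals in any mutual position to
  \<open>brownian_covariance\<close>, so that two step functions can be paired without a common
  refinement of their partitions.\<close>

lemma brownian_increment_covariance:
  assumes "0 \<le> a" "a \<le> b" "b \<le> T" "0 \<le> c" "c \<le> d" "d \<le> T"
  shows "integrable M (\<lambda>w. (W b w - W a w) * (W d w - W c w))"
    and "expectation (\<lambda>w. (W b w - W a w) * (W d w - W c w)) =
      (\<integral>s. indicator {a<..b} s * indicator {c<..d} s \<partial>lborel)"
proof -
  let ?V = "\<lambda>t w. W t w - W 0 w"
  have eq: "(W b w - W a w) * (W d w - W c w) =
      ?V b w * ?V d w - ?V b w * ?V c w - ?V a w * ?V d w + ?V a w * ?V c w" for w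
    by (simp add: algebra_simps)
  have m: "a \<in> {0..T}" "b \<in> {0..T}" "c \<in> {0..T}" "d \<in> {0..T}" using assms by auto
  note int = brownian_covariance(1)[OF m(2,4)] brownian_covariance(1)[OF m(2,3)]
    brownian_covariance(1)[OF m(1,4)] brownian_covariance(1)[OF m(1,3)]
  show "integrable M (\<lambda>w. (W b w - W a w) * (W d w - W c w))"
    unfolding eq using int by (intro bochner_integrable_add Bochner_Integration.integrable_diff)
  show "expectation (\<lambda>w. (W b w - W a w) * (W d w - W c w)) =
      (\<integral>s. indicator {a<..b} s * indicator {c<..d} s \<partial>lborel)"
    unfolding eq integral_interval_overlap(2)[OF assms(2,5)]
    by (subst Bochner_Integration.integral_add Bochner_Integration.integral_diff,
        intro int bochner_integrable_add Bochner_Integration.integrable_diff,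
        intro int bochner_integrable_add Bochner_Integration.integrable_diff)+
      (simp add: brownian_covariance(2)[OF m(2,4)] brownian_covariance(2)[OF m(2,3)]
        brownian_covariance(2)[OF m(1,4)] brownian_covariance(2)[OF m(1,3)])
qed

lemma step_integral_product:
  assumes p: "time_partition n \<tau> T" and p': "time_partition n' \<tau>' T"
  shows "integrable M (\<lambda>w. step_integral W n \<tau> c w * step_integral W n' \<tau>' c' w)"
    and "integrable lborel (\<lambda>s. step_fun n \<tau> c s * step_fun n' \<tau>' c' s)"
    and "expectation (\<lambda>w. step_integral W n \<tau> c w * step_integral W n' \<tau>' c' w) =
      (\<integral>s. step_fun n \<tau> c s * step_fun n' \<tau>' c' s \<partial>lborel)"
proof -
  let ?D = "\<lambda>\<tau> i w. W (\<tau> (Suc i)) w - W (\<tau> i) w"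
  let ?I = "\<lambda>\<tau> i s. indicator {\<tau> i<..\<tau> (Suc i)} s :: real"
  have eq1: "step_integral W n \<tau> c w * step_integral W n' \<tau>' c' w =
      (\<Sum>i<n. \<Sum>j<n'. (c i * c' j) * (?D \<tau> i w * ?D \<tau>' j w))" for w
    unfolding step_integral_def sum_product by (intro sum.cong refl) (simp add: ac_simps)
  have eq2: "step_fun n \<tau> c s * step_fun n' \<tau>' c' s =
      (\<Sum>i<n. \<Sum>j<n'. (c i * c' j) * (?I \<tau> i s * ?I \<tau>' j s))" for s
    unfolding step_fun_def sum_product by (intro sum.cong refl) (simp add: ac_simps)
  note b = time_partition_bounds[OF p] and b' = time_partition_bounds[OF p']
  have i1: "integrable M (\<lambda>w. (c i * c' j) * (?D \<tau> i w * ?D \<tau>' j w))" if "i < n" "j < n'" for i j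
    using brownian_increment_covariance(1)[OF b[OF that(1)] b'[OF that(2)]]
    by (rule Bochner_Integration.integrable_mult_right)
  have i2: "integrable lborel (\<lambda>s. (c i * c' j) * (?I \<tau> i s * ?I \<tau>' j s))" if "i < n" "j < n'" for i j
    using integral_interval_overlap(1)[OF b(2)[OF that(1)] b'(2)[OF that(2)]]
    by (rule Bochner_Integration.integrable_mult_right)
  show "integrable M (\<lambda>w. step_integral W n \<tau> c w * step_integral W n' \<tau>' c' w)"
    unfolding eq1 using i1 by (intro Bochner_Integration.integrable_sum) auto
  show "integrable lborel (\<lambda>s. step_fun n \<tau> c s * step_fun n' \<tau>' c' s)"
    unfolding eq2 using i2 by (intro Bochner_Integration.integrable_sum) auto
  have "expectation (\<lambda>w. step_integral W n \<tau> c w * step_integral W n' \<tau>' c' w) =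
      (\<Sum>i<n. \<Sum>j<n'. expectation (\<lambda>w. (c i * c' j) * (?D \<tau> i w * ?D \<tau>' j w)))"
    unfolding eq1 using i1
    by (subst Bochner_Integration.integral_sum)
      (auto intro!: Bochner_Integration.integrable_sum sum.cong Bochner_Integration.integral_sum)
  also have "\<dots> = (\<Sum>i<n. \<Sum>j<n'. \<integral>s. (c i * c' j) * (?I \<tau> i s * ?I \<tau>' j s) \<partial>lborel)"
  proof (intro sum.cong refl)
    fix i j assume ij: "i \<in> {..<n}" "j \<in> {..<n'}"
    then show "expectation (\<lambda>w. (c i * c' j) * (?D \<tau> i w * ?D \<tau>' j w)) =
        (\<integral>s. (c i * c' j) * (?I \<tau> i s * ?I \<tau>' j s) \<partial>lborel)"
      using brownian_increment_covariance(2)[OF b b', of i j] by simp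
  qed
  also have "\<dots> = (\<integral>s. step_fun n \<tau> c s * step_fun n' \<tau>' c' s \<partial>lborel)"
    unfolding eq2 using i2
    by (subst Bochner_Integration.integral_sum)
      (auto intro!: Bochner_Integration.integrable_sum sum.cong Bochner_Integration.integral_sum[symmetric])
  finally show "expectation (\<lambda>w. step_integral W n \<tau> c w * step_integral W n' \<tau>' c' w) =
      (\<integral>s. step_fun n \<tau> c s * step_fun n' \<tau>' c' s \<partial>lborel)" .
qed

lemma step_integral_isometry:
  assumes p: "time_partition n \<tau> T" and p': "time_partition n' \<tau>' T"
  shows "(\<integral>\<^sup>+w. ennreal ((step_integral W n \<tau> c w - step_integral W n' \<tau>' c' w)\<^sup>2) \<partial>M) =
      (\<integral>\<^sup>+s. ennreal ((step_fun n \<tau> c s - step_fun n' \<tau>' c' s)\<^sup>2) \<partial>lborel)"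
proof -
  have eq: "(a - b)\<^sup>2 = a * a - 2 * (a * b) + b * b" for a b :: real
    by (simp add: power2_eq_square algebra_simps)
  note p1 = step_integral_product[OF p p, of c c]
  note p2 = step_integral_product[OF p p', of c c']
  note p3 = step_integral_product[OF p' p', of c' c']
  let ?X = "step_integral W n \<tau> c" and ?Y = "step_integral W n' \<tau>' c'"
  let ?f = "step_fun n \<tau> c" and ?g = "step_fun n' \<tau>' c'"
  have i1: "integrable M (\<lambda>w. (?X w - ?Y w)\<^sup>2)" unfolding eq using p1(1) p2(1) p3(1) by auto
  have i2: "integrable lborel (\<lambda>s. (?f s - ?g s)\<^sup>2)" unfolding eq using p1(2) p2(2) p3(2) by auto
  have "expectation (\<lambda>w. (?X w - ?Y w)\<^sup>2) = (\<integral>s. (?f s - ?g s)\<^sup>2 \<partial>lborel)"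
    unfolding eq using p1 p2 p3 by simp
  then show ?thesis
    using nn_integral_eq_integral[OF i1] nn_integral_eq_integral[OF i2] by simp
qed

lemma step_integral_measurable:
  assumes "time_partition n \<tau> T"
  shows "step_integral W n \<tau> c \<in> borel_measurable (path_algebra M T W)"
  unfolding step_integral_def[abs_def]
proof (intro borel_measurable_sum borel_measurable_times borel_measurable_diff borel_measurable_const
    path_algebra_measurable)
  fix i assume "i \<in> {..<n}"
  then show "\<tau> i \<in> {0..T}" "\<tau> (Suc i) \<in> {0..T}"
    using time_partition_bounds[OF assms, of i] by auto
qed

lemma subalgebra_path: "subalgebra M (path_algebra M T W)"
  by (rule subalgebra_path_algebra[OF brownian_measurable])

text \<open>Extending the integrand by zero moves the approximation from \<open>{0..t}\<close> to
  the whole line, where \<open>step_integral_isometry\<close> is stated; the step functions already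
  vanish outside \<open>{0..t}\<close> because their partitions lie in it.\<close>

lemma wiener_integral_approx:
  assumes "is_wiener_integral M W t f I" and t: "t \<in> {0..T}"
  obtains n \<tau> c where "\<And>j. time_partition (n j) (\<tau> j) T"
    "(\<lambda>j. \<integral>\<^sup>+x. ennreal ((indicator {0..t} x * f x - step_fun (n j) (\<tau> j) (c j) x)\<^sup>2) \<partial>lborel) \<longlonglongrightarrow> 0"
    "(\<lambda>j. \<integral>\<^sup>+w. ennreal ((I w - step_integral W (n j) (\<tau> j) (c j) w)\<^sup>2) \<partial>M) \<longlonglongrightarrow> 0"
proof -
  obtain n \<tau> c where v: "\<forall>j. 0 \<le> \<tau> j 0 \<and> (\<forall>i<n j. \<tau> j i \<le> \<tau> j (Suc i)) \<and> \<tau> j (n j) \<le> t"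
    and l: "(\<lambda>j. \<integral>\<^sup>+s\<in>{0..t}. ennreal ((f s - step_fun (n j) (\<tau> j) (c j) s)\<^sup>2) \<partial>lborel) \<longlonglongrightarrow> 0"
      "(\<lambda>j. \<integral>\<^sup>+w. ennreal ((I w - step_integral W (n j) (\<tau> j) (c j) w)\<^sup>2) \<partial>M) \<longlonglongrightarrow> 0"
    using assms(1) unfolding is_wiener_integral_def by blast
  have p: "time_partition (n j) (\<tau> j) t" for j unfolding time_partition_def using v by blast
  have "(\<integral>\<^sup>+s\<in>{0..t}. ennreal ((f s - step_fun (n j) (\<tau> j) (c j) s)\<^sup>2) \<partial>lborel) =
    (\<integral>\<^sup>+x. ennreal ((indicator {0..t} x * f x - step_fun (n j) (\<tau> j) (c j) x)\<^sup>2) \<partial>lborel)" for j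
  proof (rule nn_integral_cong)
    fix s
    show "ennreal ((f s - step_fun (n j) (\<tau> j) (c j) s)\<^sup>2) * indicator {0..t} s =
      ennreal ((indicator {0..t} s * f s - step_fun (n j) (\<tau> j) (c j) s)\<^sup>2)"
      using step_fun_outside[OF p, of s j "c j"] by (cases "s \<in> {0..t}") auto
  qed
  note l(1)[unfolded this]
  moreover have "time_partition (n j) (\<tau> j) T" for j
    using p[of j] t by (auto simp: time_partition_def)
  ultimately show thesis using l(2) that by blast
qed

lemma wiener_integral_zero: "is_wiener_integral M W t (\<lambda>_. 0) (\<lambda>_. 0)" if "t \<ge> 0"
  unfolding is_wiener_integral_def
  using that by (intro conjI exI[of _ "\<lambda>_. 0"] exI[of _ "\<lambda>_ _. 0"]) (auto simp: step_fun_def step_integral_def)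

text \<open>One estimate for two purposes: uniqueness (equal integrands) and the second moment
  (\<open>f' = 0\<close>). The path from \<open>I\<close> to \<open>I'\<close> runs through their
  step integrals; the isometry trades the middle piece for a distance of step functions, which in
  turn runs through the two integrands. The factor 16 comes from four uses of
  \<open>(u + v)\<^sup>2 \<le> 2 * (u\<^sup>2 + v\<^sup>2)\<close>.\<close>

lemma wiener_integral_dist:
  assumes I: "is_wiener_integral M W t f I" and I': "is_wiener_integral M W t f' I'" and t: "t \<in> {0..T}"
    and [measurable]: "(\<lambda>s. indicator {0..t} s * f s) \<in> borel_measurable borel"
      "(\<lambda>s. indicator {0..t} s * f' s) \<in> borel_measurable borel"
  shows "(\<integral>\<^sup>+w. ennreal ((I w - I' w)\<^sup>2) \<partial>M) \<le>
    16 * (\<integral>\<^sup>+x. ennreal ((indicator {0..t} x * f x - indicator {0..t} x * f' x)\<^sup>2) \<partial>lborel)"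
proof -
  have [measurable]: "I \<in> borel_measurable M" "I' \<in> borel_measurable M"
    using I I' by (auto simp: is_wiener_integral_def)
  let ?f = "\<lambda>x. indicator {0..t} x * f x" and ?f' = "\<lambda>x. indicator {0..t} x * f' x"
  obtain n \<tau> c where s: "\<And>j. time_partition (n j) (\<tau> j) T"
    "(\<lambda>j. \<integral>\<^sup>+x. ennreal ((?f x - step_fun (n j) (\<tau> j) (c j) x)\<^sup>2) \<partial>lborel) \<longlonglongrightarrow> 0"
    "(\<lambda>j. \<integral>\<^sup>+w. ennreal ((I w - step_integral W (n j) (\<tau> j) (c j) w)\<^sup>2) \<partial>M) \<longlonglongrightarrow> 0"
    using wiener_integral_approx[OF I t] by blast
  obtain n' \<tau>' c' where s': "\<And>j. time_partition (n' j) (\<tau>' j) T"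
    "(\<lambda>j. \<integral>\<^sup>+x. ennreal ((?f' x - step_fun (n' j) (\<tau>' j) (c' j) x)\<^sup>2) \<partial>lborel) \<longlonglongrightarrow> 0"
    "(\<lambda>j. \<integral>\<^sup>+w. ennreal ((I' w - step_integral W (n' j) (\<tau>' j) (c' j) w)\<^sup>2) \<partial>M) \<longlonglongrightarrow> 0"
    using wiener_integral_approx[OF I' t] by blast
  define S S' where "S = (\<lambda>j. step_integral W (n j) (\<tau> j) (c j))" and "S' = (\<lambda>j. step_integral W (n' j) (\<tau>' j) (c' j))"
  define \<phi> \<phi>' where "\<phi> = (\<lambda>j. step_fun (n j) (\<tau> j) (c j))" and "\<phi>' = (\<lambda>j. step_fun (n' j) (\<tau>' j) (c' j))"
  note [measurable] = measurable_from_subalg[OF subalgebra_path step_integral_measurable[OF s(1)]]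
    measurable_from_subalg[OF subalgebra_path step_integral_measurable[OF s'(1)]]
  have [measurable]: "S j \<in> borel_measurable M" "S' j \<in> borel_measurable M"
    "\<phi> j \<in> borel_measurable borel" "\<phi>' j \<in> borel_measurable borel" for j
    unfolding S_def S'_def \<phi>_def \<phi>'_def by simp_all
  let ?a = "\<lambda>j. \<integral>\<^sup>+w. ennreal ((I w - S j w)\<^sup>2) \<partial>M" and ?a' = "\<lambda>j. \<integral>\<^sup>+w. ennreal ((I' w - S' j w)\<^sup>2) \<partial>M"
  let ?b = "\<lambda>j. \<integral>\<^sup>+x. ennreal ((?f x - \<phi> j x)\<^sup>2) \<partial>lborel" and ?b' = "\<lambda>j. \<integral>\<^sup>+x. ennreal ((?f' x - \<phi>' j x)\<^sup>2) \<partial>lborel"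
  let ?c = "\<integral>\<^sup>+x. ennreal ((?f x - ?f' x)\<^sup>2) \<partial>lborel"
  let ?X = "\<lambda>j. 2 * (?a j + 2 * (2 * (?b j + 2 * (?c + ?b' j)) + ?a' j))"
  have tri: "(\<integral>\<^sup>+x. ennreal ((u x - y x)\<^sup>2) \<partial>N) \<le>
      2 * ((\<integral>\<^sup>+x. ennreal ((u x - v x)\<^sup>2) \<partial>N) + (\<integral>\<^sup>+x. ennreal ((v x - y x)\<^sup>2) \<partial>N))"
    if "u \<in> borel_measurable N" "v \<in> borel_measurable N" "y \<in> borel_measurable N"
    for N :: "'x measure" and u v y :: "'x \<Rightarrow> real"
    using nn_integral_square_add[of "\<lambda>x. u x - v x" N "\<lambda>x. v x - y x"] that by simp
  have "(\<integral>\<^sup>+w. ennreal ((I w - I' w)\<^sup>2) \<partial>M) \<le> ?X j" for j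
  proof -
    let ?B = "\<integral>\<^sup>+w. ennreal ((S j w - I' w)\<^sup>2) \<partial>M" and ?C = "\<integral>\<^sup>+w. ennreal ((S j w - S' j w)\<^sup>2) \<partial>M"
    let ?D = "\<integral>\<^sup>+x. ennreal ((?f x - \<phi>' j x)\<^sup>2) \<partial>lborel"
    have A: "(\<integral>\<^sup>+w. ennreal ((I w - I' w)\<^sup>2) \<partial>M) \<le> 2 * (?a j + ?B)" by (rule tri) auto
    have B: "?B \<le> 2 * (?C + ?a' j)"
      using tri[of "S j" M "S' j" I'] by (simp add: power2_commute[of "S' j _"])
    have "?C = (\<integral>\<^sup>+x. ennreal ((\<phi> j x - \<phi>' j x)\<^sup>2) \<partial>lborel)"
      unfolding S_def S'_def \<phi>_def \<phi>'_def by (rule step_integral_isometry[OF s(1) s'(1)])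
    also have "\<dots> \<le> 2 * (?b j + ?D)"
      using tri[of "\<phi> j" lborel ?f "\<phi>' j"] by (simp add: power2_commute[of "\<phi> j _"])
    finally have C: "?C \<le> 2 * (?b j + ?D)" .
    have D: "?D \<le> 2 * (?c + ?b' j)" by (rule tri) auto
    have "?C \<le> 2 * (?b j + 2 * (?c + ?b' j))"
      by (rule order_trans[OF C mult_left_mono[OF add_left_mono[OF D]]]) simp
    from order_trans[OF B mult_left_mono[OF add_right_mono[OF this]]]
    have "?B \<le> 2 * (2 * (?b j + 2 * (?c + ?b' j)) + ?a' j)" by simp
    from order_trans[OF A mult_left_mono[OF add_left_mono[OF this]]] show ?thesis by simp
  qed
  moreover have "?X \<longlonglongrightarrow> 2 * (0 + 2 * (2 * (0 + 2 * (?c + 0)) + 0))"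
    unfolding S_def S'_def \<phi>_def \<phi>'_def by (intro tendsto_add ennreal_tendsto_cmult s s' tendsto_const) auto
  ultimately have "(\<integral>\<^sup>+w. ennreal ((I w - I' w)\<^sup>2) \<partial>M) \<le> 2 * (0 + 2 * (2 * (0 + 2 * (?c + 0)) + 0))"
    by (intro LIMSEQ_le_const[where X="?X"]) auto
  then show ?thesis by (simp add: mult.assoc[symmetric])
qed

lemma wiener_integral_unique:
  assumes I: "is_wiener_integral M W t f I" and I': "is_wiener_integral M W t f I'" and t: "t \<in> {0..T}"
    and f: "(\<lambda>s. indicator {0..t} s * f s) \<in> borel_measurable borel"
  shows "AE w in M. I w = I' w"
proof -
  have "(\<integral>\<^sup>+w. ennreal ((I w - I' w)\<^sup>2) \<partial>M) = 0"
    using wiener_integral_dist[OF I I' t f f] by simp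
  moreover have "I \<in> borel_measurable M" "I' \<in> borel_measurable M"
    using I I' by (auto simp: is_wiener_integral_def)
  ultimately have "AE w in M. ennreal ((I w - I' w)\<^sup>2) = 0"
    by (subst (asm) nn_integral_0_iff_AE) auto
  then show ?thesis by eventually_elim (simp add: ennreal_eq_0_iff)
qed

lemma wiener_integral_bound:
  assumes I: "is_wiener_integral M W t f I" and t: "t \<in> {0..T}"
    and f: "(\<lambda>s. indicator {0..t} s * f s) \<in> borel_measurable borel"
  shows "(\<integral>\<^sup>+w. ennreal ((I w)\<^sup>2) \<partial>M) \<le> 16 * (\<integral>\<^sup>+x. ennreal ((indicator {0..t} x * f x)\<^sup>2) \<partial>lborel)"
  using wiener_integral_dist[OF I wiener_integral_zero t f] t by simp

text \<open>Along a subsequence the step integrals converge almost surely. Each of them is a finite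
  combination of values of \<open>W\<close>, so their pointwise limit is the required
  version.\<close>

lemma wiener_integral_ae_measurable:
  assumes I: "is_wiener_integral M W t f I" and t: "t \<in> {0..T}"
  shows "ae_measurable M (path_algebra M T W) I"
proof -
  have [measurable]: "I \<in> borel_measurable M"
    using I by (auto simp: is_wiener_integral_def)
  obtain n \<tau> c where p: "\<And>j. time_partition (n j) (\<tau> j) T"
    and "(\<lambda>j. \<integral>\<^sup>+x. ennreal ((indicator {0..t} x * f x - step_fun (n j) (\<tau> j) (c j) x)\<^sup>2) \<partial>lborel) \<longlonglongrightarrow> 0"
    and lim': "(\<lambda>j. \<integral>\<^sup>+w. ennreal ((I w - step_integral W (n j) (\<tau> j) (c j) w)\<^sup>2) \<partial>M) \<longlonglongrightarrow> 0"
    using wiener_integral_approx[OF I t] by blast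
  define s where "s = (\<lambda>j. step_integral W (n j) (\<tau> j) (c j))"
  have s: "s j \<in> borel_measurable (path_algebra M T W)" for j
    unfolding s_def by (rule step_integral_measurable[OF p])
  have lim: "(\<lambda>j. \<integral>\<^sup>+w. ennreal ((I w - s j w)\<^sup>2) \<partial>M) \<longlonglongrightarrow> 0"
    unfolding s_def by (rule lim')
  note [measurable] = measurable_from_subalg[OF subalgebra_path s]
  let ?u = "\<lambda>j w. (I w - s j w)\<^sup>2"
  \<comment> \<open>Convergence to zero makes the second moments finite only from some index on,
    whereas extracting the subsequence asks for integrability of every term; hence the shift by
    \<open>N\<close>.\<close>
  have "eventually (\<lambda>j. (\<integral>\<^sup>+w. ennreal (?u j w) \<partial>M) < \<infinity>) sequentially"
    using order_tendstoD(2)[OF lim, of \<infinity>] by simp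
  then obtain N where N: "\<And>j. j \<ge> N \<Longrightarrow> (\<integral>\<^sup>+w. ennreal (?u j w) \<partial>M) < \<infinity>"
    by (auto simp: eventually_sequentially)
  have int: "integrable M (?u (j + N))" for j
    using N[of "j + N"] by (intro integrableI_bounded) auto
  have "(\<lambda>j. \<integral>w. norm (?u (j + N) w) \<partial>M) \<longlonglongrightarrow> 0"
  proof -
    have "(\<integral>w. norm (?u (j + N) w) \<partial>M) = enn2real (\<integral>\<^sup>+w. ennreal (?u (j + N) w) \<partial>M)" for j
      by (subst integral_eq_nn_integral) auto
    moreover have "(\<lambda>j. enn2real (\<integral>\<^sup>+w. ennreal (?u (j + N) w) \<partial>M)) \<longlonglongrightarrow> enn2real 0"
      by (rule tendsto_enn2real) (use LIMSEQ_ignore_initial_segment[OF lim, of N] in auto)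
    ultimately show ?thesis by simp
  qed
  from tendsto_L1_AE_subseq[OF int this] obtain r :: "nat \<Rightarrow> nat" where
    r: "AE w in M. (\<lambda>j. ?u (r j + N) w) \<longlonglongrightarrow> 0" by auto
  define Z where "Z = (\<lambda>w. lim (\<lambda>j. s (r j + N) w))"
  have "Z \<in> borel_measurable (path_algebra M T W)"
    unfolding Z_def using s by (intro borel_measurable_lim_metric) auto
  moreover have "AE w in M. I w = Z w"
    using r
  proof eventually_elim
    case (elim w)
    have "(\<lambda>j. sqrt (?u (r j + N) w)) \<longlonglongrightarrow> sqrt 0" by (intro tendsto_real_sqrt elim)
    then have "(\<lambda>j. \<bar>I w - s (r j + N) w\<bar>) \<longlonglongrightarrow> 0" by simp
    then have "(\<lambda>j. I w - s (r j + N) w) \<longlonglongrightarrow> 0" by (rule tendsto_rabs_zero_cancel)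
    then have "(\<lambda>j. I w - (I w - s (r j + N) w)) \<longlonglongrightarrow> I w - 0" by (intro tendsto_diff tendsto_const)
    then have "(\<lambda>j. s (r j + N) w) \<longlonglongrightarrow> I w" by simp
    then show ?case unfolding Z_def by (rule limI[symmetric])
  qed
  ultimately show ?thesis unfolding ae_measurable_def by blast
qed

end

end

section \<open>Quadratic functionals of a kernel transform\<close>

lemma abs_mult_bound: "\<bar>x * y\<bar> \<le> a * b" if "\<bar>x\<bar> \<le> a" "\<bar>y\<bar> \<le> b" for x y a b :: real
  unfolding abs_mult using that by (intro mult_mono) auto

lemma abs_add_bound: "\<bar>x + y\<bar> \<le> a + b" if "\<bar>x\<bar> \<le> a" "\<bar>y\<bar> \<le> b" for x y a b :: real
  using that by linarith

lemma time_kernel_sections: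
  assumes \<kappa>: "(\<lambda>(t, s). \<kappa> t s :: real) \<in> borel_measurable (leb T \<Otimes>\<^sub>M leb T)"
  shows "t \<in> {0..T} \<Longrightarrow> \<kappa> t \<in> borel_measurable (leb T)"
    and "s \<in> {0..T} \<Longrightarrow> (\<lambda>t. \<kappa> t s) \<in> borel_measurable (leb T)"
proof -
  show "\<kappa> t \<in> borel_measurable (leb T)" if "t \<in> {0..T}"
  proof -
    have "Pair t \<in> measurable (leb T) (leb T \<Otimes>\<^sub>M leb T)"
      using that by (intro measurable_Pair1') simp
    from measurable_compose[OF this \<kappa>] show ?thesis by simp
  qed
  show "(\<lambda>t. \<kappa> t s) \<in> borel_measurable (leb T)" if "s \<in> {0..T}"
    using process_section[OF \<kappa>] that by simp
qed

text \<open>Non-integrable \<open>f\<close> are covered as well, their integral being zero by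
  convention and \<open>c\<close> nonnegative as a bound of \<open>\<bar>f 0\<bar>\<close>. Kernel
  bounds can therefore be read off the shape of a term.\<close>

lemma time_integral_bound:
  assumes f: "\<And>t. t \<in> {0..T} \<Longrightarrow> \<bar>f t\<bar> \<le> c" and "T > 0"
  shows "\<bar>\<integral>t. f t \<partial>leb T\<bar> \<le> T * c"
proof -
  have c: "c \<ge> 0" using f[of 0] \<open>T > 0\<close> by force
  show ?thesis
  proof (cases "integrable (leb T) f")
    case True
    have "\<bar>\<integral>t. f t \<partial>leb T\<bar> \<le> (\<integral>t. \<bar>f t\<bar> \<partial>leb T)" by (rule integral_abs_bound)
    also have "\<dots> \<le> (\<integral>t. c \<partial>leb T)"
      using True f by (intro integral_mono) auto
    also have "\<dots> = T * c" using measure_leb[of T] \<open>T > 0\<close> by simp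
    finally show ?thesis .
  next
    case False
    then show ?thesis using c \<open>T > 0\<close> by (simp add: not_integrable_integral_eq)
  qed
qed

lemma time_bounded_integrable:
  fixes f :: "real \<Rightarrow> real"
  assumes "f \<in> borel_measurable (leb T)" "\<And>t. t \<in> {0..T} \<Longrightarrow> \<bar>f t\<bar> \<le> c"
  shows "integrable (leb T) f"
  using integrable_bounded_mult[of "leb T" "\<lambda>_. 1" f c] assms by simp

context
  fixes T :: real and \<kappa> :: "real \<Rightarrow> real \<Rightarrow> real" and b :: real and z :: "real \<Rightarrow> real"
  assumes T: "T > 0"
    and \<kappa>: "process_measurable T (leb T) \<kappa>"
    and b: "\<And>t s. t \<in> {0..T} \<Longrightarrow> s \<in> {0..T} \<Longrightarrow> \<bar>\<kappa> t s\<bar> \<le> b"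
    and z: "integrable (leb T) z"
begin

lemma kernel_section_integrable: "t \<in> {0..T} \<Longrightarrow> integrable (leb T) (\<lambda>s. \<kappa> t s * z s)"
  using time_kernel_sections(1)[OF \<kappa>] b by (intro integrable_bounded_mult[OF z]) auto

lemma kernel_transform_measurable:
  "(\<lambda>t. \<integral>s. \<kappa> t s * z s \<partial>leb T) \<in> borel_measurable (leb T)"
proof (rule time.borel_measurable_lebesgue_integral)
  have "z \<in> borel_measurable (leb T)" using z by auto
  from borel_measurable_times[OF \<kappa> measurable_compose[OF measurable_snd this]]
  show "process_measurable T (leb T) (\<lambda>t s. \<kappa> t s * z s)"
    by (simp add: case_prod_beta')
qed

lemma kernel_transform_bound:
  assumes "t \<in> {0..T}"
  shows "\<bar>\<integral>s. \<kappa> t s * z s \<partial>leb T\<bar> \<le> b * (\<integral>s. \<bar>z s\<bar> \<partial>leb T)"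
proof -
  have "\<bar>\<integral>s. \<kappa> t s * z s \<partial>leb T\<bar> \<le> (\<integral>s. \<bar>\<kappa> t s * z s\<bar> \<partial>leb T)"
    by (rule integral_abs_bound)
  also have "\<dots> \<le> (\<integral>s. b * \<bar>z s\<bar> \<partial>leb T)"
    using integrable_abs[OF kernel_section_integrable[OF assms]] z b[OF assms]
    by (intro integral_mono) (auto simp: abs_mult intro!: mult_right_mono)
  finally show ?thesis by simp
qed

text \<open>Transposition of the kernel by Fubini: a functional linear in the kernel transform
  becomes an integral against \<open>z\<close> itself.\<close>

lemma kernel_swap:
  assumes a: "a \<in> borel_measurable (leb T)" and ab: "\<And>t. t \<in> {0..T} \<Longrightarrow> \<bar>a t\<bar> \<le> c"
  shows "(\<integral>t. a t * (\<integral>s. \<kappa> t s * z s \<partial>leb T) \<partial>leb T) =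
    (\<integral>s. (\<integral>t. a t * \<kappa> t s \<partial>leb T) * z s \<partial>leb T)"
    and "integrable (leb T) (\<lambda>s. (\<integral>t. a t * \<kappa> t s \<partial>leb T) * z s)"
proof -
  let ?L = "leb T"
  have am: "process_measurable T ?L (\<lambda>t s. a t * \<kappa> t s)"
    using borel_measurable_times[OF measurable_compose[OF measurable_fst a] \<kappa>] by (simp add: case_prod_beta')
  have "integrable (?L \<Otimes>\<^sub>M ?L) (\<lambda>x. (case x of (t, s) \<Rightarrow> a t * \<kappa> t s) * (1 * z (snd x)))"
  proof (rule integrable_bounded_mult[OF _ am])
    show "integrable (?L \<Otimes>\<^sub>M ?L) (\<lambda>x. 1 * z (snd x))"
      by (rule time2.integrable_mult_fst_snd[OF _ z]) simp
    show "\<bar>case x of (t, s) \<Rightarrow> a t * \<kappa> t s\<bar> \<le> c * b" if xs: "x \<in> space (?L \<Otimes>\<^sub>M ?L)" for x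
    proof -
      obtain t s where x: "x = (t, s)" "t \<in> {0..T}" "s \<in> {0..T}"
        using xs by (cases x) (auto simp: space_pair_measure)
      have "\<bar>a t\<bar> * \<bar>\<kappa> t s\<bar> \<le> c * b"
        using ab[OF x(2)] b[OF x(2,3)] by (intro mult_mono) auto
      then show ?thesis by (simp add: x abs_mult)
    qed
  qed
  then have int: "integrable (?L \<Otimes>\<^sub>M ?L) (\<lambda>(t, s). a t * \<kappa> t s * z s)"
    by (simp add: case_prod_beta')
  have "(\<integral>t. a t * (\<integral>s. \<kappa> t s * z s \<partial>?L) \<partial>?L) = (\<integral>t. (\<integral>s. a t * \<kappa> t s * z s \<partial>?L) \<partial>?L)"
    by (simp add: mult.assoc)
  also have "\<dots> = (\<integral>s. (\<integral>t. a t * \<kappa> t s * z s \<partial>?L) \<partial>?L)"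
    by (rule time2.Fubini_integral[OF int, symmetric])
  also have "\<dots> = (\<integral>s. (\<integral>t. a t * \<kappa> t s \<partial>?L) * z s \<partial>?L)"
    by simp
  finally show "(\<integral>t. a t * (\<integral>s. \<kappa> t s * z s \<partial>?L) \<partial>?L) = (\<integral>s. (\<integral>t. a t * \<kappa> t s \<partial>?L) * z s \<partial>?L)" .
  from time2.integrable_snd[OF int]
  show "integrable ?L (\<lambda>s. (\<integral>t. a t * \<kappa> t s \<partial>?L) * z s)" by simp
qed

text \<open>A deterministic identity, later applied to each path of the noise. Terms linear in
  \<open>D\<close> are transposed onto \<open>z\<close> and collect in \<open>h1\<close>;
  \<open>d * D * z\<close> is a double integral as it stands; the square of \<open>D\<close> takes
  two transpositions, one per factor; the terminal terms evaluate the kernel at \<open>T\<close>.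
  Here \<open>l2\<close> is the variance that centres \<open>z\<^sup>2\<close>, not the cost
  coefficient of the same name further below.\<close>

lemma quadratic_kernel_expansion:
  fixes a1 a2 c d R l2 :: "real \<Rightarrow> real" and a3 a4 :: real
  assumes z2: "integrable (leb T) (\<lambda>s. (z s)\<^sup>2)"
    and m: "a1 \<in> borel_measurable (leb T)" "a2 \<in> borel_measurable (leb T)"
      "c \<in> borel_measurable (leb T)" "d \<in> borel_measurable (leb T)"
      "R \<in> borel_measurable (leb T)" "l2 \<in> borel_measurable (leb T)"
    and bd: "\<And>t. t \<in> {0..T} \<Longrightarrow> \<bar>a1 t\<bar> \<le> C" "\<And>t. t \<in> {0..T} \<Longrightarrow> \<bar>a2 t\<bar> \<le> C"
      "\<And>t. t \<in> {0..T} \<Longrightarrow> \<bar>c t\<bar> \<le> C" "\<And>t. t \<in> {0..T} \<Longrightarrow> \<bar>d t\<bar> \<le> C"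
      "\<And>t. t \<in> {0..T} \<Longrightarrow> \<bar>R t\<bar> \<le> C" "\<And>t. t \<in> {0..T} \<Longrightarrow> \<bar>l2 t\<bar> \<le> C"
  defines "D \<equiv> \<lambda>t. \<integral>s. \<kappa> t s * z s \<partial>leb T"
    and "h1 \<equiv> \<lambda>s. a2 s + (\<integral>t. a1 t * \<kappa> t s \<partial>leb T) + a3 * \<kappa> T s"
    and "h3 \<equiv> \<lambda>t r. (\<integral>s. c s * \<kappa> s t * \<kappa> s r \<partial>leb T) + d t * \<kappa> t r + a4 * \<kappa> T t * \<kappa> T r"
  shows "(\<integral>t. a1 t * D t + a2 t * z t + c t * (D t)\<^sup>2 + d t * D t * z t + R t * (z t)\<^sup>2 - R t * l2 t \<partial>leb T)
      + a3 * D T + a4 * (D T)\<^sup>2 =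
    (\<integral>t. h1 t * z t \<partial>leb T) + (\<integral>t. R t * ((z t)\<^sup>2 - l2 t) \<partial>leb T)
      + (\<integral>t. (\<integral>r. h3 t r * z r * z t \<partial>leb T) \<partial>leb T)"
proof -
  let ?L = "leb T"
  have T0: "T \<in> {0..T}" using T by simp
  have Dm: "D \<in> borel_measurable ?L" unfolding D_def by (rule kernel_transform_measurable)
  obtain Db where Db: "\<And>t. t \<in> {0..T} \<Longrightarrow> \<bar>D t\<bar> \<le> Db"
    using kernel_transform_bound unfolding D_def by blast
  have i1: "integrable ?L (\<lambda>t. a1 t * D t)"
    by (rule time_bounded_integrable[where c="C * Db"])
      (use m Dm bd Db in \<open>auto intro!: abs_mult_bound\<close>)
  have i2: "integrable ?L (\<lambda>t. a2 t * z t)"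
    by (rule integrable_bounded_mult[OF z m(2)]) (use bd in auto)
  have i3: "integrable ?L (\<lambda>t. c t * (D t)\<^sup>2)"
    by (rule time_bounded_integrable[where c="C * (Db * Db)"])
      (use m Dm bd Db in \<open>auto simp: power2_eq_square intro!: abs_mult_bound\<close>)
  have cD: "(\<lambda>t. c t * D t) \<in> borel_measurable ?L" "(\<lambda>t. d t * D t) \<in> borel_measurable ?L" using m Dm by auto
  have cDb: "\<bar>c t * D t\<bar> \<le> C * Db" "\<bar>d t * D t\<bar> \<le> C * Db" if "t \<in> {0..T}" for t
    using that bd Db by (auto intro!: abs_mult_bound)
  have i4: "integrable ?L (\<lambda>t. d t * D t * z t)"
    by (rule integrable_bounded_mult[OF z cD(2)]) (use cDb in auto)
  have i5: "integrable ?L (\<lambda>t. R t * (z t)\<^sup>2)"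
    by (rule integrable_bounded_mult[OF z2 m(5), where c=C]) (use bd in auto)
  have i6: "integrable ?L (\<lambda>t. R t * l2 t)"
    by (rule time_bounded_integrable[where c="C * C"])
      (use m bd in \<open>auto intro!: abs_mult_bound\<close>)
  have lhs: "(\<integral>t. a1 t * D t + a2 t * z t + c t * (D t)\<^sup>2 + d t * D t * z t + R t * (z t)\<^sup>2 - R t * l2 t \<partial>?L) =
     (\<integral>t. a1 t * D t \<partial>?L) + (\<integral>t. a2 t * z t \<partial>?L) + (\<integral>t. c t * (D t)\<^sup>2 \<partial>?L) + (\<integral>t. d t * D t * z t \<partial>?L)
     + ((\<integral>t. R t * (z t)\<^sup>2 \<partial>?L) - (\<integral>t. R t * l2 t \<partial>?L))"
    using i1 i2 i3 i4 i5 i6 by simp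
  have R: "(\<integral>t. R t * ((z t)\<^sup>2 - l2 t) \<partial>?L) = (\<integral>t. R t * (z t)\<^sup>2 \<partial>?L) - (\<integral>t. R t * l2 t \<partial>?L)"
    using i5 i6 by (simp add: right_diff_distrib)
  have kT: "integrable ?L (\<lambda>s. \<kappa> T s * z s)" by (rule kernel_section_integrable[OF T0])
  have h1: "(\<integral>t. h1 t * z t \<partial>?L) = (\<integral>t. a2 t * z t \<partial>?L) + (\<integral>t. a1 t * D t \<partial>?L) + a3 * D T"
  proof -
    have "(\<integral>t. h1 t * z t \<partial>?L) =
      (\<integral>s. a2 s * z s + (\<integral>t. a1 t * \<kappa> t s \<partial>?L) * z s + a3 * (\<kappa> T s * z s) \<partial>?L)"
      unfolding h1_def by (simp add: algebra_simps)
    also have "\<dots> = (\<integral>t. a2 t * z t \<partial>?L) + (\<integral>s. (\<integral>t. a1 t * \<kappa> t s \<partial>?L) * z s \<partial>?L) + a3 * D T"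
      using i2 kernel_swap(2)[OF m(1) bd(1)] kT by (simp add: D_def)
    finally show ?thesis using kernel_swap(1)[OF m(1) bd(1)] by (simp add: D_def)
  qed
  have csec: "(\<lambda>s. c s * \<kappa> s t) \<in> borel_measurable ?L" "\<And>s. s \<in> {0..T} \<Longrightarrow> \<bar>c s * \<kappa> s t\<bar> \<le> C * b"
    if "t \<in> {0..T}" for t
    using that m(3) time_kernel_sections(2)[OF \<kappa>] bd(3) b by (auto intro!: abs_mult_bound)
  have in3: "(\<integral>r. h3 t r * z r * z t \<partial>?L) =
      (\<integral>s. c s * D s * \<kappa> s t \<partial>?L) * z t + d t * D t * z t + a4 * D T * (\<kappa> T t * z t)"
    if t: "t \<in> {0..T}" for t
  proof -
    have "(\<integral>r. h3 t r * z r * z t \<partial>?L) = (\<integral>r. (\<integral>s. c s * \<kappa> s t * \<kappa> s r \<partial>?L) * z r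
       + d t * (\<kappa> t r * z r) + a4 * \<kappa> T t * (\<kappa> T r * z r) \<partial>?L) * z t"
      unfolding h3_def by (subst integral_mult_left_zero[symmetric]) (simp add: algebra_simps)
    also have "(\<integral>r. (\<integral>s. c s * \<kappa> s t * \<kappa> s r \<partial>?L) * z r
       + d t * (\<kappa> t r * z r) + a4 * \<kappa> T t * (\<kappa> T r * z r) \<partial>?L) =
       (\<integral>r. (\<integral>s. c s * \<kappa> s t * \<kappa> s r \<partial>?L) * z r \<partial>?L) + d t * D t + a4 * \<kappa> T t * D T"
      using kernel_swap(2)[OF csec[OF t]] kernel_section_integrable[OF t] kT by (simp add: D_def)
    \<comment> \<open>First transposition, with \<open>t\<close> frozen and weight
      \<open>c s * \<kappa> s t\<close>: the factor in \<open>r\<close> becomes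
      \<open>D s\<close>.\<close>
    also have "(\<integral>r. (\<integral>s. c s * \<kappa> s t * \<kappa> s r \<partial>?L) * z r \<partial>?L) = (\<integral>s. c s * \<kappa> s t * D s \<partial>?L)"
      unfolding D_def by (rule kernel_swap(1)[OF csec[OF t], symmetric])
    finally show ?thesis by (simp add: algebra_simps)
  qed
  have "(\<integral>t. (\<integral>r. h3 t r * z r * z t \<partial>?L) \<partial>?L) =
      (\<integral>t. (\<integral>s. c s * D s * \<kappa> s t \<partial>?L) * z t + d t * D t * z t + a4 * D T * (\<kappa> T t * z t) \<partial>?L)"
    by (rule bochner_integral_cong) (use in3 in auto)
  also have "\<dots> = (\<integral>t. (\<integral>s. c s * D s * \<kappa> s t \<partial>?L) * z t \<partial>?L) + (\<integral>t. d t * D t * z t \<partial>?L) + a4 * D T * D T"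
    using kernel_swap(2)[OF cD(1) cDb(1)] i4 kT by (simp add: D_def)
  \<comment> \<open>Second transposition, with weight \<open>c s * D s\<close>, which is bounded on
    the given path.\<close>
  also have "(\<integral>t. (\<integral>s. c s * D s * \<kappa> s t \<partial>?L) * z t \<partial>?L) = (\<integral>t. c t * D t * D t \<partial>?L)"
    using kernel_swap(1)[OF cD(1) cDb(1)] by (simp add: D_def)
  finally have h3: "(\<integral>t. (\<integral>r. h3 t r * z r * z t \<partial>?L) \<partial>?L) =
      (\<integral>t. c t * (D t)\<^sup>2 \<partial>?L) + (\<integral>t. d t * D t * z t \<partial>?L) + a4 * (D T)\<^sup>2"
    by (simp add: power2_eq_square mult.assoc)
  show ?thesis unfolding lhs R h1 h3 by simp
qed

end

text \<open>At a fixed time a quadratic cost, split into state and noise, has exactly this shape,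
  the mixed terms being linear in the state. Additivity and taking out measurable factors leave only
  \<open>real_cond_exp_indep\<close>.\<close>

lemma (in prob_space_subalgebra) real_cond_exp_affine_indep:
  assumes indep: "indep_set (sets F) (sets G)" and G: "subalgebra M G"
    and Z: "ae_measurable M G Z" "integrable M Z" and X: "ae_measurable M G X" "integrable M X"
    and \<zeta>: "ae_measurable M F \<zeta>" "\<zeta> \<in> borel_measurable M" and X\<zeta>: "integrable M (\<lambda>w. \<zeta> w * X w)"
    and n: "ae_measurable M F n" "integrable M n"
  shows "AE w in M. real_cond_exp M F (\<lambda>w. Z w + \<zeta> w * X w + n w) w =
    expectation Z + \<zeta> w * expectation X + n w"
proof -
  have "AE w in M. real_cond_exp M F (\<lambda>w. Z w + \<zeta> w * X w + n w) w =
      real_cond_exp M F (\<lambda>w. Z w + \<zeta> w * X w) w + real_cond_exp M F n w"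
    using Z X\<zeta> n by (intro real_cond_exp_add) auto
  moreover have "AE w in M. real_cond_exp M F (\<lambda>w. Z w + \<zeta> w * X w) w =
      real_cond_exp M F Z w + real_cond_exp M F (\<lambda>w. \<zeta> w * X w) w"
    using Z X\<zeta> by (intro real_cond_exp_add) auto
  moreover have "AE w in M. real_cond_exp M F (\<lambda>w. \<zeta> w * X w) w = \<zeta> w * real_cond_exp M F X w"
    using X by (intro real_cond_exp_ae_measurable_mult \<zeta> X\<zeta>) auto
  ultimately show ?thesis
    using real_cond_exp_indep[OF indep G Z] real_cond_exp_indep[OF indep G X] real_cond_exp_ae_measurable[OF n]
    by eventually_elim simp
qed

section \<open>The conditional cost gap\<close>

text \<open>Deterministic data with bounds valid at every time. No probability space is fixed here,
  so the constants defined below depend on \<open>T\<close>, \<open>x0\<close>, \<open>A\<close>,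
  \<open>B\<close>, \<Gamma>, \<open>kb\<close> and \<open>Kb\<close> alone; the uniformity in the
  theorem rests on this. The single \<Gamma> covers all cost and diffusion coefficients.\<close>

locale lq_policy =
  fixes T x0 A B M m \<Gamma> kb Kb :: real and \<sigma> Q S R p q k K :: "real \<Rightarrow> real"
  assumes T: "T > 0"
    and coeff_meas [measurable]:
      "\<sigma> \<in> borel_measurable (leb T)" "Q \<in> borel_measurable (leb T)"
      "S \<in> borel_measurable (leb T)" "R \<in> borel_measurable (leb T)"
      "p \<in> borel_measurable (leb T)" "q \<in> borel_measurable (leb T)"
      "k \<in> borel_measurable (leb T)" "K \<in> borel_measurable (leb T)"
    and coeff_bound:
      "\<And>t. t \<in> {0..T} \<Longrightarrow> \<bar>\<sigma> t\<bar> \<le> \<Gamma>" "\<And>t. t \<in> {0..T} \<Longrightarrow> \<bar>Q t\<bar> \<le> \<Gamma>"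
      "\<And>t. t \<in> {0..T} \<Longrightarrow> \<bar>S t\<bar> \<le> \<Gamma>" "\<And>t. t \<in> {0..T} \<Longrightarrow> \<bar>R t\<bar> \<le> \<Gamma>"
      "\<And>t. t \<in> {0..T} \<Longrightarrow> \<bar>p t\<bar> \<le> \<Gamma>" "\<And>t. t \<in> {0..T} \<Longrightarrow> \<bar>q t\<bar> \<le> \<Gamma>"
      "\<bar>M\<bar> \<le> \<Gamma>" "\<bar>m\<bar> \<le> \<Gamma>"
    and policy_bound:
      "\<And>t. t \<in> {0..T} \<Longrightarrow> \<bar>k t\<bar> \<le> kb" "\<And>t. t \<in> {0..T} \<Longrightarrow> \<bar>K t\<bar> \<le> Kb"
begin

text \<open>The closed-loop drift coefficient under the feedback \<open>k + K x\<close>. Its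
  resolvent times \<open>B\<close> is \<open>\<kappa> t s\<close>, the response of the state at time
  \<open>t\<close> to action noise at time \<open>s\<close>.\<close>

definition "\<alpha> t = A + B * K t"
definition "\<kappa> t s = (if s \<le> t then B * exp (cumint T \<alpha> t - cumint T \<alpha> s) else 0)"

text \<open>The coefficients of the running cost along the feedback \<open>a = k + K x + z\<close>, which is the polynomial
  \<open>c x\<^sup>2 + l1 x + l0 + d x z + R z\<^sup>2 + l2 z\<close>.\<close>

definition "c t = Q t + 2 * (S t * K t) + R t * (K t * K t)"
definition "d t = 2 * S t + 2 * (R t * K t)"
definition "l1 t = 2 * (S t * k t) + 2 * (R t * (k t * K t)) + 2 * p t + 2 * (q t * K t)"
definition "l2 t = 2 * (R t * k t) + 2 * q t"
definition "l0 t = R t * (k t * k t) + 2 * (q t * k t)"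

text \<open>The argument \<mu> stands for the mean of the relaxed state. The summands are the direct
  effect of the noise on the running cost, its effect through the state perturbation, and the
  derivative of the terminal cost at the mean, transported back by \<kappa>.\<close>

definition "h1 \<mu> s = (d s * \<mu> s + l2 s) + (\<integral>t. (2 * (c t * \<mu> t) + l1 t) * \<kappa> t s \<partial>leb T)
  + (2 * (M * \<mu> T) + 2 * m) * \<kappa> T s"
definition "h3 t r = (\<integral>s. c s * \<kappa> s t * \<kappa> s r \<partial>leb T) + d t * \<kappa> t r + M * \<kappa> T t * \<kappa> T r"

definition "feedback_cost z Y w = (\<integral>t. running_cost Q S R p q t (Y t w) (k t + K t * Y t w + z t w)
  \<partial>leb T) + terminal_cost M m (Y T w)"
text \<open>The Gaussian action is already integrated out: its variance \<open>l\<close> is seen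
  only by the coefficient \<open>R\<close> of the squared action.\<close>

definition "averaged_cost l X w = (\<integral>t. running_cost Q S R p q t (X t w) (k t + K t * X t w) + R t * l t
  \<partial>leb T) + terminal_cost M m (X T w)"
definition "expansion \<mu> l z = (\<integral>t. h1 \<mu> t * z t \<partial>leb T) + (\<integral>t. R t * ((z t)\<^sup>2 - l t) \<partial>leb T)
  + (\<integral>t. (\<integral>r. h3 t r * z r * z t \<partial>leb T) \<partial>leb T)"

section \<open>Explicit bounds in terms of the model coefficients and the norms of the
  policy\<close>

definition "\<alpha>b = \<bar>A\<bar> + \<bar>B\<bar> * Kb"
definition "\<kappa>b = \<bar>B\<bar> * exp (T * \<alpha>b + T * \<alpha>b)"
definition "cb = \<Gamma> + 2 * (\<Gamma> * Kb) + \<Gamma> * (Kb * Kb)"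
definition "db = 2 * \<Gamma> + 2 * (\<Gamma> * Kb)"
definition "l1b = 2 * (\<Gamma> * kb) + 2 * (\<Gamma> * (kb * Kb)) + 2 * \<Gamma> + 2 * (\<Gamma> * Kb)"
definition "l2b = 2 * (\<Gamma> * kb) + 2 * \<Gamma>"
definition "l0b = \<Gamma> * (kb * kb) + 2 * (\<Gamma> * kb)"
text \<open>A bound on the mean of the Wiener integral in the state, from
  \<open>\<bar>x\<bar> \<le> 1 + x\<^sup>2\<close>, the factor 16 of
  \<open>wiener_integral_dist\<close> and the bound \<open>T * (\<Gamma> * \<Gamma>)\<close> on the
  integral of the square of \<sigma>. In \<open>\<mu>b\<close> the summands belong to this integral,
  to the deterministic part of the state and to the kernel transform of the integral.\<close>

definition "Jb = 1 + 16 * (T * (\<Gamma> * \<Gamma>))"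
definition "\<mu>b = Jb + exp (T * \<alpha>b) * (\<bar>x0\<bar> + T * (exp (T * \<alpha>b) * (\<bar>B\<bar> * kb)))
  + T * (exp (T * \<alpha>b + T * \<alpha>b) * \<alpha>b * Jb)"
definition "h1b = (db * \<mu>b + l2b) + T * ((2 * (cb * \<mu>b) + l1b) * \<kappa>b) + (2 * (\<Gamma> * \<mu>b) + 2 * \<Gamma>) * \<kappa>b"
definition "h3b = T * (cb * \<kappa>b * \<kappa>b) + db * \<kappa>b + \<Gamma> * \<kappa>b * \<kappa>b"
definition "hb = h1b + \<Gamma> + h3b"

lemma T_mem: "T \<in> {0..T}" and zero_mem: "0 \<in> {0..T}"
  using T by auto

lemma two_bound: "\<bar>2 * x\<bar> \<le> 2 * y" if "\<bar>x\<bar> \<le> y" for x y :: real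
  using that by simp

lemmas bound_intros = abs_add_bound abs_mult_bound two_bound

lemma poly_meas [measurable]:
  "\<alpha> \<in> borel_measurable (leb T)" "c \<in> borel_measurable (leb T)"
  "d \<in> borel_measurable (leb T)" "l1 \<in> borel_measurable (leb T)"
  "l2 \<in> borel_measurable (leb T)" "l0 \<in> borel_measurable (leb T)"
  unfolding \<alpha>_def[abs_def] c_def[abs_def] d_def[abs_def] l1_def[abs_def] l2_def[abs_def] l0_def[abs_def]
  by measurable

text \<open>Every bound repeats the term it bounds with each coefficient replaced by its own bound,
  so \<open>bound_intros\<close> merely follows the syntax; the same holds for
  \<open>h1_bound\<close> and \<open>h3_bound\<close>.\<close>

lemma poly_bound:
  assumes "t \<in> {0..T}"
  shows "\<bar>\<alpha> t\<bar> \<le> \<alpha>b" "\<bar>c t\<bar> \<le> cb" "\<bar>d t\<bar> \<le> db" "\<bar>l1 t\<bar> \<le> l1b" "\<bar>l2 t\<bar> \<le> l2b" "\<bar>l0 t\<bar> \<le> l0b"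
  unfolding \<alpha>_def c_def d_def l1_def l2_def l0_def \<alpha>b_def cb_def db_def l1b_def l2b_def l0b_def
  by (intro bound_intros coeff_bound policy_bound assms order_refl)+

lemma running_cost_feedback:
  "running_cost Q S R p q t x (k t + K t * x + z) =
    c t * x * x + l1 t * x + l0 t + d t * x * z + R t * z * z + l2 t * z"
  unfolding running_cost_def c_def l1_def l0_def d_def l2_def
  by (simp add: power2_eq_square algebra_simps)

lemma \<alpha>_integrable: "integrable (leb T) \<alpha>"
  by (rule time_bounded_integrable[OF poly_meas(1) poly_bound(1)])

lemma cumint_\<alpha>_bound: "\<bar>cumint T \<alpha> t\<bar> \<le> T * \<alpha>b"
proof -
  have "\<alpha>b \<ge> 0" using poly_bound(1)[OF zero_mem] by simp
  then show ?thesis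
    unfolding cumint_def using poly_bound(1) by (intro time_integral_bound T) auto
qed

lemma exp_\<alpha>_bound: "\<bar>exp (cumint T \<alpha> t)\<bar> \<le> exp (T * \<alpha>b)" "\<bar>exp (- cumint T \<alpha> t)\<bar> \<le> exp (T * \<alpha>b)"
    "\<bar>exp (cumint T \<alpha> t - cumint T \<alpha> s)\<bar> \<le> exp (T * \<alpha>b + T * \<alpha>b)"
  using cumint_\<alpha>_bound[of t] cumint_\<alpha>_bound[of s] by auto

text \<open>Serves two resolvent kernels: \<kappa>, with \<open>g\<close> constantly
  \<open>B\<close>, and the kernel acting on the Wiener integral in
  \<open>state_representation\<close>, with \<open>g\<close> equal to \<alpha>.\<close>

lemma cut_measurable:
  fixes f g :: "real \<Rightarrow> real"
  assumes f: "f \<in> borel_measurable (leb T)" and g: "g \<in> borel_measurable (leb T)"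
  shows "process_measurable T (leb T) (\<lambda>t s. if s \<le> t then exp (f t - f s) * g s else 0)"
proof -
  have "Measurable.pred (leb T \<Otimes>\<^sub>M leb T) (\<lambda>x. snd x \<le> fst x)"
    using measurable_compose[OF measurable_pair_swap' time_le_measurable[of T]] by (simp add: case_prod_beta')
  moreover have "(\<lambda>x. exp (f (fst x) - f (snd x)) * g (snd x)) \<in> borel_measurable (leb T \<Otimes>\<^sub>M leb T)"
  proof -
    have [measurable]: "(\<lambda>x. f (fst x)) \<in> borel_measurable (leb T \<Otimes>\<^sub>M leb T)"
      "(\<lambda>x. f (snd x)) \<in> borel_measurable (leb T \<Otimes>\<^sub>M leb T)"
      "(\<lambda>x. g (snd x)) \<in> borel_measurable (leb T \<Otimes>\<^sub>M leb T)"
      by (rule measurable_compose[OF measurable_fst f] measurable_compose[OF measurable_snd f]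
        measurable_compose[OF measurable_snd g])+
    show ?thesis by simp
  qed
  ultimately show ?thesis unfolding case_prod_beta' by (intro measurable_If) auto
qed

lemma \<kappa>_measurable: "process_measurable T (leb T) \<kappa>"
  using cut_measurable[of "cumint T \<alpha>" "\<lambda>_. B"] unfolding \<kappa>_def by (simp add: mult.commute)

lemma \<kappa>_bound: "\<bar>\<kappa> t s\<bar> \<le> \<kappa>b"
  unfolding \<kappa>_def \<kappa>b_def using abs_mult_bound[OF order_refl exp_\<alpha>_bound(3)] by (auto simp del: abs_exp_cancel)

lemma h1_measurable:
  assumes [measurable]: "\<mu> \<in> borel_measurable (leb T)"
  shows "h1 \<mu> \<in> borel_measurable (leb T)"
proof -
  have "process_measurable T (leb T) (\<lambda>t s. (2 * (c t * \<mu> t) + l1 t) * \<kappa> t s)"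
    using borel_measurable_times[OF _ \<kappa>_measurable, of "\<lambda>x. 2 * (c (fst x) * \<mu> (fst x)) + l1 (fst x)"]
    by (simp add: case_prod_beta')
  from measurable_compose[OF measurable_pair_swap' this]
  have "process_measurable T (leb T) (\<lambda>s t. (2 * (c t * \<mu> t) + l1 t) * \<kappa> t s)"
    by (simp add: case_prod_beta')
  then have [measurable]: "(\<lambda>s. \<integral>t. (2 * (c t * \<mu> t) + l1 t) * \<kappa> t s \<partial>leb T) \<in> borel_measurable (leb T)"
    by (rule time.borel_measurable_lebesgue_integral)
  have [measurable]: "\<kappa> T \<in> borel_measurable (leb T)"
    by (rule time_kernel_sections(1)[OF \<kappa>_measurable T_mem])
  show ?thesis unfolding h1_def[abs_def] by measurable
qed

lemma h1_bound:
  assumes "\<And>t. t \<in> {0..T} \<Longrightarrow> \<bar>\<mu> t\<bar> \<le> \<mu>b" "s \<in> {0..T}"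
  shows "\<bar>h1 \<mu> s\<bar> \<le> h1b"
  unfolding h1_def h1b_def
  by (intro bound_intros poly_bound time_integral_bound \<kappa>_bound coeff_bound T assms T_mem)

lemma h3_measurable: "process_measurable T (leb T) h3"
proof -
  let ?L = "leb T"
  have \<kappa>m: "(\<lambda>x. \<kappa> (f x) (g x)) \<in> borel_measurable N" if "f \<in> measurable N ?L" "g \<in> measurable N ?L" for f g N
    using measurable_compose[OF measurable_Pair[OF that] \<kappa>_measurable] by simp
  have "(\<lambda>(x, s). c s * \<kappa> s (fst x) * \<kappa> s (snd x)) \<in> borel_measurable ((?L \<Otimes>\<^sub>M ?L) \<Otimes>\<^sub>M ?L)"
    unfolding case_prod_beta'
    by (intro borel_measurable_times \<kappa>m measurable_snd measurable_compose[OF measurable_snd poly_meas(2)]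
        measurable_compose[OF measurable_fst measurable_fst] measurable_compose[OF measurable_fst measurable_snd])
  then have 1: "(\<lambda>x. \<integral>s. c s * \<kappa> s (fst x) * \<kappa> s (snd x) \<partial>?L) \<in> borel_measurable (?L \<Otimes>\<^sub>M ?L)"
    by (rule time.borel_measurable_lebesgue_integral)
  have \<kappa>T: "\<kappa> T \<in> borel_measurable ?L"
    by (rule time_kernel_sections(1)[OF \<kappa>_measurable T_mem])
  show ?thesis unfolding h3_def case_prod_beta'
    by (intro borel_measurable_add borel_measurable_times 1 \<kappa>m measurable_fst measurable_snd borel_measurable_const
        measurable_compose[OF measurable_fst poly_meas(3)] measurable_compose[OF measurable_fst \<kappa>T]
        measurable_compose[OF measurable_snd \<kappa>T])
qed

lemma h3_bound:
  assumes "t \<in> {0..T}" "r \<in> {0..T}"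
  shows "\<bar>h3 t r\<bar> \<le> h3b"
  unfolding h3_def h3b_def
  by (intro bound_intros poly_bound time_integral_bound \<kappa>_bound coeff_bound T assms T_mem)

lemma hb_bounds:
  shows "h1b \<le> hb" "\<Gamma> \<le> hb" "h3b \<le> hb"
proof -
  have "\<Gamma> \<ge> 0" "h3b \<ge> 0" using coeff_bound(7) h3_bound[OF zero_mem zero_mem] by auto
  moreover have "h1b \<ge> 0"
  proof -
    have "\<mu>b \<ge> 0"
    proof -
      have "\<alpha>b \<ge> 0" "kb \<ge> 0" using poly_bound(1)[OF zero_mem] policy_bound(1)[OF zero_mem] by auto
      then show ?thesis unfolding \<mu>b_def Jb_def using T by auto
    qed
    \<comment> \<open>The sign of \<open>h1b\<close> is read off its own bound at the zero function,
      which is admissible because \<open>\<mu>b\<close> is nonnegative.\<close>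
    then show ?thesis using h1_bound[of "\<lambda>_. 0" 0] zero_mem by auto
  qed
  ultimately show "h1b \<le> hb" "\<Gamma> \<le> hb" "h3b \<le> hb" by (auto simp: hb_def)
qed

text \<open>The core computation, for a state that is a functional of the paths plus a perturbation
  driven by the noise. The running cost is conditioned at each fixed time and carried through the
  time integral by \<open>real_cond_exp_Fubini\<close>, the terminal cost is conditioned separately,
  and on each path the difference to the relaxed cost is an instance of
  \<open>quadratic_kernel_expansion\<close>.\<close>

lemma conditional_cost_gap:
  assumes F0: "prob_space_subalgebra P F0" and G: "subalgebra P G"
    and indep: "prob_space.indep_set P (sets F0) (sets G)"
    and X: "L2_process P T G X" and z: "L2_process P T F0 z"
    and \<mu>: "\<And>t. t \<in> {0..T} \<Longrightarrow> \<bar>\<mu> t\<bar> \<le> \<mu>b" "\<And>t. t \<in> {0..T} \<Longrightarrow> \<mu> t = prob_space.expectation P (X t)"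
      "\<mu> \<in> borel_measurable (leb T)"
    and l: "l \<in> borel_measurable (leb T)" "\<And>t. t \<in> {0..T} \<Longrightarrow> \<bar>l t\<bar> \<le> lb"
  defines "D \<equiv> \<lambda>t w. \<integral>s. \<kappa> t s * z s w \<partial>leb T"
  shows "AE w in P. real_cond_exp P F0 (feedback_cost z (\<lambda>t w. X t w + D t w)) w
    - prob_space.expectation P (averaged_cost l X) = expansion \<mu> l (\<lambda>t. z t w)"
proof -
  interpret prob_space_subalgebra P F0 by (rule F0)
  let ?L = "leb T"
  interpret LM: pair_sigma_finite ?L P ..
  have D: "L2_process P T F0 D"
    unfolding D_def by (rule L2_kernel[OF subalg T \<kappa>_measurable \<kappa>_bound z])
  note m\<mu>[measurable] = \<mu>(3)
  note sc = L2_scale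
  \<comment> \<open>The coefficients of \<open>D\<close> and of \<open>z\<close> once the state has
    been replaced by its mean.\<close>
  define a1 where "a1 = (\<lambda>t. 2 * (c t * \<mu> t) + l1 t)"
  define a2 where "a2 = (\<lambda>t. d t * \<mu> t + l2 t)"
  have am[measurable]: "a1 \<in> borel_measurable ?L" "a2 \<in> borel_measurable ?L" unfolding a1_def a2_def by measurable
  have ab: "\<bar>a1 t\<bar> \<le> 2 * (cb * \<mu>b) + l1b" "\<bar>a2 t\<bar> \<le> db * \<mu>b + l2b" if "t \<in> {0..T}" for t
    unfolding a1_def a2_def by (intro bound_intros poly_bound \<mu>(1) that)+
  \<comment> \<open>The running cost at \<open>X + D\<close> is \<open>f1 + \<zeta> * X + n\<close>:
    pure state terms, terms in which noise multiplies the state, pure noise terms.\<close>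
  define f1 where "f1 = (\<lambda>t w. (c t * X t w) * X t w + (l1 t * X t w + l0 t))"
  define \<zeta> where "\<zeta> = (\<lambda>t w. (2 * c t) * D t w + d t * z t w)"
  define n where "n = (\<lambda>t w. ((c t * D t w) * D t w + (d t * D t w) * z t w + (R t * z t w) * z t w)
    + (l1 t * D t w + l2 t * z t w))"
  have cX: "L2_process P T G (\<lambda>t w. c t * X t w)" by (rule sc[OF poly_meas(2) poly_bound(2) X])
  have lX: "L2_process P T G (\<lambda>t w. l1 t * X t w + l0 t)"
    by (intro L2_add sc[OF poly_meas(4) poly_bound(4) X]
        L2_deterministic[OF poly_meas(6) poly_bound(6)])
  have \<zeta>L: "L2_process P T F0 \<zeta>" unfolding \<zeta>_def
    by (intro L2_add sc[OF _ two_bound[OF poly_bound(2)] D] sc[OF poly_meas(3) poly_bound(3) z])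
      measurable
  have cD: "L2_process P T F0 (\<lambda>t w. c t * D t w)" by (rule sc[OF poly_meas(2) poly_bound(2) D])
  have dD: "L2_process P T F0 (\<lambda>t w. d t * D t w)" by (rule sc[OF poly_meas(3) poly_bound(3) D])
  have Rz: "L2_process P T F0 (\<lambda>t w. R t * z t w)" by (rule sc[OF coeff_meas(4) coeff_bound(4) z])
  have lD: "L2_process P T F0 (\<lambda>t w. l1 t * D t w + l2 t * z t w)"
    by (intro L2_add sc[OF poly_meas(4) poly_bound(4) D] sc[OF poly_meas(5) poly_bound(5) z])
  have f1I: "process_integrable T P f1"
    using bochner_integrable_add[OF L2_mult_integrable[OF cX X T] L2_integrable[OF lX T]]
    unfolding f1_def by (simp add: case_prod_beta')
  have nI: "process_integrable T P n"
    using bochner_integrable_add[OF bochner_integrable_add[OF bochner_integrable_add[OF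
        L2_mult_integrable[OF cD D T] L2_mult_integrable[OF dD z T]]
        L2_mult_integrable[OF Rz z T]] L2_integrable[OF lD T]]
    unfolding n_def by (simp add: case_prod_beta')
  have X\<zeta>I: "process_integrable T P (\<lambda>t w. \<zeta> t w * X t w)"
    by (rule L2_mult_integrable[OF \<zeta>L X T])
  have \<mu>\<zeta>I: "process_integrable T P (\<lambda>t w. \<zeta> t w * \<mu> t)"
    using L2_integrable[OF sc[OF \<mu>(3) \<mu>(1) \<zeta>L] T] by (simp add: mult.commute)
  have f1t: "integrable P (f1 t)" "ae_measurable P G (f1 t)" if t: "t \<in> {0..T}" for t
  proof -
    show "integrable P (f1 t)" unfolding f1_def
      by (intro bochner_integrable_add L2_mult_integrable_at[OF cX X t] L2_integrable_at[OF lX t])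
    show "ae_measurable P G (f1 t)" unfolding f1_def
      by (intro ae_measurable_add ae_measurable_mult ae_measurable_const L2_D(3)[OF X t])
  qed
  have nt: "integrable P (n t)" "ae_measurable P F0 (n t)" if t: "t \<in> {0..T}" for t
  proof -
    show "integrable P (n t)" unfolding n_def
      by (intro bochner_integrable_add L2_mult_integrable_at[OF cD D t]
          L2_mult_integrable_at[OF dD z t] L2_mult_integrable_at[OF Rz z t] L2_integrable_at[OF lD t])
    show "ae_measurable P F0 (n t)" unfolding n_def
      by (intro ae_measurable_add ae_measurable_mult ae_measurable_const L2_D(3)[OF D t]
          L2_D(3)[OF z t])
  qed
  define \<phi> where "\<phi> = (\<lambda>t. expectation (f1 t))"
  have \<phi>I: "integrable ?L \<phi>" unfolding \<phi>_def using LM.integrable_fst[OF f1I] .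
  have \<phi>I': "process_integrable T P (\<lambda>t w. \<phi> t)"
    using LM.integrable_mult_fst_snd[OF \<phi>I, of "\<lambda>_. 1"] by (simp add: case_prod_beta')
  define v where "v = (\<lambda>t w. f1 t w + \<zeta> t w * X t w + n t w)"
  \<comment> \<open>The candidate for the conditional expectation of \<open>v\<close> at each time;
    exchanging it with the time integral requires its joint integrability.\<close>
  define h where "h = (\<lambda>t w. \<phi> t + \<zeta> t w * \<mu> t + n t w)"
  have vI: "process_integrable T P v"
    using bochner_integrable_add[OF bochner_integrable_add[OF f1I X\<zeta>I] nI]
    unfolding v_def by (simp add: case_prod_beta')
  have hI: "process_integrable T P h"
    using bochner_integrable_add[OF bochner_integrable_add[OF \<phi>I' \<mu>\<zeta>I] nI]
    unfolding h_def by (simp add: case_prod_beta')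
  have cost: "running_cost Q S R p q t (X t w + D t w) (k t + K t * (X t w + D t w) + z t w) = v t w" for t w
    unfolding running_cost_feedback v_def f1_def \<zeta>_def n_def by (simp add: algebra_simps)
  have cost0: "running_cost Q S R p q t (X t w) (k t + K t * X t w) = f1 t w" for t w
    using running_cost_feedback[of t "X t w" 0] unfolding f1_def by simp
  have "AE w in P. real_cond_exp P F0 (v t) w = h t w" if t: "t \<in> {0..T}" for t
    using real_cond_exp_affine_indep[OF indep G f1t(2,1)[OF t] L2_D(3)[OF X t]
        L2_integrable_at[OF X t] L2_D(3)[OF \<zeta>L t] L2_D(2)[OF \<zeta>L t]
        L2_mult_integrable_at[OF \<zeta>L X t] nt(2,1)[OF t]]
    unfolding v_def h_def \<phi>_def \<mu>(2)[OF t] .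
  then have "AE t in ?L. AE w in P. real_cond_exp P F0 (v t) w = h t w"
    by (intro AE_I2[of ?L]) simp
  then have run: "AE w in P. real_cond_exp P F0 (\<lambda>w. \<integral>t. v t w \<partial>?L) w = (\<integral>t. h t w \<partial>?L)"
    by (rule real_cond_exp_Fubini[OF time.sigma_finite_measure_axioms vI hI])
  \<comment> \<open>The terminal cost is split in the same way as the running cost.\<close>
  define g1 where "g1 = (\<lambda>w. M * X T w * X T w + 2 * m * X T w)"
  define g2 where "g2 = (\<lambda>w. (2 * M) * D T w)"
  define g3 where "g3 = (\<lambda>w. M * D T w * D T w + 2 * m * D T w)"
  have g: "terminal_cost M m (X T w + D T w) = g1 w + g2 w * X T w + g3 w"
    "terminal_cost M m (X T w) = g1 w" for w
    unfolding terminal_cost_def g1_def g2_def g3_def by (simp_all add: power2_eq_square algebra_simps)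
  note XT = L2_D(3)[OF X T_mem] L2_integrable_at[OF X T_mem]
    L2_mult_integrable_at[OF X X T_mem]
  note DT = L2_D(2,3)[OF D T_mem] L2_integrable_at[OF D T_mem]
    L2_mult_integrable_at[OF D D T_mem] L2_mult_integrable_at[OF D X T_mem]
  have gI: "integrable P g1" "integrable P (\<lambda>w. g2 w * X T w)" "integrable P g3"
    unfolding g1_def g2_def g3_def using XT DT by (auto simp: mult.assoc)
  have gm: "ae_measurable P G g1" "ae_measurable P F0 g2" "ae_measurable P F0 g3" "g2 \<in> borel_measurable P"
  proof -
    show "ae_measurable P G g1" unfolding g1_def
      by (intro ae_measurable_add ae_measurable_mult ae_measurable_const XT(1))
    show "ae_measurable P F0 g2" "ae_measurable P F0 g3" unfolding g2_def g3_def
      by (intro ae_measurable_add ae_measurable_mult ae_measurable_const DT(2))+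
    show "g2 \<in> borel_measurable P" unfolding g2_def using DT(1) by simp
  qed
  have fin: "AE w in P. real_cond_exp P F0 (\<lambda>w. g1 w + g2 w * X T w + g3 w) w =
      expectation g1 + g2 w * \<mu> T + g3 w"
    using real_cond_exp_affine_indep[OF indep G gm(1) gI(1) XT(1,2) gm(2,4) gI(2) gm(3) gI(3)]
    unfolding \<mu>(2)[OF T_mem] .
  have VI: "integrable P (\<lambda>w. \<integral>t. v t w \<partial>?L)" by (rule LM.integrable_snd[OF vI])
  have add: "AE w in P. real_cond_exp P F0 (\<lambda>w. (\<integral>t. v t w \<partial>?L) + (g1 w + g2 w * X T w + g3 w)) w =
     real_cond_exp P F0 (\<lambda>w. \<integral>t. v t w \<partial>?L) w + real_cond_exp P F0 (\<lambda>w. g1 w + g2 w * X T w + g3 w) w"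
    using VI gI by (intro real_cond_exp_add) auto
  have RlI: "integrable ?L (\<lambda>t. R t * l t)"
    by (rule time_bounded_integrable[OF _ abs_mult_bound[OF coeff_bound(4) l(2)]])
      (use coeff_meas(4) l(1) in auto)
  have relaxed: "expectation (\<lambda>w. (\<integral>t. f1 t w + R t * l t \<partial>?L) + g1 w) =
      (\<integral>t. \<phi> t \<partial>?L) + (\<integral>t. R t * l t \<partial>?L) + expectation g1"
  proof -
    have FI: "integrable P (\<lambda>w. \<integral>t. f1 t w \<partial>?L)" by (rule LM.integrable_snd[OF f1I])
    have sum: "process_integrable T P (\<lambda>t w. f1 t w + R t * l t)"
      using bochner_integrable_add[OF f1I LM.integrable_mult_fst_snd[OF RlI, of "\<lambda>_. 1"]]
      by (simp add: case_prod_beta')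
    have "expectation (\<lambda>w. (\<integral>t. f1 t w + R t * l t \<partial>?L) + g1 w) =
        expectation (\<lambda>w. (\<integral>t. f1 t w \<partial>?L) + (\<integral>t. R t * l t \<partial>?L) + g1 w)"
    proof (rule integral_cong_AE)
      show "AE w in P. (\<integral>t. f1 t w + R t * l t \<partial>?L) + g1 w = (\<integral>t. f1 t w \<partial>?L) + (\<integral>t. R t * l t \<partial>?L) + g1 w"
        using LM.AE_integrable_snd[OF f1I] by eventually_elim (simp add: RlI)
    qed (use LM.integrable_snd[OF sum] FI gI(1) in auto)
    also have "\<dots> = expectation (\<lambda>w. \<integral>t. f1 t w \<partial>?L) + (\<integral>t. R t * l t \<partial>?L) + expectation g1"
      using FI gI(1) by (simp add: prob_space)
    also have "expectation (\<lambda>w. \<integral>t. f1 t w \<partial>?L) = (\<integral>t. \<phi> t \<partial>?L)"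
      unfolding \<phi>_def by (rule LM.Fubini_integral[OF f1I])
    finally show ?thesis .
  qed
  have zI: "AE w in P. integrable ?L (\<lambda>t. z t w)" by (rule LM.AE_integrable_snd[OF L2_integrable[OF z T]])
  have z2I: "AE w in P. integrable ?L (\<lambda>t. (z t w)\<^sup>2)"
    using LM.AE_integrable_snd[OF L2_mult_integrable[OF z z T]] by (simp add: power2_eq_square)
  have hI': "AE w in P. integrable ?L (\<lambda>t. h t w)" by (rule LM.AE_integrable_snd[OF hI])
  \<comment> \<open>A common bound that only secures integrability in the pathwise expansion; it
    involves \<open>lb\<close> and does not enter \<open>hb\<close>.\<close>
  define C where "C = (2 * (cb * \<mu>b) + l1b) + (db * \<mu>b + l2b) + cb + db + \<Gamma> + lb"
  have Cb: "\<bar>a1 t\<bar> \<le> C" "\<bar>a2 t\<bar> \<le> C" "\<bar>c t\<bar> \<le> C" "\<bar>d t\<bar> \<le> C" "\<bar>R t\<bar> \<le> C" "\<bar>l t\<bar> \<le> C" if t: "t \<in> {0..T}" for t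
    using ab[OF t] poly_bound(2,3)[OF t] coeff_bound(4)[OF t] l(2)[OF t] unfolding C_def by auto
  show ?thesis
    unfolding feedback_cost_def[abs_def] averaged_cost_def[abs_def] cost cost0 g relaxed
    using add run fin zI z2I hI'
  proof eventually_elim
    case (elim w)
    define E where "E = (\<integral>t. a1 t * D t w + a2 t * z t w + c t * (D t w)\<^sup>2 + d t * D t w * z t w
        + R t * (z t w)\<^sup>2 - R t * l t \<partial>?L)"
    define H where "H = (\<integral>t. h t w \<partial>?L)"
    define \<Phi> where "\<Phi> = (\<integral>t. \<phi> t \<partial>?L)"
    define \<Lambda> where "\<Lambda> = (\<integral>t. R t * l t \<partial>?L)"
    \<comment> \<open>The means of the pure state terms cancel here, and \<open>R * l\<close> is all
      that the relaxed cost contributes.\<close>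
    have "H - (\<Phi> + \<Lambda>) = (\<integral>t. h t w - (\<phi> t + R t * l t) \<partial>?L)"
      unfolding H_def \<Phi>_def \<Lambda>_def using elim \<phi>I RlI by simp
    also have "\<dots> = E"
      unfolding E_def h_def \<zeta>_def n_def a1_def a2_def
      by (intro bochner_integral_cong refl) (simp add: power2_eq_square algebra_simps)
    finally have 1: "H - (\<Phi> + \<Lambda>) = E" .
    have h1e: "h1 \<mu> s = a2 s + (\<integral>t. a1 t * \<kappa> t s \<partial>?L) + (2 * (M * \<mu> T) + 2 * m) * \<kappa> T s" for s
      by (simp add: h1_def a1_def a2_def)
    have 2: "E + (2 * (M * \<mu> T) + 2 * m) * D T w + M * (D T w)\<^sup>2 = expansion \<mu> l (\<lambda>t. z t w)"
      unfolding E_def expansion_def h1e h3_def D_def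
      by (rule quadratic_kernel_expansion[OF T \<kappa>_measurable \<kappa>_bound elim(4,5) am poly_meas(2,3)
            coeff_meas(4) l(1) Cb])
    have "g2 w * \<mu> T + g3 w = (2 * (M * \<mu> T) + 2 * m) * D T w + M * (D T w)\<^sup>2"
      by (simp add: g2_def g3_def power2_eq_square algebra_simps)
    then show ?case
      unfolding elim(1-3) 2[symmetric] H_def[symmetric] \<Phi>_def[symmetric] \<Lambda>_def[symmetric] using 1 by linarith
  qed
qed

end

section \<open>The state equations\<close>

lemma cumint_process_measurable:
  assumes "process_measurable T P g"
  shows "process_measurable T P (\<lambda>t w. cumint T (\<lambda>s. g s w) t)"
proof -
  let ?L = "leb T"
  have "(\<lambda>x. \<integral>s. (if s \<le> fst x then g s (snd x) else 0) \<partial>?L) \<in> borel_measurable (?L \<Otimes>\<^sub>M P)"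
  proof (rule time.borel_measurable_lebesgue_integral)
    have "(\<lambda>x. (snd x, fst (fst x))) \<in> measurable ((?L \<Otimes>\<^sub>M P) \<Otimes>\<^sub>M ?L) (?L \<Otimes>\<^sub>M ?L)"
      by measurable
    from measurable_compose[OF this time_le_measurable[of T]]
    have "Measurable.pred ((?L \<Otimes>\<^sub>M P) \<Otimes>\<^sub>M ?L) (\<lambda>x. snd x \<le> fst (fst x))" by simp
    moreover have "(\<lambda>x. g (snd x) (snd (fst x))) \<in> borel_measurable ((?L \<Otimes>\<^sub>M P) \<Otimes>\<^sub>M ?L)"
      by (intro process_compose[OF assms] measurable_snd measurable_compose[OF measurable_fst measurable_snd])
    ultimately show "(\<lambda>(x, s). if s \<le> fst x then g s (snd x) else 0) \<in> borel_measurable ((?L \<Otimes>\<^sub>M P) \<Otimes>\<^sub>M ?L)"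
      unfolding case_prod_beta' by (intro measurable_If) auto
  qed
  then show ?thesis by (simp add: cumint_def case_prod_beta')
qed

text \<open>Fubini for null sets, the coincidence set being jointly measurable. The exceptional
  times may depend on the path, so a prescribed time has to be treated separately.\<close>

lemma (in prob_space) AE_time_swap:
  fixes g :: "real \<Rightarrow> 'a \<Rightarrow> real"
  assumes "process_measurable T M g"
    and "process_measurable T M h"
    and eq: "\<And>t. t \<in> {0..T} \<Longrightarrow> AE w in M. g t w = h t w"
  shows "AE w in M. AE t in leb T. g t w = h t w"
proof -
  interpret LM: pair_sigma_finite "leb T" M ..
  have [measurable]: "(\<lambda>x. g (fst x) (snd x)) \<in> borel_measurable (leb T \<Otimes>\<^sub>M M)"
    "(\<lambda>x. h (fst x) (snd x)) \<in> borel_measurable (leb T \<Otimes>\<^sub>M M)"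
    using assms(1,2) by (simp_all add: case_prod_beta')
  have "{x \<in> space (leb T \<Otimes>\<^sub>M M). g (fst x) (snd x) = h (fst x) (snd x)} \<in> sets (leb T \<Otimes>\<^sub>M M)"
    by measurable
  from LM.AE_commute[OF this] show ?thesis
    using eq by (auto intro: AE_I2)
qed

lemma time_integral_measurable:
  fixes u :: "real \<Rightarrow> 'w \<Rightarrow> real"
  assumes "process_measurable T P u"
  shows "(\<lambda>w. \<integral>t. u t w \<partial>leb T) \<in> borel_measurable P"
  using measurable_compose[OF measurable_pair_swap' assms]
  by (intro time.borel_measurable_lebesgue_integral) (simp add: case_prod_beta')

lemma policy_noise_measurable:
  assumes "policy_noise P T F0 \<xi>"
  shows "process_measurable T P (\<lambda>t w. \<xi> w t)"
proof -
  have "(borel_measurable (P \<Otimes>\<^sub>M restrict_space borel {0..T}) :: (_ \<Rightarrow> real) set) =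
      borel_measurable (P \<Otimes>\<^sub>M leb T)"
    by (intro measurable_cong_sets sets_pair_measure_cong refl sets_leb[symmetric])
  then have "(\<lambda>(w, t). \<xi> w t) \<in> borel_measurable (P \<Otimes>\<^sub>M leb T)"
    using assms by (simp add: policy_noise_def)
  from measurable_compose[OF measurable_pair_swap' this] show ?thesis by (simp add: case_prod_beta')
qed

section \<open>Moments, representation and difference of the states\<close>

context lq_policy
begin

lemma \<sigma>_square_integral:
  assumes t: "t \<in> {0..T}"
  shows "(\<lambda>s. indicator {0..t} s * \<sigma> s) \<in> borel_measurable borel"
    "(\<integral>\<^sup>+s. ennreal ((indicator {0..t} s * \<sigma> s)\<^sup>2) \<partial>lborel) \<le> ennreal (T * (\<Gamma> * \<Gamma>))"
proof -
  have "(\<lambda>s. indicator {0..T} s *\<^sub>R \<sigma> s) \<in> borel_measurable borel"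
    using coeff_meas(1) unfolding measurable_leb
    by (subst (asm) borel_measurable_restrict_space_iff) auto
  then have "(\<lambda>s. indicator {0..t} s * (indicator {0..T} s *\<^sub>R \<sigma> s)) \<in> borel_measurable borel"
    by (intro borel_measurable_times) auto
  moreover have "indicator {0..t} s * (indicator {0..T} s *\<^sub>R \<sigma> s) = indicator {0..t} s * \<sigma> s" for s
    using t by (auto simp: indicator_def)
  ultimately show "(\<lambda>s. indicator {0..t} s * \<sigma> s) \<in> borel_measurable borel" by (simp only:)
  have "(\<integral>\<^sup>+s. ennreal ((indicator {0..t} s * \<sigma> s)\<^sup>2) \<partial>lborel) \<le> (\<integral>\<^sup>+s. ennreal (\<Gamma> * \<Gamma>) * indicator {0..T} s \<partial>lborel)"
  proof (rule nn_integral_mono)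
    fix s
    show "ennreal ((indicator {0..t} s * \<sigma> s)\<^sup>2) \<le> ennreal (\<Gamma> * \<Gamma>) * indicator {0..T} s"
    proof (cases "s \<in> {0..t}")
      case True
      then have s: "s \<in> {0..T}" using t by auto
      have "(\<sigma> s)\<^sup>2 = \<bar>\<sigma> s * \<sigma> s\<bar>" by (simp add: power2_eq_square)
      also have "\<dots> \<le> \<Gamma> * \<Gamma>" by (intro abs_mult_bound coeff_bound s)
      finally show ?thesis using True s by (simp add: ennreal_leI)
    qed simp
  qed
  also have "\<dots> = ennreal (\<Gamma> * \<Gamma>) * ennreal T" using T by (simp add: nn_integral_cmult_indicator)
  also have "\<dots> = ennreal (T * (\<Gamma> * \<Gamma>))"
    using T by (subst ennreal_mult[symmetric]) (auto simp: mult.commute)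
  finally show "(\<integral>\<^sup>+s. ennreal ((indicator {0..t} s * \<sigma> s)\<^sup>2) \<partial>lborel) \<le> ennreal (T * (\<Gamma> * \<Gamma>))" .
qed

lemma L2_noise:
  assumes "prob_space P" and noise: "policy_noise P T F0 \<xi>"
    and lam: "lam \<in> borel_measurable (leb T)" "\<And>t. t \<in> {0..T} \<Longrightarrow> \<bar>lam t\<bar> \<le> lb"
  shows "L2_process P T F0 (\<lambda>t w. lam t * \<xi> w t)"
proof -
  interpret prob_space P by fact
  have "L2_process P T F0 (\<lambda>t w. \<xi> w t)"
    unfolding L2_process_def
  proof (intro conjI ballI exI)
    show "process_measurable T P (\<lambda>t w. \<xi> w t)"
      by (rule policy_noise_measurable[OF noise])
    fix t assume t: "t \<in> {0..T}"
    then have D: "distributed P lborel (\<lambda>w. \<xi> w t) std_normal_density" and F: "(\<lambda>w. \<xi> w t) \<in> borel_measurable F0"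
      using noise by (auto simp: policy_noise_def)
    from normal_second_moment(3,4)[OF D] show "(\<integral>\<^sup>+w. ennreal ((\<xi> w t)\<^sup>2) \<partial>P) \<le> ennreal 1"
      by (subst nn_integral_eq_integral) auto
    show "ae_measurable P F0 (\<lambda>w. \<xi> w t)" by (rule ae_measurableI[OF F])
  qed
  from L2_scale[OF lam this] show ?thesis .
qed

lemma drift_measurable:
  assumes X: "process_measurable T P X" and z: "process_measurable T P z"
  shows "process_measurable T P (\<lambda>s w. \<alpha> s * X s w + B * k s + B * z s w)"
proof -
  note [measurable] = X[unfolded case_prod_beta'] z[unfolded case_prod_beta']
  show ?thesis unfolding case_prod_beta' by measurable
qed

text \<open>Here \<open>z\<close> is the exploration noise \<open>\<lambda> \<xi>\<close>; it vanishes for the relaxed policy.\<close>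

definition state_process :: "'w measure \<Rightarrow> (real \<Rightarrow> 'w \<Rightarrow> real) \<Rightarrow> (real \<Rightarrow> 'w \<Rightarrow> real) \<Rightarrow> (real \<Rightarrow> 'w \<Rightarrow> real) \<Rightarrow> bool" where
  "state_process P W z X \<longleftrightarrow>
    process_measurable T P X \<and>
    (AE w in P. integrable (leb T) (\<lambda>s. \<alpha> s * X s w + B * k s + B * z s w)) \<and>
    (\<forall>t\<in>{0..T}. \<exists>I. is_wiener_integral P W t \<sigma> I \<and>
      (AE w in P. X t w = x0 + cumint T (\<lambda>s. \<alpha> s * X s w + B * k s + B * z s w) t + I w))"

text \<open>At each time \<open>J\<close> agrees almost surely with a Wiener integral and inherits
  its second moment and its measurability in the paths. The mean is bounded rather than
  computed.\<close>

lemma L2_wiener: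
  assumes "prob_space P" and bm: "brownian_motion P T W"
    and J: "process_measurable T P J"
    and wi: "\<And>t. t \<in> {0..T} \<Longrightarrow> \<exists>I. is_wiener_integral P W t \<sigma> I \<and> (AE w in P. J t w = I w)"
  shows "L2_process P T (path_algebra P T W) J"
    and "t \<in> {0..T} \<Longrightarrow> \<bar>prob_space.expectation P (J t)\<bar> \<le> Jb"
proof -
  interpret prob_space P by fact
  have bnd: "(\<integral>\<^sup>+w. ennreal ((J t w)\<^sup>2) \<partial>P) \<le> ennreal (16 * (T * (\<Gamma> * \<Gamma>)))"
    and aem: "ae_measurable P (path_algebra P T W) (J t)" if t: "t \<in> {0..T}" for t
  proof -
    obtain I where I: "is_wiener_integral P W t \<sigma> I" and ae: "AE w in P. J t w = I w"
      using wi[OF t] by blast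
    have "(\<integral>\<^sup>+w. ennreal ((J t w)\<^sup>2) \<partial>P) = (\<integral>\<^sup>+w. ennreal ((I w)\<^sup>2) \<partial>P)"
      by (rule nn_integral_cong_AE) (use ae in auto)
    also have "\<dots> \<le> 16 * (\<integral>\<^sup>+s. ennreal ((indicator {0..t} s * \<sigma> s)\<^sup>2) \<partial>lborel)"
      by (rule wiener_integral_bound[OF bm I t \<sigma>_square_integral(1)[OF t]])
    also have "\<dots> \<le> 16 * ennreal (T * (\<Gamma> * \<Gamma>))" by (intro mult_left_mono \<sigma>_square_integral t) simp
    also have "\<dots> = ennreal (16 * (T * (\<Gamma> * \<Gamma>)))" using T by (simp add: ennreal_mult)
    finally show "(\<integral>\<^sup>+w. ennreal ((J t w)\<^sup>2) \<partial>P) \<le> ennreal (16 * (T * (\<Gamma> * \<Gamma>)))" .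
    show "ae_measurable P (path_algebra P T W) (J t)"
      by (rule ae_measurable_cong_AE[OF ae wiener_integral_ae_measurable[OF bm I t]])
  qed
  show L2: "L2_process P T (path_algebra P T W) J"
    unfolding L2_process_def using J bnd aem by blast
  show "\<bar>expectation (J t)\<bar> \<le> Jb" if t: "t \<in> {0..T}"
  proof -
    have i: "integrable P (J t)" "integrable P (\<lambda>w. (J t w)\<^sup>2)"
      using L2_integrable_at[OF L2 t] L2_D(4)[OF L2 t] by auto
    have "ennreal (expectation (\<lambda>w. (J t w)\<^sup>2)) \<le> ennreal (16 * (T * (\<Gamma> * \<Gamma>)))"
      using bnd[OF t] nn_integral_eq_integral[OF i(2)] by simp
    then have 2: "expectation (\<lambda>w. (J t w)\<^sup>2) \<le> 16 * (T * (\<Gamma> * \<Gamma>))"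
      using T by (subst (asm) ennreal_le_iff) auto
    have "\<bar>expectation (J t)\<bar> \<le> expectation (\<lambda>w. \<bar>J t w\<bar>)" by (rule integral_abs_bound)
    also have "\<dots> \<le> expectation (\<lambda>w. 1 + (J t w)\<^sup>2)"
    proof (rule integral_mono)
      have "\<bar>x\<bar> \<le> 1 + x\<^sup>2" for x :: real using abs_mult_le_sum_squares[of 1 x] by simp
      then show "\<bar>J t w\<bar> \<le> 1 + (J t w)\<^sup>2" for w .
    qed (use i in auto)
    also have "\<dots> = 1 + expectation (\<lambda>w. (J t w)\<^sup>2)" using i by (simp add: prob_space)
    finally show ?thesis using 2 unfolding Jb_def by simp
  qed
qed

text \<open>A solution comes with neither moments nor measurability in the paths of \<open>W\<close>
  alone. Both are taken from \<open>J\<close>, what is left of \<open>X\<close> without initial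
  value and drift: \<open>X - J\<close> solves a pathwise linear equation with source
  \<open>\<alpha> * J + B * k\<close>, and variation of constants expresses \<open>X\<close> through
  \<open>J\<close>.\<close>

lemma state_representation:
  assumes "prob_space P" and bm: "brownian_motion P T W" and X: "state_process P W (\<lambda>_ _. 0) X"
  obtains X' where "L2_process P T (path_algebra P T W) X'"
    "AE w in P. \<forall>t\<in>{0..T}. X t w = X' t w"
    "\<And>t. t \<in> {0..T} \<Longrightarrow> \<bar>prob_space.expectation P (X' t)\<bar> \<le> \<mu>b"
proof -
  interpret prob_space P by fact
  let ?L = "leb T" and ?G = "path_algebra P T W"
  interpret LM: pair_sigma_finite ?L P ..
  have Xm: "process_measurable T P X"
    using X by (simp add: state_process_def)
  define f where "f = (\<lambda>s w. \<alpha> s * X s w + B * k s)"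
  define J where "J = (\<lambda>t w. X t w - x0 - cumint T (\<lambda>s. f s w) t)"
  have fm: "process_measurable T P f"
    using drift_measurable[OF Xm, of "\<lambda>_ _. 0"] by (simp add: f_def)
  have fI: "AE w in P. integrable ?L (\<lambda>s. f s w)"
    using X by (simp add: state_process_def f_def)
  have Jm: "process_measurable T P J"
    using borel_measurable_diff[OF borel_measurable_diff[OF Xm borel_measurable_const[of x0]] cumint_process_measurable[OF fm]]
    unfolding J_def by (simp add: case_prod_beta')
  have wi: "\<exists>I. is_wiener_integral P W t \<sigma> I \<and> (AE w in P. J t w = I w)" if t: "t \<in> {0..T}" for t
  proof -
    obtain I where I: "is_wiener_integral P W t \<sigma> I" "AE w in P. X t w = x0 + cumint T (\<lambda>s. f s w) t + I w"
      using X t unfolding state_process_def f_def mult_zero_right add_0_right by blast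
    have "AE w in P. J t w = I w" using I(2) by eventually_elim (simp add: J_def)
    with I(1) show ?thesis by blast
  qed
  have J: "L2_process P T ?G J" by (rule L2_wiener(1)[OF assms(1) bm Jm wi])
  have EJ: "\<bar>expectation (J t)\<bar> \<le> Jb" if "t \<in> {0..T}" for t
    by (rule L2_wiener(2)[OF assms(1) bm Jm wi that])
  \<comment> \<open>The solution splits into \<open>\<mu>0\<close>, driven by \<open>x0\<close> and
    the source \<open>B * k\<close>, and the transform of \<open>J\<close> under
    \<open>\<kappa>'\<close>, driven by the source \<open>\<alpha> * J\<close>.\<close>
  define \<mu>0 where "\<mu>0 = (\<lambda>t. exp (cumint T \<alpha> t) * (x0 + cumint T (\<lambda>s. exp (- cumint T \<alpha> s) * (B * k s)) t))"
  define \<kappa>' where "\<kappa>' = (\<lambda>t s. if s \<le> t then exp (cumint T \<alpha> t - cumint T \<alpha> s) * \<alpha> s else 0)"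
  have kb0: "0 \<le> kb" "0 \<le> \<alpha>b" using policy_bound(1)[OF zero_mem] poly_bound(1)[OF zero_mem] by auto
  have Ebk: "\<bar>if s \<le> t then exp (- cumint T \<alpha> s) * (B * k s) else 0\<bar> \<le> exp (T * \<alpha>b) * (\<bar>B\<bar> * kb)"
    if "s \<in> {0..T}" for s t
  proof (cases "s \<le> t")
    case True
    have "\<bar>exp (- cumint T \<alpha> s) * (B * k s)\<bar> \<le> exp (T * \<alpha>b) * (\<bar>B\<bar> * kb)"
      by (intro abs_mult_bound exp_\<alpha>_bound policy_bound order_refl that)
    then show ?thesis using True by simp
  qed (use kb0 in simp)
  have \<mu>0m: "\<mu>0 \<in> borel_measurable ?L" unfolding \<mu>0_def by measurable
  have \<mu>0b: "\<bar>\<mu>0 t\<bar> \<le> exp (T * \<alpha>b) * (\<bar>x0\<bar> + T * (exp (T * \<alpha>b) * (\<bar>B\<bar> * kb)))" for t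
    unfolding \<mu>0_def cumint_def[of T "\<lambda>s. exp (- cumint T \<alpha> s) * (B * k s)"]
    by (intro abs_mult_bound abs_add_bound exp_\<alpha>_bound time_integral_bound T Ebk order_refl)
  have \<kappa>'m: "process_measurable T ?L \<kappa>'"
    unfolding \<kappa>'_def by (rule cut_measurable) measurable
  have \<kappa>'b: "\<bar>\<kappa>' t s\<bar> \<le> exp (T * \<alpha>b + T * \<alpha>b) * \<alpha>b" if "s \<in> {0..T}" for t s
  proof (cases "s \<le> t")
    case True
    have "\<bar>exp (cumint T \<alpha> t - cumint T \<alpha> s) * \<alpha> s\<bar> \<le> exp (T * \<alpha>b + T * \<alpha>b) * \<alpha>b"
      by (intro abs_mult_bound exp_\<alpha>_bound poly_bound that)
    then show ?thesis using True by (simp add: \<kappa>'_def)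
  qed (use kb0 in \<open>simp add: \<kappa>'_def\<close>)
  define N where "N = (\<lambda>t w. \<integral>s. \<kappa>' t s * J s w \<partial>?L)"
  have N: "L2_process P T ?G N" unfolding N_def
    by (rule L2_kernel[OF subalgebra_path[OF bm] T \<kappa>'m _ J]) (use \<kappa>'b in auto)
  have JI: "process_integrable T P J" by (rule L2_integrable[OF J T])
  define X' where "X' = (\<lambda>t w. J t w + \<mu>0 t + N t w)"
  have "L2_process P T ?G X'" unfolding X'_def
    by (intro L2_add J N L2_deterministic[OF \<mu>0m \<mu>0b])
  moreover have "AE w in P. \<forall>t\<in>{0..T}. X t w = X' t w"
    using fI LM.AE_integrable_snd[OF JI] AE_space
  proof eventually_elim
    case (elim w)
    have JIb: "integrable ?L (\<lambda>s. \<alpha> s * J s w)"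
      by (rule integrable_bounded_mult[OF elim(2) poly_meas(1)]) (use poly_bound(1) in auto)
    have kI: "integrable ?L (\<lambda>s. B * k s)"
      using time_bounded_integrable[OF coeff_meas(7) policy_bound(1)] by simp
    \<comment> \<open>By the definition of \<open>J\<close> the equation for \<open>y\<close> holds
      at every time, so a single exceptional set of paths serves all \<open>t\<close>.\<close>
    define y where "y = (\<lambda>s. X s w - J s w)"
    have y: "y s = x0 + cumint T (\<lambda>s. f s w) s" for s by (simp add: y_def J_def)
    have [measurable]: "(\<lambda>s. f s w) \<in> borel_measurable ?L" "(\<lambda>s. J s w) \<in> borel_measurable ?L"
      using elim by auto
    have ym: "y \<in> borel_measurable ?L" unfolding y[abs_def] by measurable
    show "\<forall>t\<in>{0..T}. X t w = X' t w"
    proof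
      fix t assume "t \<in> {0..T}"
      have "y t = exp (cumint T \<alpha> t) * (x0 + cumint T (\<lambda>s. exp (- cumint T \<alpha> s) * (\<alpha> s * J s w + B * k s)) t)"
        by (rule linear_ode_representation[OF \<alpha>_integrable bochner_integrable_add[OF JIb kI] elim(1) ym])
          (rule AE_I2, simp add: f_def y_def algebra_simps, rule AE_I2, rule y, rule y)
      also have "cumint T (\<lambda>s. exp (- cumint T \<alpha> s) * (\<alpha> s * J s w + B * k s)) t =
          cumint T (\<lambda>s. exp (- cumint T \<alpha> s) * (\<alpha> s * J s w)) t + cumint T (\<lambda>s. exp (- cumint T \<alpha> s) * (B * k s)) t"
      proof -
        have *: "(\<lambda>s. exp (- cumint T \<alpha> s)) \<in> borel_measurable ?L" by measurable
        show ?thesis unfolding distrib_left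
          by (intro cumint_add integrable_bounded_mult[OF JIb * exp_\<alpha>_bound(2)] integrable_bounded_mult[OF kI * exp_\<alpha>_bound(2)])
      qed
      also have "exp (cumint T \<alpha> t) * (x0 + (cumint T (\<lambda>s. exp (- cumint T \<alpha> s) * (\<alpha> s * J s w)) t
          + cumint T (\<lambda>s. exp (- cumint T \<alpha> s) * (B * k s)) t)) =
          \<mu>0 t + exp (cumint T \<alpha> t) * cumint T (\<lambda>s. exp (- cumint T \<alpha> s) * (\<alpha> s * J s w)) t"
        by (simp add: \<mu>0_def algebra_simps)
      also have "exp (cumint T \<alpha> t) * cumint T (\<lambda>s. exp (- cumint T \<alpha> s) * (\<alpha> s * J s w)) t = N t w"
        unfolding N_def cumint_scale[symmetric] \<kappa>'_def
          cumint_def[of T "\<lambda>s. exp (cumint T \<alpha> t) * (exp (- cumint T \<alpha> s) * (\<alpha> s * J s w))" t]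
        by (intro bochner_integral_cong refl) (simp add: exp_diff exp_minus field_simps)
      finally show "X t w = X' t w" by (simp add: X'_def y_def)
    qed
  qed
  moreover have "\<bar>expectation (X' t)\<bar> \<le> \<mu>b" if t: "t \<in> {0..T}" for t
  proof -
    have "expectation (X' t) = expectation (J t) + \<mu>0 t + expectation (N t)"
      unfolding X'_def using L2_integrable_at[OF J t] L2_integrable_at[OF N t]
      by (simp add: prob_space)
    also have "expectation (N t) = (\<integral>s. \<kappa>' t s * expectation (J s) \<partial>?L)"
    proof -
      have "L2_process P T ?G (\<lambda>s w. \<kappa>' t s * J s w)"
        by (rule L2_scale[OF time_kernel_sections(1)[OF \<kappa>'m t] \<kappa>'b J])
      from LM.Fubini_integral[OF L2_integrable[OF this T]] show ?thesis by (simp add: N_def)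
    qed
    also have "\<bar>expectation (J t) + \<mu>0 t + (\<integral>s. \<kappa>' t s * expectation (J s) \<partial>?L)\<bar> \<le> \<mu>b"
      unfolding \<mu>b_def by (intro abs_add_bound abs_mult_bound EJ[OF t] \<mu>0b time_integral_bound T \<kappa>'b EJ)
    finally show ?thesis .
  qed
  ultimately show thesis by (rule that)
qed

text \<open>The two Wiener integrals are cancelled one time at a time, as
  \<open>wiener_integral_unique\<close> has its own null set for each time. Hence the claim concerns
  a fixed \<open>t\<close>, and on a given path the integral equation is known for almost every
  \<open>s\<close> only.\<close>

lemma state_difference:
  assumes "prob_space P" and bm: "brownian_motion P T W"
    and X: "state_process P W (\<lambda>_ _. 0) X" and Y: "state_process P W z Y" and z: "L2_process P T F0 z"
    and t: "t \<in> {0..T}"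
  shows "AE w in P. Y t w = X t w + (\<integral>s. \<kappa> t s * z s w \<partial>leb T)"
proof -
  interpret prob_space P by fact
  let ?L = "leb T"
  interpret LM: pair_sigma_finite ?L P ..
  have Xm: "process_measurable T P X" and Ym: "process_measurable T P Y"
    using X Y by (simp_all add: state_process_def)
  define U where "U = (\<lambda>t w. Y t w - X t w)"
  define g where "g = (\<lambda>s w. \<alpha> s * U s w + B * z s w)"
  have Um: "process_measurable T P U"
    using borel_measurable_diff[OF Ym Xm] by (simp add: U_def case_prod_beta')
  have gm: "process_measurable T P g"
    using borel_measurable_diff[OF drift_measurable[OF Ym L2_D(1)[OF z]]
        drift_measurable[OF Xm, of "\<lambda>_ _. 0"]]
    by (simp add: g_def U_def case_prod_beta' algebra_simps)
  have iX: "AE w in P. integrable ?L (\<lambda>s. \<alpha> s * X s w + B * k s)"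
    and iY: "AE w in P. integrable ?L (\<lambda>s. \<alpha> s * Y s w + B * k s + B * z s w)"
    using X Y by (simp_all add: state_process_def)
  have gI: "AE w in P. integrable ?L (\<lambda>s. g s w)"
    using iX iY
  proof eventually_elim
    case (elim w)
    from Bochner_Integration.integrable_diff[OF elim(2,1)] show ?case
      by (simp add: g_def U_def algebra_simps)
  qed
  have eq: "AE w in P. U t w = cumint T (\<lambda>s. g s w) t" if t: "t \<in> {0..T}" for t
  proof -
    obtain I where I: "is_wiener_integral P W t \<sigma> I"
      "AE w in P. X t w = x0 + cumint T (\<lambda>s. \<alpha> s * X s w + B * k s) t + I w"
      using X t unfolding state_process_def mult_zero_right add_0_right by blast
    obtain I' where I': "is_wiener_integral P W t \<sigma> I'"
      "AE w in P. Y t w = x0 + cumint T (\<lambda>s. \<alpha> s * Y s w + B * k s + B * z s w) t + I' w"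
      using Y t unfolding state_process_def by blast
    have "AE w in P. I w = I' w"
      by (rule wiener_integral_unique[OF bm I(1) I'(1) t \<sigma>_square_integral(1)[OF t]])
    then show ?thesis using I(2) I'(2) iX gI
    proof eventually_elim
      case (elim w)
      have "cumint T (\<lambda>s. \<alpha> s * Y s w + B * k s + B * z s w) t =
          cumint T (\<lambda>s. (\<alpha> s * X s w + B * k s) + g s w) t"
        by (intro arg_cong[where f="\<lambda>f. cumint T f t"] ext) (simp add: g_def U_def algebra_simps)
      also have "\<dots> = cumint T (\<lambda>s. \<alpha> s * X s w + B * k s) t + cumint T (\<lambda>s. g s w) t"
        by (rule cumint_add[OF elim(4,5)])
      finally show ?case using elim(1-3) by (simp add: U_def)
    qed
  qed
  have eq': "AE w in P. AE s in ?L. U s w = cumint T (\<lambda>s. g s w) s"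
    by (rule AE_time_swap[OF Um cumint_process_measurable[OF gm] eq])
  show ?thesis
    using eq[OF t] eq' gI LM.AE_integrable_snd[OF L2_integrable[OF z T]] AE_space
  proof eventually_elim
    case (elim w)
    have "U t w = exp (cumint T \<alpha> t) * (0 + cumint T (\<lambda>s. exp (- cumint T \<alpha> s) * (B * z s w)) t)"
      by (rule linear_ode_representation[where f="\<lambda>s. g s w" and y="\<lambda>s. U s w" and a=\<alpha> and b="\<lambda>s. B * z s w"])
        (use elim process_section[OF Um elim(5)] \<alpha>_integrable in \<open>auto simp: g_def\<close>)
    also have "\<dots> = (\<integral>s. \<kappa> t s * z s w \<partial>?L)"
      unfolding add_0 cumint_scale[symmetric] \<kappa>_def
        cumint_def[of T "\<lambda>s. exp (cumint T \<alpha> t) * (exp (- cumint T \<alpha> s) * (B * z s w))" t]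
      by (intro bochner_integral_cong refl) (simp add: exp_diff exp_minus field_simps)
    finally show ?case by (simp add: U_def)
  qed
qed

lemma feedback_running_cost_measurable:
  assumes V: "process_measurable T P V" and y: "process_measurable T P y"
  shows "process_measurable T P (\<lambda>t w. running_cost Q S R p q t (V t w) (k t + K t * V t w + y t w))"
proof -
  note [measurable] = V[unfolded case_prod_beta'] y[unfolded case_prod_beta']
  show ?thesis unfolding running_cost_feedback case_prod_beta' by measurable
qed

lemma averaged_running_cost_measurable:
  assumes V: "process_measurable T P V" and l: "l \<in> borel_measurable (leb T)"
  shows "process_measurable T P (\<lambda>t w. running_cost Q S R p q t (V t w) (k t + K t * V t w) + R t * l t)"
proof -
  note [measurable] = V[unfolded case_prod_beta'] l
  show ?thesis using running_cost_feedback[of _ _ 0] unfolding case_prod_beta' by simp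
qed

lemma terminal_cost_measurable:
  assumes V: "process_measurable T P V"
  shows "(\<lambda>w. terminal_cost M m (V T w)) \<in> borel_measurable P"
proof -
  have "(\<lambda>w. V T w) \<in> borel_measurable P"
    by (rule process_compose[OF V measurable_const measurable_ident_sets[OF refl]]) (use T in simp)
  then show ?thesis unfolding terminal_cost_def by simp
qed

lemma cost_measurable:
  assumes V: "process_measurable T P V"
  shows "process_measurable T P y \<Longrightarrow> feedback_cost y V \<in> borel_measurable P"
    and "l \<in> borel_measurable (leb T) \<Longrightarrow> averaged_cost l V \<in> borel_measurable P"
proof -
  show "feedback_cost y V \<in> borel_measurable P" if "process_measurable T P y"
    unfolding feedback_cost_def[abs_def]
    by (rule borel_measurable_add[OF time_integral_measurable[OF feedback_running_cost_measurable[OF V that]]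
        terminal_cost_measurable[OF V]])
  show "averaged_cost l V \<in> borel_measurable P" if "l \<in> borel_measurable (leb T)"
    unfolding averaged_cost_def[abs_def]
    by (rule borel_measurable_add[OF time_integral_measurable[OF averaged_running_cost_measurable[OF V that]]
        terminal_cost_measurable[OF V]])
qed

text \<open>Transports \<open>conditional_cost_gap\<close> from the representatives
  \<open>X'\<close> and \<open>X' + D\<close> to the given states. The perturbed state agrees with
  its representative at almost every time, which suffices for the running cost, and separately at
  \<open>T\<close>, for the terminal cost.\<close>

lemma state_cost_gap:
  assumes F0: "prob_space_subalgebra P F0" and bm: "brownian_motion P T W"
    and indep: "indep_of_process P T W F0"
    and X: "state_process P W (\<lambda>_ _. 0) X" and Y: "state_process P W z Y" and z: "L2_process P T F0 z"
    and l: "l \<in> borel_measurable (leb T)" "\<And>t. t \<in> {0..T} \<Longrightarrow> \<bar>l t\<bar> \<le> lb"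
  obtains \<mu> where "\<mu> \<in> borel_measurable (leb T)" "\<And>t. t \<in> {0..T} \<Longrightarrow> \<bar>\<mu> t\<bar> \<le> \<mu>b"
    "AE w in P. real_cond_exp P F0 (feedback_cost z Y) w - prob_space.expectation P (averaged_cost l X) =
      expansion \<mu> l (\<lambda>t. z t w)"
proof -
  interpret prob_space_subalgebra P F0 by (rule F0)
  let ?L = "leb T" and ?G = "path_algebra P T W"
  interpret LM: pair_sigma_finite ?L P ..
  have ps: "prob_space P" by (rule prob_space_axioms)
  obtain X' where X': "L2_process P T ?G X'" and XX': "AE w in P. \<forall>t\<in>{0..T}. X t w = X' t w"
    and \<mu>b: "\<And>t. t \<in> {0..T} \<Longrightarrow> \<bar>expectation (X' t)\<bar> \<le> \<mu>b"
    using state_representation[OF ps bm X] by blast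
  define D where "D = (\<lambda>t w. \<integral>s. \<kappa> t s * z s w \<partial>?L)"
  have D: "L2_process P T F0 D"
    unfolding D_def by (rule L2_kernel[OF subalg T \<kappa>_measurable \<kappa>_bound z])
  define \<mu> where "\<mu> = (\<lambda>t. expectation (X' t))"
  have \<mu>m: "\<mu> \<in> borel_measurable ?L"
    unfolding \<mu>_def by (rule borel_measurable_lebesgue_integral[OF L2_D(1)[OF X']])
  have ind: "indep_set (sets F0) (sets ?G)"
    using indep unfolding indep_of_process_def sets_path_algebra .
  have \<mu>b': "\<bar>\<mu> t\<bar> \<le> \<mu>b" if "t \<in> {0..T}" for t using \<mu>b[OF that] by (simp add: \<mu>_def)
  have \<mu>e: "\<mu> t = expectation (X' t)" for t by (simp add: \<mu>_def)
  have gap: "AE w in P. real_cond_exp P F0 (feedback_cost z (\<lambda>t w. X' t w + D t w)) w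
    - expectation (averaged_cost l X') = expansion \<mu> l (\<lambda>t. z t w)"
    unfolding D_def
    by (rule conditional_cost_gap[OF F0 subalgebra_path[OF bm] ind X' z \<mu>b' \<mu>e \<mu>m l]) assumption+
  have Xm: "process_measurable T P X" and Ym: "process_measurable T P Y"
    using X Y by (simp_all add: state_process_def)
  note zm = L2_D(1)[OF z]
  have X'Dm: "process_measurable T P (\<lambda>t w. X' t w + D t w)"
    using borel_measurable_add[OF L2_D(1)[OF X'] L2_D(1)[OF D]]
    by (simp add: case_prod_beta')
  have YX: "AE w in P. Y t w = X' t w + D t w" if t: "t \<in> {0..T}" for t
    using state_difference[OF ps bm X Y z t] XX' by eventually_elim (use t in \<open>simp add: D_def\<close>)
  have YX': "AE w in P. AE t in ?L. Y t w = X' t w + D t w"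
    by (rule AE_time_swap[OF Ym X'Dm YX])
  have "AE w in P. feedback_cost z Y w = feedback_cost z (\<lambda>t w. X' t w + D t w) w"
    using YX[OF T_mem] YX' AE_space
  proof eventually_elim
    case (elim w)
    have "(\<integral>t. running_cost Q S R p q t (Y t w) (k t + K t * Y t w + z t w) \<partial>?L) =
      (\<integral>t. running_cost Q S R p q t (X' t w + D t w) (k t + K t * (X' t w + D t w) + z t w) \<partial>?L)"
      using elim(2) process_section[OF feedback_running_cost_measurable[OF Ym zm] elim(3)]
        process_section[OF feedback_running_cost_measurable[OF X'Dm zm] elim(3)]
      by (intro integral_cong_AE) auto
    then show ?case using elim(1) by (simp add: feedback_cost_def)
  qed
  then have c1: "AE w in P. real_cond_exp P F0 (feedback_cost z Y) w =
      real_cond_exp P F0 (feedback_cost z (\<lambda>t w. X' t w + D t w)) w"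
    by (rule real_cond_exp_cong[OF _ cost_measurable(1)[OF Ym zm] cost_measurable(1)[OF X'Dm zm]])
  have "AE w in P. averaged_cost l X w = averaged_cost l X' w"
    using XX'
  proof eventually_elim
    case (elim w)
    have "(\<integral>t. running_cost Q S R p q t (X t w) (k t + K t * X t w) + R t * l t \<partial>?L) =
        (\<integral>t. running_cost Q S R p q t (X' t w) (k t + K t * X' t w) + R t * l t \<partial>?L)"
      by (rule bochner_integral_cong) (use elim in auto)
    then show ?case using elim T_mem by (simp add: averaged_cost_def)
  qed
  then have c2: "expectation (averaged_cost l X) = expectation (averaged_cost l X')"
    by (rule integral_cong_AE[OF cost_measurable(2)[OF Xm l(1)] cost_measurable(2)[OF L2_D(1)[OF X'] l(1)]])
  have "AE w in P. real_cond_exp P F0 (feedback_cost z Y) w - expectation (averaged_cost l X) =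
      expansion \<mu> l (\<lambda>t. z t w)"
    unfolding c2 using c1 gap by eventually_elim simp
  from that[OF \<mu>m _ this] \<mu>b' show thesis by blast
qed

end

section \<open>From the policies to the state equations\<close>

text \<open>Expanding the polynomial around \<mu> leaves the central moments 1, 0 and
  \<open>v\<close>; zero variance is the point mass and is treated apart.\<close>

lemma normal_law_integral:
  assumes "v \<ge> 0"
  shows "(\<integral>a. c0 + c1 * a + c2 * a\<^sup>2 \<partial>normal_law \<mu> v) = c0 + c1 * \<mu> + c2 * (\<mu>\<^sup>2 + v)"
proof (cases "v = 0")
  case True
  then show ?thesis unfolding normal_law_def by (simp add: integral_return)
next
  case False
  then have \<sigma>: "sqrt v > 0" and sv: "(sqrt v)\<^sup>2 = v" using assms by auto
  let ?d = "normal_density \<mu> (sqrt v)"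
  have i0: "integrable lborel ?d" "(\<integral>x. ?d x \<partial>lborel) = 1"
    using \<sigma> by auto
  have i1: "integrable lborel (\<lambda>x. ?d x * (x - \<mu>))" "(\<integral>x. ?d x * (x - \<mu>) \<partial>lborel) = 0"
  proof -
    show i: "integrable lborel (\<lambda>x. ?d x * (x - \<mu>))"
      using integrable_normal_moment[OF \<sigma>, of \<mu> 1] by simp
    show "(\<integral>x. ?d x * (x - \<mu>) \<partial>lborel) = 0"
      using integral_normal_moment_odd[OF \<sigma>, of \<mu> 0] by simp
  qed
  have i2: "integrable lborel (\<lambda>x. ?d x * (x - \<mu>)\<^sup>2)" "(\<integral>x. ?d x * (x - \<mu>)\<^sup>2 \<partial>lborel) = v"
    using integrable_normal_moment[OF \<sigma>, of \<mu> 2] integral_normal_moment_even[OF \<sigma>, of \<mu> 1] sv by auto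
  have "(\<integral>a. c0 + c1 * a + c2 * a\<^sup>2 \<partial>normal_law \<mu> v) = (\<integral>x. ?d x * (c0 + c1 * x + c2 * x\<^sup>2) \<partial>lborel)"
    unfolding normal_law_def using False by (simp add: integral_density)
  also have "\<dots> = (\<integral>x. (c0 + c1 * \<mu> + c2 * \<mu>\<^sup>2) * ?d x + (c1 + 2 * c2 * \<mu>) * (?d x * (x - \<mu>)) + c2 * (?d x * (x - \<mu>)\<^sup>2) \<partial>lborel)"
    by (intro bochner_integral_cong refl) (simp add: power2_eq_square algebra_simps)
  also have "\<dots> = (c0 + c1 * \<mu> + c2 * \<mu>\<^sup>2) + c2 * v"
    using i0 i1 i2 by simp
  finally show ?thesis by (simp add: algebra_simps)
qed

lemma relaxed_drift_gaussian:
  "relaxed_drift A B (gaussian_policy k K lam) w t x = A * x + B * (k t + K t * x)"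
  unfolding relaxed_drift_def gaussian_policy_def
  using normal_law_integral[of "(lam t)\<^sup>2" "k t + K t * x" "A * x" B 0] by simp

lemma running_cost_gaussian:
  "(\<integral>a. running_cost Q S R p q t x a \<partial>gaussian_policy k K lam t x) =
    running_cost Q S R p q t x (k t + K t * x) + R t * (lam t)\<^sup>2"
proof -
  have "running_cost Q S R p q t x a = (Q t * x\<^sup>2 + 2 * p t * x) + (2 * S t * x + 2 * q t) * a + R t * a\<^sup>2" for a
    by (simp add: running_cost_def algebra_simps)
  then show ?thesis
    unfolding gaussian_policy_def
    using normal_law_integral[of "(lam t)\<^sup>2" "k t + K t * x" "Q t * x\<^sup>2 + 2 * p t * x" "2 * S t * x + 2 * q t" "R t"]
    by (simp add: algebra_simps)
qed

text \<open>Makes the costs of the given solutions measurable: they agree almost surely with costs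
  of jointly measurable modifications, while joint measurability of the solutions themselves is
  unknown.\<close>

lemma (in complete_measure) borel_measurable_AE_cong:
  fixes f g :: "'a \<Rightarrow> real"
  assumes g: "g \<in> borel_measurable M" and ae: "AE x in M. f x = g x"
  shows "f \<in> borel_measurable M"
proof (rule measurableI)
  fix B :: "real set" assume B: "B \<in> sets borel"
  obtain N where N: "{x \<in> space M. f x \<noteq> g x} \<subseteq> N" "N \<in> null_sets M"
    by (rule AE_E[OF ae]) (auto intro: null_setsI)
  have "f -` B \<inter> space M = ((g -` B \<inter> space M) - N) \<union> (f -` B \<inter> space M \<inter> N)"
    using N(1) by auto
  moreover have "f -` B \<inter> space M \<inter> N \<in> sets M" using complete[OF _ N(2)] by blast
  moreover have "g -` B \<inter> space M \<in> sets M" using g B by (rule measurable_sets)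
  ultimately show "f -` B \<inter> space M \<in> sets M" using N(2) by (metis null_setsD2 sets.Diff sets.Un)
qed simp

text \<open>Approximation by the process frozen at the last grid point of mesh
  \<open>1 / Suc n\<close>. Rounding down keeps the grid points inside \<open>{0..T}\<close>, where
  \<open>X\<close> is known to be measurable, and only countably many of them occur.\<close>

lemma continuous_process_measurable:
  fixes X :: "real \<Rightarrow> 'a \<Rightarrow> real"
  assumes "T > 0" and X: "\<And>t. t \<in> {0..T} \<Longrightarrow> X t \<in> borel_measurable M"
    and cont: "\<And>w. w \<in> space M \<Longrightarrow> continuous_on {0..T} (\<lambda>t. X t w)"
  shows "process_measurable T M X"
proof -
  let ?N = "leb T \<Otimes>\<^sub>M M"
  define \<delta> where "\<delta> = (\<lambda>(n::nat) t. \<lfloor>t * real (Suc n)\<rfloor>)"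
  have \<delta>: "0 \<le> real_of_int (\<delta> n t) / real (Suc n)" "real_of_int (\<delta> n t) / real (Suc n) \<le> t"
    "\<bar>real_of_int (\<delta> n t) / real (Suc n) - t\<bar> \<le> 1 / real (Suc n)" if "t \<in> {0..T}" for n t
  proof -
    have p: "real (Suc n) > 0" by simp
    have 1: "real_of_int (\<delta> n t) \<le> t * real (Suc n)" "t * real (Suc n) < real_of_int (\<delta> n t) + 1"
      unfolding \<delta>_def by linarith+
    show "0 \<le> real_of_int (\<delta> n t) / real (Suc n)" using that by (simp add: \<delta>_def)
    show 2: "real_of_int (\<delta> n t) / real (Suc n) \<le> t" using 1(1) p by (simp add: pos_divide_le_eq)
    have "t \<le> (real_of_int (\<delta> n t) + 1) / real (Suc n)" using 1(2) p by (simp add: pos_le_divide_eq)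
    then show "\<bar>real_of_int (\<delta> n t) / real (Suc n) - t\<bar> \<le> 1 / real (Suc n)"
      using 2 unfolding add_divide_distrib by linarith
  qed
  have step: "(\<lambda>x. X (real_of_int (\<delta> n (fst x)) / real (Suc n)) (snd x)) \<in> borel_measurable ?N" for n
  proof (rule measurable_compose_countable'[where f="\<lambda>i x. X (real_of_int i / real (Suc n)) (snd x)"
        and g="\<lambda>x. \<delta> n (fst x)" and I="{i. real_of_int i / real (Suc n) \<in> {0..T}}"])
    show "(\<lambda>x. X (real_of_int i / real (Suc n)) (snd x)) \<in> borel_measurable ?N"
      if "i \<in> {i. real_of_int i / real (Suc n) \<in> {0..T}}" for i
      using that by (intro measurable_compose[OF measurable_snd X]) auto
    have [measurable]: "(\<lambda>x. fst x) \<in> borel_measurable ?N"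
      using measurable_compose[OF measurable_fst measurable_time_ident] by simp
    have "(\<lambda>x. \<delta> n (fst x)) \<in> measurable ?N (count_space UNIV)" unfolding \<delta>_def by measurable
    moreover have "(\<lambda>x. \<delta> n (fst x)) \<in> space ?N \<rightarrow> {i. real_of_int i / real (Suc n) \<in> {0..T}}"
    proof
      fix x assume "x \<in> space ?N"
      then have "fst x \<in> {0..T}" by (auto simp: space_pair_measure)
      then show "\<delta> n (fst x) \<in> {i. real_of_int i / real (Suc n) \<in> {0..T}}"
        using \<delta>(1,2)[of "fst x" n] by auto
    qed
    ultimately show "(\<lambda>x. \<delta> n (fst x)) \<in> measurable ?N (count_space {i. real_of_int i / real (Suc n) \<in> {0..T}})"
      using measurable_restrict_space2[of "\<lambda>x. \<delta> n (fst x)" ?N "{i. real_of_int i / real (Suc n) \<in> {0..T}}" "count_space UNIV"]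
      by (simp add: restrict_count_space)
  qed auto
  have "(\<lambda>x. X (fst x) (snd x)) \<in> borel_measurable ?N"
  proof (rule borel_measurable_LIMSEQ_real[OF _ step])
    fix x assume "x \<in> space ?N"
    then have t: "fst x \<in> {0..T}" and w: "snd x \<in> space M" by (auto simp: space_pair_measure)
    have "(\<lambda>n. real_of_int (\<delta> n (fst x)) / real (Suc n) - fst x) \<longlonglongrightarrow> 0"
      by (rule Lim_null_comparison[OF _ lim_1_over_n[THEN LIMSEQ_Suc]])
        (use \<delta>(3)[OF t] in \<open>auto simp: eventually_sequentially\<close>)
    then have l: "(\<lambda>n. real_of_int (\<delta> n (fst x)) / real (Suc n)) \<longlonglongrightarrow> fst x" by (rule LIM_zero_cancel)
    show "(\<lambda>n. X (real_of_int (\<delta> n (fst x)) / real (Suc n)) (snd x)) \<longlonglongrightarrow> X (fst x) (snd x)"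
    proof (rule continuous_on_tendsto_compose[OF cont[OF w] l t], intro always_eventually allI)
      show "real_of_int (\<delta> n (fst x)) / real (Suc n) \<in> {0..T}" for n
        using \<delta>(1)[OF t, of n] order_trans[OF \<delta>(2)[OF t, of n], of T] t by simp
    qed
  qed
  then show ?thesis by (simp add: case_prod_beta')
qed

lemma noise_filtration_measurable:
  assumes X: "X \<in> borel_measurable (noise_filtration P F0 W t)" and F0: "subalgebra P F0"
    and W: "\<And>s. s \<in> {0..t} \<Longrightarrow> W s \<in> borel_measurable P"
  shows "X \<in> borel_measurable P"
proof (rule measurable_from_subalg[OF _ X], unfold subalgebra_def, intro conjI)
  have sub: "sets F0 \<union> path_events P t W \<union> null_sets P \<subseteq> sets P"
    using F0 measurable_sets[OF W] by (auto simp: subalgebra_def path_events_def)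
  then have pow: "sets F0 \<union> path_events P t W \<union> null_sets P \<subseteq> Pow (space P)"
    using sets.space_closed by blast
  show "space (noise_filtration P F0 W t) = space P"
    unfolding noise_filtration_def using pow by (rule space_measure_of)
  show "sets (noise_filtration P F0 W t) \<subseteq> sets P"
    unfolding noise_filtration_def sets_measure_of[OF pow] using sub by (rule sets.sigma_sets_subset)
qed

text \<open>The essential supremum is almost surely a bound in time, so clipping at it alters the
  function on a null set only. The absolute value makes \<open>b\<close> nonnegative without
  evaluating the essential supremum.\<close>

lemma Linf_clip:
  assumes "k \<in> Linf T"
  defines "b \<equiv> \<bar>real_of_ereal (Linf_norm T k)\<bar>"
  defines "k' \<equiv> \<lambda>t. max (- b) (min b (k t))"
  shows "k \<in> borel_measurable (leb T)" "k' \<in> borel_measurable (leb T)"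
    "\<bar>k' t\<bar> \<le> b" "AE t in leb T. k t = k' t"
proof -
  show [measurable]: "k \<in> borel_measurable (leb T)"
    using assms(1) by (simp add: Linf_def leb_def)
  show "k' \<in> borel_measurable (leb T)" unfolding k'_def by measurable
  show "\<bar>k' t\<bar> \<le> b"
  proof -
    have "b \<ge> 0" unfolding b_def by (rule abs_ge_zero)
    then show ?thesis by (auto simp: k'_def max_def min_def)
  qed
  have fin: "Linf_norm T k < \<infinity>" using assms(1) by (simp add: Linf_def)
  have "AE t in leb T. ereal \<bar>k t\<bar> \<le> Linf_norm T k"
    unfolding Linf_norm_def leb_def by (rule esssup_AE)
  then show "AE t in leb T. k t = k' t"
  proof eventually_elim
    case (elim t)
    then have "\<bar>k t\<bar> \<le> b" unfolding b_def using fin by (cases "Linf_norm T k") auto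
    then show ?case by (auto simp: k'_def)
  qed
qed

lemma continuous_bounded_on_interval:
  fixes f :: "real \<Rightarrow> real"
  assumes "continuous_on {0..T} f"
  shows "\<exists>c. \<forall>t\<in>{0..T}. \<bar>f t\<bar> \<le> c"
proof -
  have "bounded (f ` {0..T})" by (intro compact_imp_bounded compact_continuous_image assms) simp
  then show ?thesis unfolding bounded_iff by auto
qed

lemma continuous_time_measurable:
  fixes f :: "real \<Rightarrow> real"
  assumes "continuous_on {0..T} f"
  shows "f \<in> borel_measurable (leb T)"
  unfolding measurable_leb using assms by (rule borel_measurable_continuous_on_restrict)

lemma restrict_square_measurable:
  assumes "(\<lambda>(t, r). h t r :: real) \<in> borel_measurable (leb T \<Otimes>\<^sub>M leb T)"
  shows "(\<lambda>(t, r). h t r) \<in> borel_measurable (restrict_space borel ({0..T} \<times> {0..T}))"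
proof -
  let ?N = "restrict_space (borel :: (real \<times> real) measure) ({0..T} \<times> {0..T})"
  have "fst \<in> measurable (borel :: (real \<times> real) measure) borel" "snd \<in> measurable (borel :: (real \<times> real) measure) borel"
    unfolding borel_prod[symmetric] by (rule measurable_fst measurable_snd)+
  then have 1: "fst \<in> measurable ?N (restrict_space borel {0..T})" "snd \<in> measurable ?N (restrict_space borel {0..T})"
  proof -
    have "fst \<in> space ?N \<rightarrow> {0..T}" "snd \<in> space ?N \<rightarrow> {0..T}" by (auto simp: space_restrict_space)
    moreover assume "fst \<in> measurable (borel :: (real \<times> real) measure) borel" "snd \<in> measurable (borel :: (real \<times> real) measure) borel"
    ultimately show "fst \<in> measurable ?N (restrict_space borel {0..T})" "snd \<in> measurable ?N (restrict_space borel {0..T})"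
      by (auto intro: measurable_restrict_space2 measurable_restrict_space1)
  qed
  have "(\<lambda>x. (fst x, snd x)) \<in> measurable ?N (leb T \<Otimes>\<^sub>M leb T)"
    using 1 by (intro measurable_Pair) (auto simp: measurable_cong_sets[OF refl sets_leb])
  from measurable_compose[OF this assms] show ?thesis by (simp add: case_prod_beta')
qed

text \<open>Zeroing the paths on a null set that contains all discontinuous ones gives joint
  measurability, and exchanging the drift at almost every time absorbs the clipping of the policy.
  The drifts must agree for all \<open>x\<close> at once, since they are evaluated along the
  solution.\<close>

lemma (in lq_policy) sde_modification:
  assumes "prob_space P" and F0: "subalgebra P F0" and bm: "brownian_motion P T W"
    and X: "sde_solution P T F0 W x0 b \<sigma> X"
    and z: "process_measurable T P z"
    and b: "\<And>w. AE s in leb T. \<forall>x. b w s x = \<alpha> s * x + B * k s + B * z s w"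
  obtains X' where "state_process P W z X'" "AE w in P. \<forall>t\<in>{0..T}. X t w = X' t w"
proof -
  let ?L = "leb T"
  have W: "W s \<in> borel_measurable P" if "s \<in> {0..T}" for s
    using bm that by (simp add: brownian_motion_def)
  have cont: "AE w in P. continuous_on {0..T} (\<lambda>t. X t w)" using X by (simp add: sde_solution_def)
  obtain N where N: "{w \<in> space P. \<not> continuous_on {0..T} (\<lambda>t. X t w)} \<subseteq> N" "N \<in> null_sets P"
    by (rule AE_E[OF cont]) (auto intro: null_setsI)
  define X' where "X' = (\<lambda>t w. if w \<in> N then 0 else X t w)"
  have XX': "AE w in P. \<forall>t\<in>{0..T}. X t w = X' t w"
    using AE_not_in[OF N(2)] by eventually_elim (simp add: X'_def)
  have X'm: "process_measurable T P X'"
  proof (rule continuous_process_measurable[OF T])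
    fix t assume t: "t \<in> {0..T}"
    have "X t \<in> borel_measurable P"
      by (rule noise_filtration_measurable[where t=t, OF _ F0 W]) (use X t in \<open>auto simp: sde_solution_def\<close>)
    then show "X' t \<in> borel_measurable P"
      unfolding X'_def using N(2) by (intro measurable_If_set) auto
  next
    fix w assume "w \<in> space P"
    then show "continuous_on {0..T} (\<lambda>t. X' t w)"
      using N(1) by (cases "w \<in> N") (auto simp: X'_def)
  qed
  define f where "f = (\<lambda>s w. \<alpha> s * X' s w + B * k s + B * z s w)"
  have fm: "process_measurable T P f"
    unfolding f_def by (rule drift_measurable[OF X'm z])
  have "AE w in P. integrable ?L (\<lambda>s. b w s (X s w))"
    using X by (simp add: sde_solution_def set_integrable_time)
  then have bf: "AE w in P. integrable ?L (\<lambda>s. f s w) \<and> (\<forall>t. cumint T (\<lambda>s. b w s (X s w)) t = cumint T (\<lambda>s. f s w) t)"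
    using XX' AE_space
  proof eventually_elim
    case (elim w)
    have m: "(\<lambda>s. f s w) \<in> borel_measurable ?L" by (rule process_section[OF fm elim(3)])
    have ae: "AE s in ?L. b w s (X s w) = f s w"
      using b[of w] AE_space by eventually_elim (use elim(2) in \<open>simp add: f_def\<close>)
    have "integrable ?L (\<lambda>s. f s w)" by (rule integrable_cong_AE_imp[OF elim(1) m]) (use ae in auto)
    moreover have "cumint T (\<lambda>s. b w s (X s w)) t = cumint T (\<lambda>s. f s w) t" for t
      by (rule cumint_cong_AE[OF ae _ m]) (use elim(1) in auto)
    ultimately show ?case by blast
  qed
  have "state_process P W z X'" unfolding state_process_def f_def[symmetric]
  proof (intro conjI ballI)
    show "process_measurable T P X'" by (rule X'm)
    show "AE w in P. integrable ?L (\<lambda>s. \<alpha> s * X' s w + B * k s + B * z s w)"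
      using bf by eventually_elim (simp add: f_def)
    fix t assume t: "t \<in> {0..T}"
    then obtain I where I: "is_wiener_integral P W t \<sigma> I"
      "AE w in P. X t w = x0 + (LBINT s:{0..t}. b w s (X s w)) + I w"
      using X unfolding sde_solution_def by blast
    have "AE w in P. X' t w = x0 + cumint T (\<lambda>s. \<alpha> s * X' s w + B * k s + B * z s w) t + I w"
      using I(2) XX' bf
    proof eventually_elim
      case (elim w)
      then show ?case using t LBINT_time_upto[OF t, of "\<lambda>s. b w s (X s w)"] unfolding f_def by auto
    qed
    with I(1) show "\<exists>I. is_wiener_integral P W t \<sigma> I \<and>
      (AE w in P. X' t w = x0 + cumint T (\<lambda>s. \<alpha> s * X' s w + B * k s + B * z s w) t + I w)" by blast
  qed
  then show thesis using XX' by (rule that)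
qed

text \<open>The function \<open>C\<close> is quantified before the probability space, the policy and
  the noise; this expresses that the bounds depend only on the coefficients and on the two norms
  passed to it.\<close>

theorem lemma2p1:
  fixes T x0 A B M m :: real
    and \<sigma> Q S R p q :: "real \<Rightarrow> real"
  assumes "T > 0"
    and "continuous_on {0..T} \<sigma>" "continuous_on {0..T} Q" "continuous_on {0..T} S"
    and "continuous_on {0..T} R" "continuous_on {0..T} p" "continuous_on {0..T} q"
    and "M \<ge> 0"
    and "\<And>t. t \<in> {0..T} \<Longrightarrow> \<sigma> t > 0"
    and "\<And>t. t \<in> {0..T} \<Longrightarrow> R t > 0"
    and "\<And>t. t \<in> {0..T} \<Longrightarrow> Q t - (S t)\<^sup>2 * inverse (R t) \<ge> 0"
  shows "\<exists>C :: ereal \<Rightarrow> ereal \<Rightarrow> real.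
    \<forall>(P :: 'w measure) W F0 k K lam \<xi> X\<nu> X\<phi>.
      prob_space P \<and> complete_measure P \<and> brownian_motion P T W \<and>
      subalgebra P F0 \<and> indep_of_process P T W F0 \<and>
      k \<in> Linf T \<and> K \<in> Linf T \<and> lam \<in> Linf T \<and> (\<forall>t\<in>{0..T}. lam t \<ge> 0) \<and>
      policy_noise P T F0 \<xi> \<and>
      sde_solution P T F0 W x0 (relaxed_drift A B (gaussian_policy k K lam)) \<sigma> X\<nu> \<and>
      sde_solution P T F0 W x0 (randomised_drift A B (randomised_policy k K lam \<xi>)) \<sigma> X\<phi>
      \<longrightarrow>
      (\<exists>(h1 :: real \<Rightarrow> real) (h2 :: real \<Rightarrow> real) (h3 :: real \<Rightarrow> real \<Rightarrow> real).
        h1 \<in> borel_measurable (restrict_space borel {0..T}) \<and>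
        h2 \<in> borel_measurable (restrict_space borel {0..T}) \<and>
        (\<lambda>(t, r). h3 t r) \<in> borel_measurable (restrict_space borel ({0..T} \<times> {0..T})) \<and>
        (\<forall>t\<in>{0..T}. \<bar>h1 t\<bar> \<le> C (Linf_norm T k) (Linf_norm T K)) \<and>
        (\<forall>t\<in>{0..T}. \<bar>h2 t\<bar> \<le> C (Linf_norm T k) (Linf_norm T K)) \<and>
        (\<forall>t\<in>{0..T}. \<forall>r\<in>{0..T}. \<bar>h3 t r\<bar> \<le> C (Linf_norm T k) (Linf_norm T K)) \<and>
        (AE \<omega> in P.
          randomised_cost P T F0 (running_cost Q S R p q) (terminal_cost M m)
              (randomised_policy k K lam \<xi>) X\<phi> \<omega>
          - relaxed_cost P T (running_cost Q S R p q) (terminal_cost M m)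
              (gaussian_policy k K lam) X\<nu>
          = (LBINT t:{0..T}. h1 t * lam t * \<xi> \<omega> t)
            + (LBINT t:{0..T}. h2 t * (lam t)\<^sup>2 * ((\<xi> \<omega> t)\<^sup>2 - 1))
            + (LBINT t:{0..T}. (LBINT r:{0..T}.
                 h3 t r * lam r * lam t * \<xi> \<omega> r * \<xi> \<omega> t))))"
proof -
  let ?L = "leb T"
  \<comment> \<open>The sum of all moduli is one continuous function, so a single bound controls
    every coefficient.\<close>
  have "continuous_on {0..T} (\<lambda>t. \<bar>\<sigma> t\<bar> + \<bar>Q t\<bar> + \<bar>S t\<bar> + \<bar>R t\<bar> + \<bar>p t\<bar> + \<bar>q t\<bar> + \<bar>M\<bar> + \<bar>m\<bar>)"
    by (intro continuous_intros assms)
  then obtain \<Gamma> where "\<forall>t\<in>{0..T}. \<bar>\<bar>\<sigma> t\<bar> + \<bar>Q t\<bar> + \<bar>S t\<bar> + \<bar>R t\<bar> + \<bar>p t\<bar> + \<bar>q t\<bar> + \<bar>M\<bar> + \<bar>m\<bar>\<bar> \<le> \<Gamma>"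
    using continuous_bounded_on_interval by blast
  then have \<Gamma>: "\<bar>\<sigma> t\<bar> + \<bar>Q t\<bar> + \<bar>S t\<bar> + \<bar>R t\<bar> + \<bar>p t\<bar> + \<bar>q t\<bar> + \<bar>M\<bar> + \<bar>m\<bar> \<le> \<Gamma>" if "t \<in> {0..T}" for t
    using that by force
  \<comment> \<open>Outside the locale, \<open>lq_policy.hb\<close> is a function of exactly these
    parameters, so it can be chosen before any probabilistic datum is fixed.\<close>
  define C where "C = (\<lambda>kn Kn. lq_policy.hb T x0 A B \<Gamma> \<bar>real_of_ereal kn\<bar> \<bar>real_of_ereal Kn\<bar>)"
  show ?thesis
  proof (intro exI[of _ C] allI impI, elim conjE, goal_cases)
    case (1 P W F0 k K lam \<xi> X\<nu> X\<phi>)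
    note ps = 1(1) and compl = 1(2) and bm = 1(3) and F0 = 1(4) and ind = 1(5) and Linf = 1(6-8)
      and noise = 1(10) and sde\<nu> = 1(11) and sde\<phi> = 1(12)
    interpret prob_space P by (rule ps)
    interpret complete_measure P by (rule compl)
    have sub: "prob_space_subalgebra P F0" by unfold_locales (rule F0)
    interpret prob_space_subalgebra P F0 by (rule sub)
    \<comment> \<open>\<open>k\<close> and \<open>K\<close> obey their norm bounds only almost everywhere, whereas \<open>h1\<close> is a pointwise
      function of \<open>k\<close> and \<open>K\<close> and has to be bounded everywhere: clip them.\<close>
    define kb where "kb = \<bar>real_of_ereal (Linf_norm T k)\<bar>"
    define Kb where "Kb = \<bar>real_of_ereal (Linf_norm T K)\<bar>"
    define lb where "lb = \<bar>real_of_ereal (Linf_norm T lam)\<bar>"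
    define k' where "k' = (\<lambda>t. max (- kb) (min kb (k t)))"
    define K' where "K' = (\<lambda>t. max (- Kb) (min Kb (K t)))"
    define lam' where "lam' = (\<lambda>t. max (- lb) (min lb (lam t)))"
    have kc: "k \<in> borel_measurable ?L" "k' \<in> borel_measurable ?L"
      "\<And>t. \<bar>k' t\<bar> \<le> kb" "AE t in ?L. k t = k' t"
      unfolding k'_def kb_def by (rule Linf_clip[OF Linf(1)])+
    have Kc: "K \<in> borel_measurable ?L" "K' \<in> borel_measurable ?L"
      "\<And>t. \<bar>K' t\<bar> \<le> Kb" "AE t in ?L. K t = K' t"
      unfolding K'_def Kb_def by (rule Linf_clip[OF Linf(2)])+
    have lc: "lam \<in> borel_measurable ?L" "lam' \<in> borel_measurable ?L"
      "\<And>t. \<bar>lam' t\<bar> \<le> lb" "AE t in ?L. lam t = lam' t"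
      unfolding lam'_def lb_def by (rule Linf_clip[OF Linf(3)])+
    interpret lq_policy T x0 A B M m \<Gamma> kb Kb \<sigma> Q S R p q k' K'
    proof
      fix t assume t: "t \<in> {0..T}"
      show "\<bar>\<sigma> t\<bar> \<le> \<Gamma>" "\<bar>Q t\<bar> \<le> \<Gamma>" "\<bar>S t\<bar> \<le> \<Gamma>" "\<bar>R t\<bar> \<le> \<Gamma>" "\<bar>p t\<bar> \<le> \<Gamma>" "\<bar>q t\<bar> \<le> \<Gamma>"
        using \<Gamma>[OF t] by linarith+
      show "\<bar>k' t\<bar> \<le> kb" by (rule kc(3))
      show "\<bar>K' t\<bar> \<le> Kb" by (rule Kc(3))
    next
      show "\<bar>M\<bar> \<le> \<Gamma>" "\<bar>m\<bar> \<le> \<Gamma>" using \<Gamma>[of 0] \<open>T > 0\<close> by auto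
    qed (use assms kc(2) Kc(2) in \<open>auto intro: continuous_time_measurable\<close>)
    have Ceq: "C (Linf_norm T k) (Linf_norm T K) = hb" by (simp add: C_def kb_def Kb_def)
    \<comment> \<open>The noise and variance are built from the clipped \<open>lam'\<close>, whose
      boundedness at every time is what \<open>L2_noise\<close> asks for.\<close>
    define z where "z = (\<lambda>t w. lam' t * \<xi> w t)"
    define l where "l = (\<lambda>t. (lam' t)\<^sup>2)"
    have z: "L2_process P T F0 z" unfolding z_def by (rule L2_noise[OF ps noise lc(2,3)])
    have lm: "l \<in> borel_measurable ?L" unfolding l_def using lc(2) by simp
    have lbd: "\<bar>l t\<bar> \<le> lb * lb" for t
      unfolding l_def power2_eq_square by (intro abs_mult_bound lc(3))
    have zero: "(\<lambda>(t, w). 0 :: real) \<in> borel_measurable (?L \<Otimes>\<^sub>M P)" by simp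
    obtain X where X: "state_process P W (\<lambda>_ _. 0) X" and XX: "AE w in P. \<forall>t\<in>{0..T}. X\<nu> t w = X t w"
    proof (rule sde_modification[OF ps F0 bm sde\<nu> zero])
      show "AE s in ?L. \<forall>x. relaxed_drift A B (gaussian_policy k K lam) w s x = \<alpha> s * x + B * k' s + B * 0" for w
        using kc(4) Kc(4) by eventually_elim (simp add: relaxed_drift_gaussian \<alpha>_def algebra_simps)
    qed
    obtain Y where Y: "state_process P W z Y" and YY: "AE w in P. \<forall>t\<in>{0..T}. X\<phi> t w = Y t w"
    proof (rule sde_modification[OF ps F0 bm sde\<phi> L2_D(1)[OF z]])
      show "AE s in ?L. \<forall>x. randomised_drift A B (randomised_policy k K lam \<xi>) w s x = \<alpha> s * x + B * k' s + B * z s w" for w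
        using kc(4) Kc(4) lc(4)
        by eventually_elim (simp add: randomised_drift_def randomised_policy_def z_def \<alpha>_def algebra_simps)
    qed
    obtain \<mu> where \<mu>: "\<mu> \<in> borel_measurable ?L" "\<And>t. t \<in> {0..T} \<Longrightarrow> \<bar>\<mu> t\<bar> \<le> \<mu>b"
      and gap: "AE w in P. real_cond_exp P F0 (feedback_cost z Y) w - expectation (averaged_cost l X) =
        expansion \<mu> l (\<lambda>t. z t w)"
      using state_cost_gap[OF sub bm ind X Y z lm lbd] by blast
    have Xm: "process_measurable T P X" and Ym: "process_measurable T P Y"
      using X Y by (simp_all add: state_process_def)
    note zm = L2_D(1)[OF z]
    have \<xi>m: "(\<lambda>t. \<xi> w t) \<in> borel_measurable ?L" if "w \<in> space P" for w
      by (rule process_section[OF policy_noise_measurable[OF noise] that])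
    note [measurable] = kc(1) Kc(1) lc(1)
    have run_m: "(\<lambda>t. running_cost Q S R p q t (x t) (a t)) \<in> borel_measurable ?L"
      if [measurable]: "x \<in> borel_measurable ?L" "a \<in> borel_measurable ?L" for x a
      unfolding running_cost_def by measurable
    define V\<phi> where "V\<phi> = (\<lambda>w. (LBINT t:{0..T}. running_cost Q S R p q t (X\<phi> t w)
        (randomised_policy k K lam \<xi> w t (X\<phi> t w))) + terminal_cost M m (X\<phi> T w))"
    define V\<nu> where "V\<nu> = (\<lambda>w. (LBINT t:{0..T}. (\<integral>a. running_cost Q S R p q t (X\<nu> t w) a
        \<partial>gaussian_policy k K lam t (X\<nu> t w))) + terminal_cost M m (X\<nu> T w))"
    note U\<phi>m = cost_measurable(1)[OF Ym zm] and U\<nu>m = cost_measurable(2)[OF Xm lm]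
    have VU\<phi>: "AE w in P. V\<phi> w = feedback_cost z Y w"
      using YY AE_space
    proof eventually_elim
      case (elim w)
      have [measurable]: "(\<lambda>t. Y t w) \<in> borel_measurable ?L" "(\<lambda>t. \<xi> w t) \<in> borel_measurable ?L"
        by (rule process_section[OF Ym elim(2)], rule \<xi>m[OF elim(2)])
      have "(LBINT t:{0..T}. running_cost Q S R p q t (X\<phi> t w) (randomised_policy k K lam \<xi> w t (X\<phi> t w))) =
          (\<integral>t. running_cost Q S R p q t (Y t w) (k t + K t * Y t w + lam t * \<xi> w t) \<partial>?L)"
        unfolding LBINT_time randomised_policy_def
        by (rule bochner_integral_cong) (use elim(1) in auto)
      also have "\<dots> = (\<integral>t. running_cost Q S R p q t (Y t w) (k' t + K' t * Y t w + z t w) \<partial>?L)"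
      proof (rule integral_cong_AE)
        show "AE t in ?L. running_cost Q S R p q t (Y t w) (k t + K t * Y t w + lam t * \<xi> w t) =
            running_cost Q S R p q t (Y t w) (k' t + K' t * Y t w + z t w)"
          using kc(4) Kc(4) lc(4) by eventually_elim (simp add: z_def)
        show "(\<lambda>t. running_cost Q S R p q t (Y t w) (k' t + K' t * Y t w + z t w)) \<in> borel_measurable ?L"
          by (rule process_section[OF feedback_running_cost_measurable[OF Ym zm] elim(2)])
      qed (rule run_m; measurable)
      finally show ?case using elim(1) T_mem by (simp add: V\<phi>_def feedback_cost_def)
    qed
    have VU\<nu>: "AE w in P. V\<nu> w = averaged_cost l X w"
      using XX AE_space
    proof eventually_elim
      case (elim w)
      have [measurable]: "(\<lambda>t. X t w) \<in> borel_measurable ?L" by (rule process_section[OF Xm elim(2)])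
      have "(LBINT t:{0..T}. (\<integral>a. running_cost Q S R p q t (X\<nu> t w) a \<partial>gaussian_policy k K lam t (X\<nu> t w))) =
          (\<integral>t. running_cost Q S R p q t (X t w) (k t + K t * X t w) + R t * (lam t)\<^sup>2 \<partial>?L)"
        unfolding LBINT_time running_cost_gaussian
        by (rule bochner_integral_cong) (use elim(1) in auto)
      also have "\<dots> = (\<integral>t. running_cost Q S R p q t (X t w) (k' t + K' t * X t w) + R t * l t \<partial>?L)"
      proof (rule integral_cong_AE)
        show "AE t in ?L. running_cost Q S R p q t (X t w) (k t + K t * X t w) + R t * (lam t)\<^sup>2 =
            running_cost Q S R p q t (X t w) (k' t + K' t * X t w) + R t * l t"
          using kc(4) Kc(4) lc(4) by eventually_elim (simp add: l_def)
        show "(\<lambda>t. running_cost Q S R p q t (X t w) (k' t + K' t * X t w) + R t * l t) \<in> borel_measurable ?L"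
          by (rule process_section[OF averaged_running_cost_measurable[OF Xm lm] elim(2)])
        show "(\<lambda>t. running_cost Q S R p q t (X t w) (k t + K t * X t w) + R t * (lam t)\<^sup>2) \<in> borel_measurable ?L"
          by (intro borel_measurable_add run_m) measurable
      qed
      finally show ?case using elim(1) T_mem by (simp add: V\<nu>_def averaged_cost_def)
    qed
    \<comment> \<open>The congruence rule for conditional expectations asks both functions to be
      measurable; for \<open>V\<phi>\<close> this comes from completeness.\<close>
    have c\<phi>: "AE w in P. real_cond_exp P F0 V\<phi> w = real_cond_exp P F0 (feedback_cost z Y) w"
      by (rule real_cond_exp_cong[OF VU\<phi> borel_measurable_AE_cong[OF U\<phi>m VU\<phi>] U\<phi>m])
    have c\<nu>: "expectation V\<nu> = expectation (averaged_cost l X)"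
      by (rule integral_cong_AE[OF borel_measurable_AE_cong[OF U\<nu>m VU\<nu>] U\<nu>m VU\<nu>])
    have h1m: "h1 \<mu> \<in> borel_measurable ?L" by (rule h1_measurable[OF \<mu>(1)])
    have "AE w in P. randomised_cost P T F0 (running_cost Q S R p q) (terminal_cost M m)
            (randomised_policy k K lam \<xi>) X\<phi> w
        - relaxed_cost P T (running_cost Q S R p q) (terminal_cost M m) (gaussian_policy k K lam) X\<nu>
        = (LBINT t:{0..T}. h1 \<mu> t * lam t * \<xi> w t)
          + (LBINT t:{0..T}. R t * (lam t)\<^sup>2 * ((\<xi> w t)\<^sup>2 - 1))
          + (LBINT t:{0..T}. (LBINT r:{0..T}. h3 t r * lam r * lam t * \<xi> w r * \<xi> w t))"
      using c\<phi> gap AE_space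
    proof eventually_elim
      case (elim w)
      have [measurable]: "(\<lambda>t. \<xi> w t) \<in> borel_measurable ?L" "(\<lambda>t. z t w) \<in> borel_measurable ?L"
        by (rule \<xi>m[OF elim(3)], rule process_section[OF zm elim(3)])
      note [measurable] = h1m lm
      \<comment> \<open>The clipped quantities are traded back for \<open>lam\<close> inside the
        integrals, while the kernels keep the clipped \<open>k'\<close> and
        \<open>K'\<close>.\<close>
      have lz: "AE t in ?L. lam t * \<xi> w t = z t w \<and> (lam t)\<^sup>2 = l t"
        using lc(4) by eventually_elim (simp add: z_def l_def)
      have 1: "(LBINT t:{0..T}. h1 \<mu> t * lam t * \<xi> w t) = (\<integral>t. h1 \<mu> t * z t w \<partial>?L)"
        unfolding LBINT_time by (rule integral_cong_AE) (use lz in \<open>auto simp: mult.assoc\<close>)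
      have 2: "(LBINT t:{0..T}. R t * (lam t)\<^sup>2 * ((\<xi> w t)\<^sup>2 - 1)) = (\<integral>t. R t * ((z t w)\<^sup>2 - l t) \<partial>?L)"
        unfolding LBINT_time
      proof (rule integral_cong_AE)
        show "AE t in ?L. R t * (lam t)\<^sup>2 * ((\<xi> w t)\<^sup>2 - 1) = R t * ((z t w)\<^sup>2 - l t)"
          using lc(4) by eventually_elim (simp add: z_def l_def power_mult_distrib algebra_simps)
      qed auto
      have in3: "(\<integral>r. h3 t r * lam r * lam t * \<xi> w r * \<xi> w t \<partial>?L) =
          lam t * \<xi> w t * (\<integral>r. h3 t r * z r w \<partial>?L)" if t: "t \<in> {0..T}" for t
      proof -
        have [measurable]: "h3 t \<in> borel_measurable ?L" by (rule time_kernel_sections(1)[OF h3_measurable t])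
        have "(\<integral>r. h3 t r * lam r * lam t * \<xi> w r * \<xi> w t \<partial>?L) = (\<integral>r. lam t * \<xi> w t * (h3 t r * z r w) \<partial>?L)"
        proof (rule integral_cong_AE)
          show "AE r in ?L. h3 t r * lam r * lam t * \<xi> w r * \<xi> w t = lam t * \<xi> w t * (h3 t r * z r w)"
            using lc(4) by eventually_elim (simp add: z_def)
        qed auto
        then show ?thesis by simp
      qed
      have [measurable]: "(\<lambda>t. \<integral>r. h3 t r * z r w \<partial>?L) \<in> borel_measurable ?L"
      proof (rule time.borel_measurable_lebesgue_integral)
        show "process_measurable T ?L (\<lambda>t r. h3 t r * z r w)"
          using borel_measurable_times[OF h3_measurable measurable_compose[OF measurable_snd process_section[OF zm elim(3)]]]
          by (simp add: case_prod_beta')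
      qed
      have "(LBINT t:{0..T}. (LBINT r:{0..T}. h3 t r * lam r * lam t * \<xi> w r * \<xi> w t)) =
          (\<integral>t. lam t * \<xi> w t * (\<integral>r. h3 t r * z r w \<partial>?L) \<partial>?L)"
        unfolding LBINT_time by (rule bochner_integral_cong) (use in3 in auto)
      also have "\<dots> = (\<integral>t. (\<integral>r. h3 t r * z r w * z t w \<partial>?L) \<partial>?L)"
      proof (rule integral_cong_AE)
        show "AE t in ?L. lam t * \<xi> w t * (\<integral>r. h3 t r * z r w \<partial>?L) = (\<integral>r. h3 t r * z r w * z t w \<partial>?L)"
          using lz by eventually_elim simp
      qed auto
      finally have 3: "(LBINT t:{0..T}. (LBINT r:{0..T}. h3 t r * lam r * lam t * \<xi> w r * \<xi> w t)) =
          (\<integral>t. (\<integral>r. h3 t r * z r w * z t w \<partial>?L) \<partial>?L)" .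
      show ?case
        unfolding 1 2 3 randomised_cost_def relaxed_cost_def V\<phi>_def[symmetric] V\<nu>_def[symmetric] c\<nu>
        using elim(1,2) by (simp add: expansion_def)
    qed
    moreover have "h1 \<mu> \<in> borel_measurable (restrict_space borel {0..T})" "R \<in> borel_measurable (restrict_space borel {0..T})"
      using h1m coeff_meas(4) by (simp_all add: measurable_leb)
    moreover have "(\<lambda>(t, r). h3 t r) \<in> borel_measurable (restrict_space borel ({0..T} \<times> {0..T}))"
      by (rule restrict_square_measurable[OF h3_measurable])
    moreover have "\<bar>h1 \<mu> t\<bar> \<le> hb" if "t \<in> {0..T}" for t
      using h1_bound[of \<mu> t] \<mu>(2) that hb_bounds(1) by fastforce
    moreover have "\<bar>R t\<bar> \<le> hb" if "t \<in> {0..T}" for t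
      by (rule order_trans[OF coeff_bound(4)[OF that] hb_bounds(2)])
    moreover have "\<bar>h3 t r\<bar> \<le> hb" if "t \<in> {0..T}" "r \<in> {0..T}" for t r
      by (rule order_trans[OF h3_bound[OF that] hb_bounds(3)])
    \<comment> \<open>The witness for \<open>h2\<close> is \<open>R\<close>, the coefficient of the
      squared action, whose noise enters as \<open>z\<^sup>2\<close> minus its variance.\<close>
    ultimately show ?case
      unfolding Ceq by (intro exI[of _ "h1 \<mu>"] exI[of _ R] exI[of _ h3] conjI ballI)
  qed
qed

end
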